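(* Let $1<p<\infty$. Then, for each $u\in W^{1,p}(\mathbb{R}^n)$, $$D^s u \to Du \quad \text{in } L^p(\mathbb{R}^n,\mathbb{R}^n) \text{ as } s\nearrow 1 \quad (0<s<1).$$
   Context: For $0<s<1$ let $$c_{n,s}=(n+s-1)\frac{\Gamma\left(\frac{n+s-1}{2}\right)}{\pi^{n/2}\,2^{1-s}\,\Gamma\left(\frac{1-s}{2}\right)}.$$ For $u\in C_c^\infty(\mathbb{R}^n)$ the $s$-fractional gradient $D^su:\mathbb{R}^n\to\mathbb{R}^n$ is given by the absolutely convergent integral $$D^su(x)=c_{n,s}\int_{\mathbb{R}^n}\frac{u(x)-u(y)}{|x-y|^{n+s}}\frac{x-y}{|x-y|}\,dy .$$ For $1\le p<\infty$ and $u\in L^p(\mathbb{R}^n)$ such that there is a sequence $\{u_j\}\subset C_c^\infty(\mathbb{R}^n)$ with $u_j\to u$ in $L^p(\mathbb{R}^n)$ and $\{D^su_j\}$ Cauchy in $L^p(\mathbb{R}^n,\mathbb{R}^n)$, $D^su$ is defined as the $L^p$ limit of $D^su_j$ (this is independent of the chosen sequence and of $p$). $D^su$ is defined in this sense for every $u\in W^{1,p}(\mathbb{R}^n)$. $Du$ denotes the weak gradient. *)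

theory Defs
  imports "HOL-Analysis.Analysis"
begin

text \<open>
  Euclidean space of dimension \<open>n \<ge> 1\<close> is an arbitrary type \<open>'a::euclidean_space\<close> with
  \<open>n = DIM('a)\<close>.  Elements of \<open>L\<^sup>p\<close> are represented by functions, and statements about them are
  insensitive to changes on null sets.
\<close>

primrec C_k :: "nat \<Rightarrow> ('a::euclidean_space \<Rightarrow> real) \<Rightarrow> bool" where
  "C_k 0 u \<longleftrightarrow> continuous_on UNIV u"
| "C_k (Suc k) u \<longleftrightarrow> (\<forall>x. u differentiable (at x)) \<and>
      (\<forall>b\<in>Basis. C_k k (\<lambda>x. frechet_derivative u (at x) b))"

definition Cc_infinity :: "('a::euclidean_space \<Rightarrow> real) set" where
  "Cc_infinity = {u. (\<forall>k. C_k k u) \<and> compact (closure {x. u x \<noteq> 0})}"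

definition Lp :: "real \<Rightarrow> ('a::euclidean_space \<Rightarrow> 'b::euclidean_space) set" where
  "Lp p = {f. f \<in> borel_measurable lebesgue \<and> integrable lebesgue (\<lambda>x. norm (f x) powr p)}"

definition Lp_norm :: "real \<Rightarrow> ('a::euclidean_space \<Rightarrow> 'b::euclidean_space) \<Rightarrow> real" where
  "Lp_norm p f = (LINT x|lebesgue. norm (f x) powr p) powr (1 / p)"

text \<open>
  Membership in \<open>Lp p\<close> is required separately, since the Bochner integral of a function that is
  not integrable is \<open>0\<close>.
\<close>

definition tendsto_Lp ::
  "real \<Rightarrow> ('i \<Rightarrow> 'a::euclidean_space \<Rightarrow> 'b::euclidean_space) \<Rightarrow> ('a \<Rightarrow> 'b) \<Rightarrow> 'i filter \<Rightarrow> bool" where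
  "tendsto_Lp p f l F \<longleftrightarrow> (\<forall>\<^sub>F i in F. f i \<in> Lp p) \<and> l \<in> Lp p \<and>
     ((\<lambda>i. Lp_norm p (\<lambda>x. f i x - l x)) \<longlongrightarrow> 0) F"

definition locally_integrable :: "('a::euclidean_space \<Rightarrow> 'b::euclidean_space) \<Rightarrow> bool" where
  "locally_integrable f \<longleftrightarrow> (\<forall>K. compact K \<longrightarrow> set_integrable lebesgue K f)"

definition has_weak_gradient :: "('a::euclidean_space \<Rightarrow> real) \<Rightarrow> ('a \<Rightarrow> 'a) \<Rightarrow> bool" where
  "has_weak_gradient u g \<longleftrightarrow> locally_integrable u \<and> locally_integrable g \<and>
     (\<forall>\<phi>\<in>Cc_infinity. \<forall>b\<in>Basis.
        (LINT x|lebesgue. u x * frechet_derivative \<phi> (at x) b)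
          = - (LINT x|lebesgue. (g x \<bullet> b) * \<phi> x))"

text \<open>The weak gradient is unique up to a null set; the choice fixes a representative.\<close>

definition weak_gradient :: "('a::euclidean_space \<Rightarrow> real) \<Rightarrow> 'a \<Rightarrow> 'a" where
  "weak_gradient u = (SOME g. has_weak_gradient u g)"

definition W1p :: "real \<Rightarrow> ('a::euclidean_space \<Rightarrow> real) set" where
  "W1p p = {u \<in> Lp p. \<exists>g\<in>Lp p. has_weak_gradient u g}"

definition frac_const :: "nat \<Rightarrow> real \<Rightarrow> real" where
  "frac_const n s = (real n + s - 1) *
     (Gamma ((real n + s - 1) / 2) /
       (pi powr (real n / 2) * 2 powr (1 - s) * Gamma ((1 - s) / 2)))"

text \<open>
  The \<open>s\<close>-fractional gradient on test functions.  At \<open>y = x\<close> the integrand is \<open>0\<close> by the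
  convention \<open>0 / 0 = 0\<close>; this is a null set.
\<close>

definition frac_gradient_Cc :: "real \<Rightarrow> ('a::euclidean_space \<Rightarrow> real) \<Rightarrow> 'a \<Rightarrow> 'a" where
  "frac_gradient_Cc s u x = frac_const DIM('a) s *\<^sub>R
     (LINT y|lebesgue. ((u x - u y) / norm (x - y) powr (real DIM('a) + s)) *\<^sub>R
                         ((x - y) /\<^sub>R norm (x - y)))"

text \<open>
  The extension by \<open>L\<^sup>p\<close> limits.  That the sequence of fractional gradients is Cauchy in \<open>L\<^sup>p\<close> is
  expressed by the existence of its limit \<open>v\<close>.
\<close>

definition has_frac_gradient ::
  "real \<Rightarrow> real \<Rightarrow> ('a::euclidean_space \<Rightarrow> real) \<Rightarrow> ('a \<Rightarrow> 'a) \<Rightarrow> bool" where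
  "has_frac_gradient p s u v \<longleftrightarrow>
     (\<exists>U. (\<forall>j. U j \<in> Cc_infinity) \<and> tendsto_Lp p U u sequentially \<and>
          tendsto_Lp p (\<lambda>j. frac_gradient_Cc s (U j)) v sequentially)"

definition frac_gradient :: "real \<Rightarrow> real \<Rightarrow> ('a::euclidean_space \<Rightarrow> real) \<Rightarrow> 'a \<Rightarrow> 'a" where
  "frac_gradient p s u = (SOME v. has_frac_gradient p s u v)"

end

theory Submission
  imports Defs
begin

text \<open>
  For \<open>u \<in> W\<^sup>1\<^sup>p\<close> the defining integral of \<open>D\<^sup>su\<close> converges absolutely almost everywhere: after the
  substitution \<open>y = x - z\<close> the integrand is \<open>u x - u (x - z)\<close> times a kernel of size \<open>|z|^(-n-s)\<close>,
  and \<open>u - u(\<cdot> - z)\<close> is of order \<open>|z|\<close> in \<open>L\<^sup>p\<close> for small \<open>z\<close> and bounded for large \<open>z\<close>.  By density of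
  test functions in \<open>W\<^sup>1\<^sup>p\<close> this integral is the \<open>L\<^sup>p\<close> limit that defines \<open>D\<^sup>su\<close>; integration by parts
  against test functions shows that the limit is unique.

  To pass to the limit, fix \<open>d > 0\<close> and replace \<open>u x - u (x - z)\<close> by \<open>Du x \<bullet> z\<close> for \<open>|z| < d\<close>.  The
  error is \<open>o(|z|)\<close> in \<open>L\<^sup>p\<close> because translations are continuous in \<open>L\<^sup>p\<close>; by symmetry of the kernel the
  main term is a multiple of \<open>Du\<close>.  Since the normalising constant is asymptotic to \<open>(1 - s) / \<omega>\<^sub>n\<close>, with
  \<open>\<omega>\<^sub>n\<close> the volume of the unit ball, this multiple tends to \<open>1\<close> as \<open>s \<rightarrow> 1\<close>, while the part with
  \<open>|z| \<ge> d\<close> tends to \<open>0\<close>.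
\<close>

section \<open>Integrals of powers of the norm\<close>

text \<open>\<open>frac_gradient\<close> and \<open>weak_gradient\<close> are choices among
  functions that agree only almost everywhere, so nothing can be computed from them before
  uniqueness is known. For the fractional gradient the obstacle is that \<open>D^s phi\<close> of a
  test function need not have compact support; it does lie in every \<open>L^r\<close> with
  \<open>r \<ge> 1\<close>, hence in the dual exponent of \<open>p\<close>, and this duality is
  where \<open>1 < p\<close> enters. The limit depends on the order of choices. The bound for the
  error from \<open>|z| < d\<close> does not improve as \<open>s\<close> tends to 1: the weight
  \<open>|z|^(1-n-s)\<close> has mass of order \<open>1/(1-s)\<close>, which the normalising
  constant just balances, and what remains is the modulus of continuity of \<open>Du\<close> under
  translations shorter than \<open>d\<close>. Hence \<open>d\<close> is fixed by the prescribed
  accuracy before \<open>s\<close> moves. The factor \<open>n\<close> in the sphere area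
  \<open>n omega_n\<close> is cancelled by the \<open>1/n\<close> that comes from averaging
  \<open>(g . z) z\<close> over all directions. Tonelli's theorem needs
  \<open>(x, z) -> u (x - z)\<close> measurable on a product, so Sobolev functions are replaced by
  Borel representatives.\<close>

lemma powr_add_le:
  fixes a b p :: real
  assumes "0 \<le> a" "0 \<le> b" "0 \<le> p"
  shows "(a + b) powr p \<le> 2 powr p * (a powr p + b powr p)"
proof -
  have "(a + b) powr p \<le> (2 * max a b) powr p"
    using assms by (intro powr_mono2) auto
  also have "\<dots> = 2 powr p * max a b powr p"
    using assms by (subst powr_mult) auto
  also have "max a b powr p \<le> a powr p + b powr p"
    by (auto simp: max_def)
  finally show ?thesis by simp
qed

lemma le_1_plus_powr:
  fixes a p :: real
  assumes "1 \<le> p"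
  shows "a \<le> 1 + a powr p"
proof (cases "a \<le> 1")
  case False
  then have "a powr 1 \<le> a powr p" using assms by (intro powr_mono) auto
  then show ?thesis using False by simp
qed (simp add: add_increasing2)

text \<open>Convexity of the power function: its graph lies above the tangent at \<open>t\<close>.
  For \<open>p > 1\<close> this is Young's inequality for \<open>a\<close> and
  \<open>t powr (p - 1)\<close> with conjugate exponents; for \<open>p = 1\<close> both sides
  agree.\<close>

lemma powr_tangent_le:
  fixes a t p :: real
  assumes "1 \<le> p" "0 \<le> a" "0 < t"
  shows "t powr p + p * t powr (p - 1) * (a - t) \<le> a powr p"
proof (cases "p = 1")
  case False
  with assms have p: "1 < p" by simp
  define q where "q = p / (p - 1)"
  have q: "1 < q" "1 / p + 1 / q = 1" "(p - 1) * q = p"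
    using p by (auto simp: q_def field_simps)
  have "a * t powr (p - 1) \<le> a powr p / p + (t powr (p - 1)) powr q / q"
    using p q assms by (intro Youngs_inequality) auto
  also have "(t powr (p - 1)) powr q = t powr p"
    by (simp add: powr_powr q)
  also have "t powr p / q = t powr p * (1 - 1 / p)"
  proof -
    have "1 / q = 1 - 1 / p" using q(2) by simp
    then have "t powr p * (1 / q) = t powr p * (1 - 1 / p)" by simp
    then show ?thesis by simp
  qed
  finally have "p * (a * t powr (p - 1)) \<le> p * (a powr p / p + t powr p * (1 - 1 / p))"
    using p by (intro mult_left_mono) auto
  then have 1: "p * (a * t powr (p - 1)) \<le> a powr p + (p - 1) * t powr p"
  proof -
    have "p * (a powr p / p + t powr p * (1 - 1 / p)) = a powr p + (p - 1) * t powr p"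
      using p by (simp add: field_simps)
    then show ?thesis using \<open>p * _ \<le> _\<close> by simp
  qed
  have "t powr p = t powr (p - 1) * t"
    using assms by (simp add: powr_diff)
  with 1 show ?thesis by (simp add: algebra_simps)
qed (use assms in auto)

text \<open>The tangent inequality at the mean, integrated against \<open>k\<close>, gives Jensen's
  inequality. The weight need not be normalised; its mass bound \<open>K\<close> accounts for the
  factor \<open>K powr (p - 1)\<close>. If the integral on the right is infinite,
  \<open>0 < K\<close> makes the whole right-hand side infinite.\<close>

lemma
  fixes f :: "'a \<Rightarrow> 'b::euclidean_space" and k :: "'a \<Rightarrow> real"
  assumes [measurable]: "f \<in> borel_measurable M" "k \<in> borel_measurable M"
    and k: "\<And>z. 0 \<le> k z" and K: "(\<integral>\<^sup>+z. k z \<partial>M) \<le> ennreal K" "0 < K" and p: "1 \<le> p"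
  shows integrable_weighted_powr:
      "(\<integral>\<^sup>+z. ennreal (k z) * ennreal (norm (f z) powr p) \<partial>M) < \<infinity> \<Longrightarrow>
        integrable M (\<lambda>z. k z *\<^sub>R f z)" (is "?fin \<Longrightarrow> ?int")
    and jensen_powr: "ennreal (norm (LINT z|M. k z *\<^sub>R f z) powr p)
        \<le> ennreal (K powr (p - 1)) * (\<integral>\<^sup>+z. ennreal (k z) * ennreal (norm (f z) powr p) \<partial>M)"
proof -
  have le: "norm (k z *\<^sub>R f z) \<le> k z + k z * norm (f z) powr p" for z
  proof -
    have "norm (f z) \<le> 1 + norm (f z) powr p" by (rule le_1_plus_powr[OF p])
    then have "k z * norm (f z) \<le> k z * (1 + norm (f z) powr p)"
      by (intro mult_left_mono k)
    then show ?thesis using k[of z] by (simp add: algebra_simps)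
  qed
  have ik: "integrable M k"
    using K k by (intro integrableI_nonneg) (auto intro: le_less_trans)
  have ikp: "integrable M (\<lambda>z. k z * norm (f z) powr p)" if ?fin
    using that k by (intro integrableI_nonneg) (auto simp: ennreal_mult)
  show int: ?int if ?fin
    by (rule Bochner_Integration.integrable_bound[OF Bochner_Integration.integrable_add[OF ik ikp[OF that]]])
       (use le k in \<open>auto intro!: AE_I2 order_trans[OF le]\<close>)
  show "ennreal (norm (LINT z|M. k z *\<^sub>R f z) powr p)
        \<le> ennreal (K powr (p - 1)) * (\<integral>\<^sup>+z. ennreal (k z) * ennreal (norm (f z) powr p) \<partial>M)"
  proof (cases "?fin")
    case True
    note ikp = ikp[OF True] and int = int[OF True]
    define m where "m = (LINT z|M. k z * norm (f z))"
    have im: "integrable M (\<lambda>z. k z * norm (f z))"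
      using integrable_norm[OF int] k by simp
    have nm: "norm (LINT z|M. k z *\<^sub>R f z) \<le> m"
      using integral_norm_bound[of M "\<lambda>z. k z *\<^sub>R f z"] k by (simp add: m_def)
    have m0: "0 \<le> m" using nm by (meson norm_ge_zero order_trans)
    have kK: "(LINT z|M. k z) \<le> K"
    proof -
      have "ennreal (LINT z|M. k z) \<le> ennreal K"
        using K nn_integral_eq_integral[OF ik] k by simp
      then show ?thesis using K by simp
    qed
    have "m powr p \<le> K powr (p - 1) * (LINT z|M. k z * norm (f z) powr p)"
    proof (cases "m = 0")
      case True
      then show ?thesis using k by (auto intro!: mult_nonneg_nonneg integral_nonneg)
    next
      case False
      with m0 have m: "0 < m" by simp
      \<comment> \<open>The point of tangency is the mean of \<open>norm (f z)\<close> as if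
        \<open>k\<close> had mass exactly \<open>K\<close>.\<close>
      define t where "t = m / K"
      have t: "0 < t" using m K by (simp add: t_def)
      have "(LINT z|M. k z * (t powr p + p * t powr (p - 1) * (norm (f z) - t)))
          \<le> (LINT z|M. k z * norm (f z) powr p)"
      proof (intro integral_mono ikp mult_left_mono powr_tangent_le k p t norm_ge_zero)
        have "integrable M (\<lambda>z. (t powr p - p * t powr (p - 1) * t) * k z
            + (p * t powr (p - 1)) * (k z * norm (f z)))"
          by (intro Bochner_Integration.integrable_add integrable_mult_right ik im)
        then show "integrable M (\<lambda>z. k z * (t powr p + p * t powr (p - 1) * (norm (f z) - t)))"
          by (rule back_subst[where P="integrable M"]) (auto simp: algebra_simps)
      qed
      also have "(\<lambda>z. k z * (t powr p + p * t powr (p - 1) * (norm (f z) - t))) =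
          (\<lambda>z. (t powr p - p * t powr (p - 1) * t) * k z
            + (p * t powr (p - 1)) * (k z * norm (f z)))"
        by (auto simp: algebra_simps)
      also have "(LINT z|M. \<dots> z) = (t powr p - p * t powr (p - 1) * t) * (LINT z|M. k z)
            + (p * t powr (p - 1)) * m"
        unfolding m_def by (subst Bochner_Integration.integral_add)
          (auto intro!: integrable_mult_right ik im)
      finally have 1: "(t powr p - p * t powr (p - 1) * t) * (LINT z|M. k z)
            + (p * t powr (p - 1)) * m \<le> (LINT z|M. k z * norm (f z) powr p)" .
      have tp: "t powr (p - 1) * t = t powr p" using t by (simp add: powr_diff)
      have mt: "m = t * K" using K by (simp add: t_def)
      have "K * t powr p = (t powr p - p * t powr p) * K + p * t powr p * K"
        by (simp add: algebra_simps)
      \<comment> \<open>The actual mass may be smaller than \<open>K\<close>; since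
        \<open>p \<ge> 1\<close> the coefficient is nonpositive, so replacing \<open>K\<close> by
        the smaller mass can only increase the product.\<close>
      also have "(t powr p - p * t powr p) * K \<le> (t powr p - p * t powr p) * (LINT z|M. k z)"
        using kK p by (intro mult_left_mono_neg) (auto simp: mult_le_cancel_right1)
      also have "\<dots> + p * t powr p * K =
          (t powr p - p * t powr (p - 1) * t) * (LINT z|M. k z) + (p * t powr (p - 1)) * m"
        unfolding mt by (simp add: mult.assoc flip: tp)
      also note 1
      finally have "K * t powr p \<le> (LINT z|M. k z * norm (f z) powr p)" by simp
      then have "K powr (p - 1) * (K * t powr p) \<le> K powr (p - 1) * (LINT z|M. k z * norm (f z) powr p)"
        by (intro mult_left_mono) auto
      also have "K powr (p - 1) * (K * t powr p) = (K powr (p - 1) * K) * t powr p" by simp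
      also have "\<dots> = K powr p * t powr p" using K by (simp add: powr_diff)
      also have "\<dots> = m powr p" using K t by (simp add: mt powr_mult)
      finally show ?thesis .
    qed
    with nm p have "norm (LINT z|M. k z *\<^sub>R f z) powr p \<le>
        K powr (p - 1) * (LINT z|M. k z * norm (f z) powr p)"
      by (meson order_trans powr_mono2 norm_ge_zero zero_le_one)
    then have "ennreal (norm (LINT z|M. k z *\<^sub>R f z) powr p) \<le>
        ennreal (K powr (p - 1) * (LINT z|M. k z * norm (f z) powr p))"
      by (rule ennreal_leI)
    also have "\<dots> = ennreal (K powr (p - 1)) * (\<integral>\<^sup>+z. ennreal (k z * norm (f z) powr p) \<partial>M)"
      using k ikp by (subst nn_integral_eq_integral) (auto simp: ennreal_mult intro!: integral_nonneg)
    finally show ?thesis using k by (simp add: ennreal_mult)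
  next
    case False
    then have "(\<integral>\<^sup>+z. ennreal (k z) * ennreal (norm (f z) powr p) \<partial>M) = \<infinity>"
      by (simp add: less_top[symmetric])
    then show ?thesis using K by (simp add: ennreal_mult_top)
  qed
qed

text \<open>Working with \<open>p\<close>-th powers in place of norms replaces Minkowski's inequality by the elementary
  \<open>modular_add\<close> below, whose factor \<open>2 powr p\<close> does not matter for convergence.\<close>

definition modular :: "real \<Rightarrow> ('a::euclidean_space \<Rightarrow> 'b::euclidean_space) \<Rightarrow> ennreal" where
  "modular p f = (\<integral>\<^sup>+x. ennreal (norm (f x) powr p) \<partial>lborel)"

text \<open>Completing the measure does not change the nonnegative integral of any function, so
  \<open>lborel\<close> can be used for translations and Tonelli's theorem, and
  \<open>lebesgue\<close> for arguments with null sets.\<close>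

lemma modular_lebesgue: "modular p f = (\<integral>\<^sup>+x. ennreal (norm (f x) powr p) \<partial>lebesgue)"
  by (simp add: modular_def nn_integral_completion)

lemma modular_cong_AE: "AE x in lebesgue. f x = g x \<Longrightarrow> modular p f = modular p g"
  unfolding modular_lebesgue by (intro nn_integral_cong_AE, erule eventually_mono) simp

lemma modular_mono:
  "0 \<le> p \<Longrightarrow> AE x in lebesgue. norm (f x) \<le> norm (g x) \<Longrightarrow> modular p f \<le> modular p g"
  unfolding modular_lebesgue
  by (intro nn_integral_mono_AE, erule eventually_mono) (intro ennreal_leI powr_mono2, auto)

lemma borel_lebesgue: "f \<in> borel_measurable borel \<Longrightarrow> f \<in> borel_measurable lebesgue"
  by (rule measurable_completion) simp

lemma modular_add:
  assumes "f \<in> borel_measurable lebesgue" "g \<in> borel_measurable lebesgue" "0 \<le> p"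
  shows "modular p (\<lambda>x. f x + g x) \<le> ennreal (2 powr p) * (modular p f + modular p g)"
proof -
  note [measurable] = assms(1,2)
  have "modular p (\<lambda>x. f x + g x) \<le>
      (\<integral>\<^sup>+x. ennreal (2 powr p) * (ennreal (norm (f x) powr p) + ennreal (norm (g x) powr p)) \<partial>lebesgue)"
    unfolding modular_lebesgue
  proof (intro nn_integral_mono)
    fix x
    have "norm (f x + g x) powr p \<le> (norm (f x) + norm (g x)) powr p"
      using assms by (intro powr_mono2 norm_triangle_ineq) auto
    also have "\<dots> \<le> 2 powr p * (norm (f x) powr p + norm (g x) powr p)"
      using assms by (intro powr_add_le) auto
    finally show "ennreal (norm (f x + g x) powr p)
        \<le> ennreal (2 powr p) * (ennreal (norm (f x) powr p) + ennreal (norm (g x) powr p))"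
      by (simp add: ennreal_mult[symmetric] ennreal_plus[symmetric] del: ennreal_plus)
  qed
  also have "\<dots> = ennreal (2 powr p) * (modular p f + modular p g)"
    unfolding modular_lebesgue by (simp add: nn_integral_cmult nn_integral_add)
  finally show ?thesis .
qed

lemma modular_uminus [simp]: "modular p (\<lambda>x. - f x) = modular p f"
  by (simp add: modular_def)

lemma modular_minus_commute: "modular p (\<lambda>x. f x - g x) = modular p (\<lambda>x. g x - f x)"
  by (simp add: modular_def norm_minus_commute)

lemma modular_diff:
  assumes "f \<in> borel_measurable lebesgue" "g \<in> borel_measurable lebesgue" "0 \<le> p"
  shows "modular p (\<lambda>x. f x - g x) \<le> ennreal (2 powr p) * (modular p f + modular p g)"
  using modular_add[of f "\<lambda>x. - g x" p] assms by simp

lemma modular_triangle: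
  assumes "f \<in> borel_measurable lebesgue" "g \<in> borel_measurable lebesgue"
    "h \<in> borel_measurable lebesgue" "0 \<le> p"
  shows "modular p (\<lambda>x. f x - h x) \<le>
    ennreal (2 powr p) * (modular p (\<lambda>x. f x - g x) + modular p (\<lambda>x. g x - h x))"
proof -
  have "modular p (\<lambda>x. (f x - g x) + (g x - h x)) \<le>
    ennreal (2 powr p) * (modular p (\<lambda>x. f x - g x) + modular p (\<lambda>x. g x - h x))"
    by (intro modular_add borel_measurable_diff assms)
  then show ?thesis by simp
qed

lemma modular_scaleR:
  assumes "f \<in> borel_measurable lebesgue"
  shows "modular p (\<lambda>x. c *\<^sub>R f x) = ennreal (\<bar>c\<bar> powr p) * modular p f"
proof -
  note [measurable] = assms
  have "(\<lambda>x. ennreal (norm (c *\<^sub>R f x) powr p)) =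
      (\<lambda>x. ennreal (\<bar>c\<bar> powr p) * ennreal (norm (f x) powr p))"
    by (auto simp: powr_mult ennreal_mult)
  then show ?thesis
    unfolding modular_lebesgue by (simp add: nn_integral_cmult)
qed

section \<open>Translations and reflections of Lebesgue measure\<close>

lemma lborel_distr_reflect:
  fixes c :: "'a::euclidean_space"
  shows "distr lborel borel (\<lambda>x. c - x) = lborel"
  by (subst (2) lborel_affine[of "-1" c]) (auto simp: density_1)

lemma lborel_distr_diff:
  fixes c :: "'a::euclidean_space"
  shows "distr lborel borel (\<lambda>x. x - c) = lborel"
proof -
  have "(\<lambda>x. x - c) = (+) (- c)" by auto
  then show ?thesis by (simp only: lborel_distr_plus)
qed

lemma nn_integral_diff_shift:
  fixes f :: "'a::euclidean_space \<Rightarrow> ennreal"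
  assumes [measurable]: "f \<in> borel_measurable borel"
  shows "(\<integral>\<^sup>+x. f (x - c) \<partial>lborel) = (\<integral>\<^sup>+x. f x \<partial>lborel)"
  by (subst (2) lborel_distr_diff[of c, symmetric]) (simp add: nn_integral_distr)

lemma integral_reflect:
  fixes f :: "'a::euclidean_space \<Rightarrow> 'b::{banach,second_countable_topology}"
  assumes [measurable]: "f \<in> borel_measurable borel"
  shows "(LINT x|lborel. f (c - x)) = (LINT x|lborel. f x)"
  by (subst (2) lborel_distr_reflect[of c, symmetric]) (simp add: integral_distr)

lemma integral_diff_shift:
  fixes f :: "'a::euclidean_space \<Rightarrow> 'b::{banach,second_countable_topology}"
  assumes [measurable]: "f \<in> borel_measurable borel"
  shows "(LINT x|lborel. f (x - c)) = (LINT x|lborel. f x)"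
  by (subst (2) lborel_distr_diff[of c, symmetric]) (simp add: integral_distr)

lemma modular_shift:
  assumes [measurable]: "f \<in> borel_measurable borel"
  shows "modular p (\<lambda>x. f (x - c)) = modular p f"
  unfolding modular_def
  using nn_integral_diff_shift[of "\<lambda>x. ennreal (norm (f x) powr p)" c] by simp

text \<open>The shape in which Minkowski's integral inequality is used: the \<open>p\<close>-th powers are kept, so
  that Jensen's inequality and Tonelli's theorem suffice.\<close>

lemma
  fixes F :: "'a::euclidean_space \<Rightarrow> 'c \<Rightarrow> 'b::euclidean_space" and k :: "'c \<Rightarrow> real"
  assumes "sigma_finite_measure M"
    and [measurable]: "(\<lambda>(x, z). F x z) \<in> borel_measurable (borel \<Otimes>\<^sub>M M)" "k \<in> borel_measurable M"
    and k: "\<And>z. 0 \<le> k z" and K: "(\<integral>\<^sup>+z. k z \<partial>M) \<le> ennreal K" "0 < K" and p: "1 \<le> p"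
  shows modular_integral_le: "modular p (\<lambda>x. LINT z|M. k z *\<^sub>R F x z)
      \<le> ennreal (K powr (p - 1)) * (\<integral>\<^sup>+z. ennreal (k z) * modular p (\<lambda>x. F x z) \<partial>M)" (is ?le)
    and AE_integrable_section:
      "(\<integral>\<^sup>+z. ennreal (k z) * modular p (\<lambda>x. F x z) \<partial>M) < \<infinity> \<Longrightarrow>
        AE x in lborel. integrable M (\<lambda>z. k z *\<^sub>R F x z)" (is "?fin \<Longrightarrow> ?AE")
proof -
  interpret M: sigma_finite_measure M by fact
  interpret pair_sigma_finite "lborel :: 'a measure" M ..
  have [measurable]: "(\<lambda>(x, z). F x z) \<in> borel_measurable (lborel \<Otimes>\<^sub>M M)"
    by measurable
  have [measurable]: "F x \<in> borel_measurable M" for x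
    by measurable
  let ?G = "\<lambda>x z. ennreal (k z) * ennreal (norm (F x z) powr p)"
  have eq: "(\<integral>\<^sup>+x. \<integral>\<^sup>+z. ?G x z \<partial>M \<partial>lborel) = (\<integral>\<^sup>+z. ennreal (k z) * modular p (\<lambda>x. F x z) \<partial>M)"
  proof -
    have "(\<integral>\<^sup>+x. \<integral>\<^sup>+z. ?G x z \<partial>M \<partial>lborel) = (\<integral>\<^sup>+z. \<integral>\<^sup>+x. ?G x z \<partial>lborel \<partial>M)"
      by (rule Fubini'[symmetric]) measurable
    also have "\<dots> = (\<integral>\<^sup>+z. ennreal (k z) * modular p (\<lambda>x. F x z) \<partial>M)"
    proof (rule nn_integral_cong)
      fix z assume [measurable]: "z \<in> space M"
      have [measurable]: "(\<lambda>x. F x z) \<in> borel_measurable borel" by measurable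
      show "(\<integral>\<^sup>+x. ?G x z \<partial>lborel) = ennreal (k z) * modular p (\<lambda>x. F x z)"
        unfolding modular_def by (rule nn_integral_cmult) measurable
    qed
    finally show ?thesis .
  qed
  have "modular p (\<lambda>x. LINT z|M. k z *\<^sub>R F x z) \<le>
      (\<integral>\<^sup>+x. ennreal (K powr (p - 1)) * (\<integral>\<^sup>+z. ?G x z \<partial>M) \<partial>lborel)"
    unfolding modular_def by (intro nn_integral_mono jensen_powr k K p) auto
  also have "\<dots> = ennreal (K powr (p - 1)) * (\<integral>\<^sup>+x. (\<integral>\<^sup>+z. ?G x z \<partial>M) \<partial>lborel)"
    by (rule nn_integral_cmult) measurable
  finally show ?le unfolding eq .
  show ?AE if ?fin
  proof -
    have "AE x in lborel. (\<integral>\<^sup>+z. ?G x z \<partial>M) \<noteq> \<infinity>"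
      using that unfolding eq[symmetric] by (intro nn_integral_noteq_infinite) auto
    then show ?thesis
    proof eventually_elim
      case (elim x)
      then show ?case
        by (intro integrable_weighted_powr[of _ _ _ K p] k K p) (auto simp: less_top)
    qed
  qed
qed

lemma modular_tendsto_0_dominated:
  fixes f :: "nat \<Rightarrow> 'a::euclidean_space \<Rightarrow> 'b::euclidean_space"
  assumes [measurable]: "\<And>n. f n \<in> borel_measurable lebesgue" "h \<in> borel_measurable lebesgue"
    and p: "0 < p"
    and lim: "AE x in lebesgue. (\<lambda>n. f n x) \<longlonglongrightarrow> 0"
    and dom: "\<And>n. AE x in lebesgue. norm (f n x) \<le> norm (h x)" and fin: "modular p h < \<infinity>"
  shows "(\<lambda>n. modular p (f n)) \<longlonglongrightarrow> 0"
proof -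
  have "(\<lambda>n. \<integral>\<^sup>+x. ennreal (norm (f n x) powr p) \<partial>lebesgue) \<longlonglongrightarrow> (\<integral>\<^sup>+x. 0 \<partial>(lebesgue::'a measure))"
  proof (rule nn_integral_dominated_convergence[where w="\<lambda>x. ennreal (norm (h x) powr p)"])
    show "AE x in lebesgue. ennreal (norm (f n x) powr p) \<le> ennreal (norm (h x) powr p)" for n
      by (rule eventually_mono[OF dom[of n]]) (use p in \<open>intro ennreal_leI powr_mono2, auto\<close>)
    show "(\<integral>\<^sup>+ x. ennreal (norm (h x) powr p) \<partial>lebesgue) < \<infinity>"
      using fin by (simp add: modular_lebesgue)
    show "AE x in lebesgue. (\<lambda>n. ennreal (norm (f n x) powr p)) \<longlonglongrightarrow> 0"
      using lim
    proof eventually_elim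
      case (elim x)
      have "(\<lambda>n. norm (f n x) powr p) \<longlonglongrightarrow> 0 powr p"
        by (intro tendsto_powr2 tendsto_norm_zero elim tendsto_const p always_eventually) auto
      then have "(\<lambda>n. ennreal (norm (f n x) powr p)) \<longlonglongrightarrow> ennreal 0"
        by (intro tendsto_ennrealI) simp
      then show ?case by simp
    qed
  qed auto
  then show ?thesis by (simp add: modular_lebesgue)
qed

lemma ennreal_quasi_less:
  assumes "a < ennreal (e / (2 * c))" "b < ennreal (e / (2 * c))" "0 < c"
  shows "ennreal c * (a + b) < ennreal e"
proof -
  obtain a' where a: "a = ennreal a'" "0 \<le> a'" using assms(1) by (cases a) auto
  obtain b' where b: "b = ennreal b'" "0 \<le> b'" using assms(2) by (cases b) auto
  have "a' < e / (2 * c)" "b' < e / (2 * c)"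
    using assms a b by (auto simp: ennreal_less_iff)
  then have "c * (a' + b') < e" using assms(3) by (simp add: field_simps)
  then show ?thesis
    using a b assms(3) by (simp add: ennreal_mult[symmetric] ennreal_less_iff flip: ennreal_plus)
qed

text \<open>Explains the recurring budget \<open>e / (2 * 2 powr p)\<close>: half of
  \<open>e\<close> for each part, divided by the constant of the quasi-triangle inequality.\<close>

lemma modular_triangle_less:
  assumes "f \<in> borel_measurable lebesgue" "g \<in> borel_measurable lebesgue"
    "h \<in> borel_measurable lebesgue" "0 \<le> p"
    and "modular p (\<lambda>x. f x - g x) < ennreal (e / (2 * 2 powr p))"
    and "modular p (\<lambda>x. g x - h x) < ennreal (e / (2 * 2 powr p))"
  shows "modular p (\<lambda>x. f x - h x) < ennreal e"
  by (rule le_less_trans[OF modular_triangle[OF assms(1-4)] ennreal_quasi_less])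
    (use assms in auto)

lemma eventually_less_ennreal:
  fixes f :: "nat \<Rightarrow> ennreal"
  assumes "f \<longlonglongrightarrow> 0" "0 < e"
  shows "\<forall>\<^sub>F n in sequentially. f n < ennreal e"
  by (rule order_tendstoD(2)[OF assms(1)]) (simp add: assms)

section \<open>Density of continuous functions and continuity of translations in L^p\<close>

lemma modular_truncate:
  fixes f :: "'a::euclidean_space \<Rightarrow> 'b::euclidean_space"
  assumes f [measurable]: "f \<in> borel_measurable lebesgue" and fin: "modular p f < \<infinity>"
    and p: "0 < p" and e: "0 < e"
  shows "\<exists>k::nat. modular p (\<lambda>x. f x - indicator {x. norm (f x) \<le> k \<and> norm x \<le> k} x *\<^sub>R f x) < ennreal e"
proof -
  have [measurable]: "(\<lambda>x::'a. x) \<in> borel_measurable lebesgue" by (rule borel_lebesgue) simp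
  have "(\<lambda>k. modular p (\<lambda>x. f x - indicator {x. norm (f x) \<le> real k \<and> norm x \<le> real k} x *\<^sub>R f x)) \<longlonglongrightarrow> 0"
  proof (rule modular_tendsto_0_dominated[where h=f])
    show "AE x in lebesgue. (\<lambda>k. f x - indicator {x. norm (f x) \<le> real k \<and> norm x \<le> real k} x *\<^sub>R f x) \<longlonglongrightarrow> 0"
    proof (rule AE_I2)
      fix x
      obtain N where N: "max (norm (f x)) (norm x) \<le> real N" using real_arch_simple by blast
      have "\<forall>\<^sub>F k in sequentially. f x - indicator {x. norm (f x) \<le> real k \<and> norm x \<le> real k} x *\<^sub>R f x = 0"
        using eventually_ge_at_top[of N] by eventually_elim (use N in auto)
      then show "(\<lambda>k. f x - indicator {x. norm (f x) \<le> real k \<and> norm x \<le> real k} x *\<^sub>R f x) \<longlonglongrightarrow> 0"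
        by (rule tendsto_eventually)
    qed
    show "AE x in lebesgue. norm (f x - indicator {x. norm (f x) \<le> real k \<and> norm x \<le> real k} x *\<^sub>R f x)
        \<le> norm (f x)" for k
      by (rule AE_I2) (auto simp: indicator_def)
  qed (use assms in auto)
  from eventually_less_ennreal[OF this e] show ?thesis
    by (auto simp: eventually_sequentially)
qed

lemma modular_indicator:
  assumes "emeasure lborel S < \<infinity>" "S \<in> sets borel"
  shows "modular p (\<lambda>x. indicator S x *\<^sub>R v) = ennreal (norm v powr p) * emeasure lborel S"
proof -
  have "(\<lambda>x. ennreal (norm (indicator S x *\<^sub>R v) powr p)) =
      (\<lambda>x. ennreal (norm v powr p) * indicator S x)"
    by (auto simp: indicator_def)
  then show ?thesis using assms by (simp add: modular_def nn_integral_cmult_indicator)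
qed

text \<open>After truncation in value and position, \<open>fk\<close> is an almost everywhere limit
  of continuous functions \<open>g n\<close>, about whose size nothing is known. Projecting their
  values and cutting them off in space forces a common bound, so dominated convergence
  applies.\<close>

lemma modular_continuous_dense:
  fixes f :: "'a::euclidean_space \<Rightarrow> 'b::euclidean_space"
  assumes f [measurable]: "f \<in> borel_measurable lebesgue" and fin: "modular p f < \<infinity>"
    and p: "0 < p" and e: "0 < e"
  shows "\<exists>h R. continuous_on UNIV h \<and> (\<forall>x. R < norm x \<longrightarrow> h x = 0) \<and>
    modular p (\<lambda>x. f x - h x) < ennreal e"
proof -
  have [measurable]: "(\<lambda>x::'a. x) \<in> borel_measurable lebesgue" by (rule borel_lebesgue) simp
  define e' where "e' = e / (2 * 2 powr p)"
  have e': "0 < e'" using e by (simp add: e'_def)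
  obtain k :: nat where k: "modular p (\<lambda>x. f x - indicator {x. norm (f x) \<le> k \<and> norm x \<le> k} x *\<^sub>R f x) < ennreal e'"
    using modular_truncate[OF f fin p e'] by blast
  define fk where "fk x = indicator {x. norm (f x) \<le> k \<and> norm x \<le> k} x *\<^sub>R f x" for x
  have fk_meas [measurable]: "fk \<in> borel_measurable lebesgue"
    unfolding fk_def by measurable
  have fk: "norm (fk x) \<le> k" "real k < norm x \<Longrightarrow> fk x = 0" for x
    by (auto simp: fk_def indicator_def)
  obtain N g where N: "negligible N" and g: "\<And>n. continuous_on UNIV (g n)"
    and lim: "\<And>x. x \<notin> N \<Longrightarrow> (\<lambda>n. g n x) \<longlonglongrightarrow> fk x"
    using lebesgue_measurable_imp_measurable_on[OF fk_meas, of UNIV] by (auto simp: measurable_on_def)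
  define c where "c x = max 0 (min 1 (real k + 1 - norm x))" for x :: 'a
  \<comment> \<open>The projection onto the ball of radius \<open>k\<close> fixes the values of
    \<open>fk\<close>, and \<open>c\<close> is 1 where \<open>fk\<close> can be nonzero; so
    \<open>h n\<close> keeps the limit \<open>fk\<close> and gains the bound \<open>k\<close> and
    support in the ball of radius \<open>k + 1\<close>.\<close>
  define h where "h n x = c x *\<^sub>R closest_point (cball 0 (real k)) (g n x)" for n x
  have c: "0 \<le> c x" "c x \<le> 1" "norm x \<le> k \<Longrightarrow> c x = 1" "real k + 1 < norm x \<Longrightarrow> c x = 0" for x
    by (auto simp: c_def)
  have cp: "continuous_on UNIV (closest_point (cball (0::'b) (real k)))"
    by (rule continuous_on_closest_point) auto
  have hc: "continuous_on UNIV (h n)" for n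
    unfolding h_def c_def
    by (intro continuous_intros continuous_on_compose2[OF cp] g) auto
  have [measurable]: "h n \<in> borel_measurable lebesgue" for n
    by (intro borel_lebesgue borel_measurable_continuous_onI hc)
  have cpn: "norm (closest_point (cball (0::'b) (real k)) y) \<le> k" for y
    using closest_point_in_set[of "cball (0::'b) (real k)" y] by auto
  have "(\<lambda>n. modular p (\<lambda>x. fk x - h n x)) \<longlonglongrightarrow> 0"
  proof (rule modular_tendsto_0_dominated[where h="\<lambda>x. indicator (cball 0 (real k + 1)) x *\<^sub>R (2 * real k)"])
    have "AE x in lebesgue. x \<notin> N"
      using N by (auto simp: negligible_iff_null_sets intro: AE_not_in)
    then show "AE x in lebesgue. (\<lambda>n. fk x - h n x) \<longlonglongrightarrow> 0"
    proof eventually_elim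
      case (elim x)
      have "(\<lambda>n. h n x) \<longlonglongrightarrow> c x *\<^sub>R closest_point (cball 0 (real k)) (fk x)"
        unfolding h_def
        by (intro tendsto_intros continuous_on_tendsto_compose[OF cp lim[OF elim]]) auto
      also have "closest_point (cball 0 (real k)) (fk x) = fk x"
        by (intro closest_point_self) (use fk in auto)
      also have "c x *\<^sub>R fk x = fk x"
        using c(3)[of x] fk(2)[of x] by (cases "norm x \<le> k") auto
      finally have "(\<lambda>n. fk x - h n x) \<longlonglongrightarrow> fk x - fk x"
        by (intro tendsto_intros)
      then show ?case by simp
    qed
    show "AE x in lebesgue. norm (fk x - h n x) \<le> norm (indicator (cball 0 (real k + 1)) x *\<^sub>R (2 * real k))" for n
    proof (rule AE_I2)
      fix x :: 'a
      show "norm (fk x - h n x) \<le> norm (indicator (cball 0 (real k + 1)) x *\<^sub>R (2 * real k))"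
      proof (cases "norm x \<le> real k + 1")
        case True
        have "norm (h n x) \<le> 1 * real k"
          unfolding h_def norm_scaleR by (intro mult_mono) (use c cpn in auto)
        then have "norm (fk x - h n x) \<le> 2 * real k"
          using fk(1)[of x] norm_triangle_ineq4[of "fk x" "h n x"] by linarith
        then show ?thesis using True by simp
      next
        case False
        then show ?thesis using fk(2)[of x] c(4)[of x] by (simp add: h_def)
      qed
    qed
    show "modular p (\<lambda>x::'a. indicator (cball 0 (real k + 1)) x *\<^sub>R (2 * real k)) < \<infinity>"
      using emeasure_lborel_cball_finite[of "0::'a" "real k + 1"]
      by (subst modular_indicator) (auto simp: ennreal_mult_less_top)
    show "(\<lambda>x::'a. indicator (cball 0 (real k + 1)) x *\<^sub>R (2 * real k)) \<in> borel_measurable lebesgue"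
      by (intro borel_lebesgue borel_measurable_scaleR borel_measurable_indicator borel_measurable_const) simp
  qed (use p in auto)
  from eventually_less_ennreal[OF this e'] obtain n where n: "modular p (\<lambda>x. fk x - h n x) < ennreal e'"
    by (auto simp: eventually_sequentially)
  have "modular p (\<lambda>x. f x - h n x) < ennreal e"
    by (rule modular_triangle_less[of f fk]) (use k n p in \<open>auto simp: fk_def[symmetric] e'_def\<close>)
  moreover have "\<forall>x. real k + 1 < norm x \<longrightarrow> h n x = 0"
    using c(4) by (auto simp: h_def)
  ultimately show ?thesis using hc by blast
qed

text \<open>Of two points at distance below 1, either both lie in the compact ball of radius
  \<open>R + 1\<close>, where continuity is uniform, or \<open>h\<close> vanishes at both.\<close>

lemma uniformly_continuous_on_compact_support:
  fixes h :: "'a::euclidean_space \<Rightarrow> 'b::real_normed_vector"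
  assumes h: "continuous_on UNIV h" and R: "\<And>x. R < norm x \<Longrightarrow> h x = 0"
  shows "uniformly_continuous_on UNIV h"
proof (unfold uniformly_continuous_on_def, intro allI impI)
  fix e :: real assume "0 < e"
  have "uniformly_continuous_on (cball 0 (R + 1)) h"
    by (intro compact_uniformly_continuous continuous_on_subset[OF h]) auto
  from uniformly_continuous_onE[OF this \<open>0 < e\<close>]
  obtain d where d: "0 < d" "\<And>x x'. x \<in> cball 0 (R + 1) \<Longrightarrow> x' \<in> cball 0 (R + 1) \<Longrightarrow> dist x' x < d \<Longrightarrow> dist (h x') (h x) < e"
    by metis
  show "\<exists>d>0. \<forall>x\<in>UNIV. \<forall>x'\<in>UNIV. dist x' x < d \<longrightarrow> dist (h x') (h x) < e"
  proof (intro exI[of _ "min d 1"] conjI ballI impI)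
    fix x x' :: 'a assume "dist x' x < min d 1"
    then have D: "dist x x' < min d 1" by (simp add: dist_commute)
    have 1: "norm x \<le> norm x' + dist x x'" "norm x' \<le> norm x + dist x x'"
      by (metis add.commute dist_norm norm_triangle_sub)
        (metis add.commute dist_commute dist_norm norm_triangle_sub)
    show "dist (h x') (h x) < e"
    proof (cases "norm x \<le> R \<or> norm x' \<le> R")
      case True
      then show ?thesis using D 1 by (intro d) (auto simp: dist_commute)
    next
      case False
      then show ?thesis using R \<open>0 < e\<close> by simp
    qed
  qed (use d in auto)
qed

text \<open>Compare \<open>f\<close> with a continuous compactly supported \<open>h\<close>:
  translating \<open>f - h\<close> preserves its modular, while \<open>h (x - z) - h x\<close> is
  uniformly small and, for \<open>norm z < 1\<close>, vanishes outside the ball of radius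
  \<open>R + 1\<close>.\<close>

lemma modular_translation_continuous:
  fixes f :: "'a::euclidean_space \<Rightarrow> 'b::euclidean_space"
  assumes f [measurable]: "f \<in> borel_measurable borel" and fin: "modular p f < \<infinity>"
    and p: "0 < p" and e: "0 < e"
  shows "\<exists>d>0. \<forall>z. norm z < d \<longrightarrow> modular p (\<lambda>x. f (x - z) - f x) < ennreal e"
proof -
  define e1 where "e1 = e / (2 * 2 powr p)"
  \<comment> \<open>The quasi-triangle inequality is used twice, one use nested in the other, so the
    inner budget is divided by its constant twice.\<close>
  define e2 where "e2 = e1 / (2 * 2 powr p)"
  have e1: "0 < e1" using e by (simp add: e1_def)
  have "1 \<le> 2 powr p" using p by (intro ge_one_powr_ge_zero) auto
  then have e2: "0 < e2" "e2 \<le> e1" using e1 p by (auto simp: e2_def field_simps)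
  obtain h R where h: "continuous_on UNIV h" and R: "\<And>x. R < norm x \<Longrightarrow> h x = 0"
    and fh: "modular p (\<lambda>x. f x - h x) < ennreal e2"
    using modular_continuous_dense[OF borel_lebesgue[OF f] fin p e2(1)] by blast
  have hm [measurable]: "h \<in> borel_measurable borel"
    by (intro borel_measurable_continuous_onI h)
  let ?S = "cball 0 (R + 1) :: 'a set"
  define V where "V = measure lborel ?S"
  have V: "emeasure lborel ?S = ennreal V"
    unfolding V_def using emeasure_lborel_cball_finite[of "0::'a" "R + 1"]
    by (intro emeasure_eq_ennreal_measure) auto
  have V0: "0 \<le> V" by (simp add: V_def)
  \<comment> \<open>Chosen so that the constant \<open>r\<close> on the ball \<open>?S\<close> has
    modular \<open>e2 * V / (V + 1)\<close>, strictly below \<open>e2\<close>.\<close>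
  define r where "r = (e2 / (V + 1)) powr (1 / p)"
  have r: "0 < r" using e2 V0 by (simp add: r_def)
  have rp: "r powr p = e2 / (V + 1)" using p e2 V0 by (simp add: r_def powr_powr)
  obtain d where d: "0 < d" "\<And>x x'. dist x' x < d \<Longrightarrow> dist (h x') (h x) < r"
    using uniformly_continuous_onE[OF uniformly_continuous_on_compact_support[OF h R] r] by (metis UNIV_I)
  show ?thesis
  proof (intro exI[of _ "min d 1"] conjI allI impI)
    fix z :: 'a assume z: "norm z < min d 1"
    have "modular p (\<lambda>x. h (x - z) - h x) \<le> modular p (\<lambda>x. indicator ?S x *\<^sub>R r)"
    proof (intro modular_mono AE_I2)
      fix x :: 'a
      show "norm (h (x - z) - h x) \<le> norm (indicator ?S x *\<^sub>R r)"
      proof (cases "x \<in> ?S")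
        case True
        have "dist (x - z) x < d" using z by (simp add: dist_norm)
        from d(2)[OF this] show ?thesis using True r by (simp add: dist_norm)
      next
        case False
        then have "R + 1 < norm x" by simp
        moreover have "norm x \<le> norm (x - z) + norm z" using norm_triangle_ineq[of "x - z" z] by simp
        ultimately have "R < norm x" "R < norm (x - z)" using z by auto
        then show ?thesis using R by simp
      qed
    qed (use p in auto)
    also have "\<dots> = ennreal (r powr p * V)"
      using V V0 r by (subst modular_indicator) (auto simp: ennreal_mult)
    also have "\<dots> < ennreal e2"
      using V0 e2 by (simp add: ennreal_less_iff rp field_simps)
    finally have 1: "modular p (\<lambda>x. h (x - z) - h x) < ennreal e2" .
    have fz [measurable]: "(\<lambda>x. f (x - z)) \<in> borel_measurable borel" "(\<lambda>x. h (x - z)) \<in> borel_measurable borel"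
      by measurable
    have 2: "modular p (\<lambda>x. h (x - z) - f x) < ennreal e1"
      by (rule modular_triangle_less[of _ h])
        (use 1 fh p in \<open>auto simp: e2_def modular_minus_commute[of p h f] intro!: borel_lebesgue\<close>)
    have "modular p (\<lambda>x. f (x - z) - h (x - z)) = modular p (\<lambda>x. f x - h x)"
      using modular_shift[of "\<lambda>x. f x - h x" p z] by simp
    then have 3: "modular p (\<lambda>x. f (x - z) - h (x - z)) < ennreal e1"
      using fh e2 by (auto intro: less_le_trans ennreal_leI)
    show "modular p (\<lambda>x. f (x - z) - f x) < ennreal e"
      by (rule modular_triangle_less[of _ "\<lambda>x. h (x - z)"])
        (use 2 3 p in \<open>auto simp: e1_def intro!: borel_lebesgue\<close>)
  qed (use d in auto)
qed

section \<open>Translation between L^p norms and integrals of p-th powers\<close>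

lemma Lp_iff:
  fixes f :: "'a::euclidean_space \<Rightarrow> 'b::euclidean_space"
  shows "f \<in> Lp p \<longleftrightarrow> f \<in> borel_measurable lebesgue \<and> modular p f < \<infinity>"
proof (cases "f \<in> borel_measurable lebesgue")
  case True
  note [measurable] = this
  show ?thesis using True by (simp add: Lp_def modular_lebesgue integrable_iff_bounded)
qed (simp add: Lp_def)

lemma Lp_norm_eq:
  fixes f :: "'a::euclidean_space \<Rightarrow> 'b::euclidean_space"
  assumes [measurable]: "f \<in> borel_measurable lebesgue"
  shows "Lp_norm p f = enn2real (modular p f) powr (1 / p)"
  unfolding Lp_norm_def modular_lebesgue
  by (subst integral_eq_nn_integral) auto

text \<open>\<open>Lp_norm\<close> is 0 when the integral diverges, so finiteness of the modular of
  \<open>f i - l\<close> has to be derived from membership in \<open>Lp\<close> before p-th powers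
  and p-th roots can be exchanged.\<close>

lemma tendsto_Lp_iff:
  fixes f :: "'i \<Rightarrow> 'a::euclidean_space \<Rightarrow> 'b::euclidean_space"
  assumes p: "0 < p"
  shows "tendsto_Lp p f l F \<longleftrightarrow> (\<forall>\<^sub>F i in F. f i \<in> Lp p) \<and> l \<in> Lp p \<and>
     ((\<lambda>i. modular p (\<lambda>x. f i x - l x)) \<longlongrightarrow> 0) F"
proof -
  have "((\<lambda>i. Lp_norm p (\<lambda>x. f i x - l x)) \<longlongrightarrow> 0) F \<longleftrightarrow>
      ((\<lambda>i. modular p (\<lambda>x. f i x - l x)) \<longlongrightarrow> 0) F"
    if ev: "\<forall>\<^sub>F i in F. f i \<in> Lp p" and l: "l \<in> Lp p"
  proof -
    have ev2: "\<forall>\<^sub>F i in F. Lp_norm p (\<lambda>x. f i x - l x) = enn2real (modular p (\<lambda>x. f i x - l x)) powr (1 / p) \<and>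
      modular p (\<lambda>x. f i x - l x) < \<infinity>"
      using ev
    proof eventually_elim
      case (elim i)
      have m: "f i \<in> borel_measurable lebesgue" "l \<in> borel_measurable lebesgue"
        and fin: "modular p (f i) < \<infinity>" "modular p l < \<infinity>"
        using elim l by (auto simp: Lp_iff)
      have "modular p (\<lambda>x. f i x - l x) \<le> ennreal (2 powr p) * (modular p (f i) + modular p l)"
        using m p by (intro modular_diff) auto
      also have "\<dots> < \<infinity>" using fin by (simp add: ennreal_mult_less_top)
      finally show ?case using m by (simp add: Lp_norm_eq)
    qed
    show ?thesis
    proof
      assume A: "((\<lambda>i. Lp_norm p (\<lambda>x. f i x - l x)) \<longlongrightarrow> 0) F"
      have "((\<lambda>i. ennreal (Lp_norm p (\<lambda>x. f i x - l x) powr p)) \<longlongrightarrow> ennreal (0 powr p)) F"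
        by (intro tendsto_ennrealI tendsto_powr2 A tendsto_const p always_eventually)
          (auto simp: Lp_norm_def)
      moreover have "\<forall>\<^sub>F i in F. ennreal (Lp_norm p (\<lambda>x. f i x - l x) powr p) = modular p (\<lambda>x. f i x - l x)"
        using ev2 by eventually_elim (use p in \<open>auto simp: powr_powr\<close>)
      ultimately show "((\<lambda>i. modular p (\<lambda>x. f i x - l x)) \<longlongrightarrow> 0) F"
        by (simp add: tendsto_cong)
    next
      assume A: "((\<lambda>i. modular p (\<lambda>x. f i x - l x)) \<longlongrightarrow> 0) F"
      have B: "((\<lambda>i. enn2real (modular p (\<lambda>x. f i x - l x))) \<longlongrightarrow> enn2real 0) F"
        by (rule tendsto_enn2real) (use A in auto)
      have "((\<lambda>i. enn2real (modular p (\<lambda>x. f i x - l x)) powr (1 / p)) \<longlongrightarrow> enn2real 0 powr (1 / p)) F"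
        by (intro tendsto_powr2 B tendsto_const always_eventually) (use p in auto)
      moreover have "\<forall>\<^sub>F i in F. enn2real (modular p (\<lambda>x. f i x - l x)) powr (1 / p) = Lp_norm p (\<lambda>x. f i x - l x)"
        using ev2 by eventually_elim auto
      ultimately show "((\<lambda>i. Lp_norm p (\<lambda>x. f i x - l x)) \<longlongrightarrow> 0) F"
        by (simp add: tendsto_cong)
    qed
  qed
  then show ?thesis unfolding tendsto_Lp_def by blast
qed

text \<open>For a merely Lebesgue measurable \<open>u\<close>, the map
  \<open>(x, z) -> u (x - z)\<close> can fail to be measurable for the Borel product sigma-algebra;
  for a Borel representative it is. The representative is built coordinate by coordinate.\<close>

lemma borel_representative:
  fixes f :: "'a::euclidean_space \<Rightarrow> 'b::euclidean_space"
  assumes "f \<in> borel_measurable lebesgue"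
  shows "\<exists>f'\<in>borel_measurable borel. AE x in lebesgue. f x = f' x"
proof -
  have "\<exists>g\<in>borel_measurable lborel. AE x in lborel. f x \<bullet> b = g x" if "b \<in> Basis" for b
    using assms by (intro completion_ex_borel_measurable_real) auto
  then obtain g where g: "\<And>b. b \<in> Basis \<Longrightarrow> g b \<in> borel_measurable lborel"
    "\<And>b. b \<in> Basis \<Longrightarrow> AE x in lborel. f x \<bullet> b = g b x" by metis
  have "AE x in lborel. \<forall>b\<in>Basis. f x \<bullet> b = g b x"
    using g by (intro AE_finite_allI) auto
  then have "AE x in lebesgue. f x = (\<Sum>b\<in>Basis. g b x *\<^sub>R b)"
    by (intro AE_completion) (auto elim!: eventually_mono simp: euclidean_eq_iff[where 'a='b])
  moreover have "(\<lambda>x. \<Sum>b\<in>Basis. g b x *\<^sub>R b) \<in> borel_measurable borel"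
    using g by (intro borel_measurable_sum borel_measurable_scaleR) auto
  ultimately show ?thesis by (rule bexI)
qed

section \<open>Smooth functions with compact support\<close>

lemma C_k_SucD: "C_k (Suc k) u \<Longrightarrow> C_k k u"
proof (induction k arbitrary: u)
  case 0
  then show ?case
    by (simp add: differentiable_imp_continuous_within continuous_at_imp_continuous_on)
next
  case (Suc k)
  from Suc.prems have "\<forall>x. u differentiable (at x)"
    and "\<forall>b\<in>Basis. C_k (Suc k) (\<lambda>x. frechet_derivative u (at x) b)"
    unfolding C_k.simps(2)[of "Suc k"] by blast+
  then show ?case using Suc.IH unfolding C_k.simps(2)[of k] by blast
qed

text \<open>The recursion in \<open>C_k\<close> runs through the choice operator
  \<open>frechet_derivative\<close>; this rule lets any explicit derivative take its place.\<close>

lemma C_k_SucI: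
  assumes "\<And>x. (u has_derivative D x) (at x)" "\<And>b. b \<in> Basis \<Longrightarrow> C_k k (\<lambda>x. D x b)"
  shows "C_k (Suc k) u"
proof -
  have "frechet_derivative u (at x) = D x" for x
    using frechet_derivative_at[OF assms(1)] by simp
  then show ?thesis using assms by (auto simp: differentiable_def)
qed

lemma C_k_Suc_derivative:
  assumes "C_k (Suc k) u"
  shows "(u has_derivative frechet_derivative u (at x)) (at x)"
  using assms by (simp add: frechet_derivative_works[symmetric])

lemma C_k_const: "C_k k (\<lambda>x. c)"
proof (induction k arbitrary: c)
  case (Suc k)
  show ?case by (rule C_k_SucI[where D="\<lambda>_ _. 0"]) (auto intro: Suc)
qed simp

lemma C_k_inner: "C_k k (\<lambda>x. x \<bullet> b)"
proof (cases k)
  case (Suc k')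
  show ?thesis unfolding Suc
    by (rule C_k_SucI[where D="\<lambda>_ v. v \<bullet> b"]) (auto intro!: C_k_const derivative_eq_intros)
qed (auto intro!: continuous_intros)

lemma C_k_add: "C_k k u \<Longrightarrow> C_k k v \<Longrightarrow> C_k k (\<lambda>x. u x + v x)"
proof (induction k arbitrary: u v)
  case (Suc k)
  note d = Suc.prems[THEN C_k_Suc_derivative]
  show ?case
    by (rule C_k_SucI[OF has_derivative_add[OF d(1) d(2)]]) (use Suc in auto)
qed (auto intro: continuous_intros)

lemma C_k_mult: "C_k k u \<Longrightarrow> C_k k v \<Longrightarrow> C_k k (\<lambda>x. u x * v x)"
proof (induction k arbitrary: u v)
  case (Suc k)
  note d = Suc.prems[THEN C_k_Suc_derivative]
  show ?case
    by (rule C_k_SucI[OF has_derivative_mult[OF d(1) d(2)]])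
      (use Suc C_k_SucD[OF Suc.prems(1)] C_k_SucD[OF Suc.prems(2)] in \<open>auto intro!: C_k_add Suc.IH\<close>)
qed (auto intro: continuous_intros)

lemma C_k_cmult: "C_k k u \<Longrightarrow> C_k k (\<lambda>x. c * u x)"
  by (intro C_k_mult C_k_const)

lemma C_k_diff: "C_k k u \<Longrightarrow> C_k k v \<Longrightarrow> C_k k (\<lambda>x. u x - v x)"
  using C_k_add[of k u "\<lambda>x. (-1) * v x"] C_k_cmult[of k v "-1"] by simp

lemma C_k_reflect: "C_k k u \<Longrightarrow> C_k k (\<lambda>x. u (c - x))"
proof (induction k arbitrary: u)
  case 0
  then show ?case by (auto intro!: continuous_on_compose2[of UNIV u] continuous_intros)
next
  case (Suc k)
  have "((\<lambda>x. u (c - x)) has_derivative (\<lambda>v. frechet_derivative u (at (c - x)) (- v))) (at x)" for x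
    by (rule has_derivative_compose[of "\<lambda>x. c - x"])
      (auto intro!: derivative_eq_intros C_k_Suc_derivative[OF Suc.prems])
  then show ?case
  proof (rule C_k_SucI)
    fix b :: 'a assume b: "b \<in> Basis"
    have "frechet_derivative u (at (c - x)) (- b) = (-1) * frechet_derivative u (at (c - x)) b" for x
      using linear_frechet_derivative[of u "at (c - x)"] Suc.prems by (simp add: linear_neg)
    moreover have "C_k k (\<lambda>x. (-1) * frechet_derivative u (at (c - x)) b)"
      by (intro C_k_cmult Suc.IH[of "\<lambda>x. frechet_derivative u (at x) b"]) (use Suc.prems b in auto)
    ultimately show "C_k k (\<lambda>x. frechet_derivative u (at (c - x)) (- b))" by simp
  qed
qed

section \<open>A smooth bump function\<close>

definition flat :: "nat \<Rightarrow> real \<Rightarrow> real" where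
  "flat m t = (if 0 < t then exp (- 1 / t) / t ^ m else 0)"

text \<open>The family of all \<open>flat m\<close> is closed under differentiation up to linear
  combinations. This is the reason for the parameter \<open>m\<close>: smoothness of
  \<open>flat 0\<close> alone would not survive an induction.\<close>

lemma flat_derivative:
  "(flat m has_real_derivative (flat (m + 2) t - real m * flat (m + 1) t)) (at t)"
proof -
  consider "t < 0" | "t = 0" | "0 < t" by linarith
  then show ?thesis
  proof cases
    case 1
    have "((\<lambda>_. 0) has_real_derivative 0) (at t)" by simp
    then show ?thesis
      by (rule has_field_derivative_transform_within_open[where S="{..<0}", THEN back_subst[of "\<lambda>d. (flat m has_real_derivative d) (at t)"]])
        (use 1 in \<open>auto simp: flat_def\<close>)
  next
    case 2
    have "((\<lambda>h. (flat m (0 + h) - flat m 0) / h) \<longlongrightarrow> 0) (at 0)"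
    proof (rule filterlim_split_at)
      have "\<forall>\<^sub>F h in at_left 0. (flat m (0 + h) - flat m 0) / h = 0"
        by (auto simp: eventually_at_filter flat_def)
      then show "((\<lambda>h. (flat m (0 + h) - flat m 0) / h) \<longlongrightarrow> 0) (at_left 0)"
        by (rule tendsto_eventually)
      \<comment> \<open>With \<open>y = 1/h\<close> the right difference quotient at 0 is
        \<open>y^(m+1) / exp y\<close>, and the exponential dominates.\<close>
      have "((\<lambda>h. inverse h ^ (m + 1) / exp (inverse h)) \<longlongrightarrow> (0::real)) (at_right 0)"
        by (rule filterlim_compose[OF tendsto_power_div_exp_0 filterlim_inverse_at_top_right])
      moreover have "\<forall>\<^sub>F h in at_right 0. inverse h ^ (m + 1) / exp (inverse h) = (flat m (0 + h) - flat m 0) / h"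
        by (auto simp: eventually_at_filter flat_def exp_minus field_simps)
      ultimately show "((\<lambda>h. (flat m (0 + h) - flat m 0) / h) \<longlongrightarrow> 0) (at_right 0)"
        by (rule Lim_transform_eventually)
    qed
    then show ?thesis using 2 by (simp add: DERIV_def) (simp add: flat_def)
  next
    case 3
    have "((\<lambda>t. exp (- 1 / t) / t ^ m) has_real_derivative
        (flat (m + 2) t - real m * flat (m + 1) t)) (at t)"
      using 3 by (auto intro!: derivative_eq_intros simp: flat_def) (cases m; simp add: field_simps)
    then show ?thesis
      by (rule has_field_derivative_transform_within_open[where S="{0<..}"])
        (use 3 in \<open>auto simp: flat_def\<close>)
  qed
qed

text \<open>Using the squared norm makes the argument a polynomial, so no smoothness is lost at the
  origin; the argument is positive exactly in the open ball of radius \<open>r\<close> when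
  \<open>0 < r\<close>.\<close>

definition bump :: "real \<Rightarrow> 'a::euclidean_space \<Rightarrow> real" where
  "bump r x = flat 0 (1 - (x \<bullet> x) / r\<^sup>2)"

lemma flat_bump_derivative:
  "((\<lambda>x. flat m (1 - (x \<bullet> x) / r\<^sup>2)) has_derivative
    (\<lambda>v. (flat (m + 2) (1 - (x \<bullet> x) / r\<^sup>2) - real m * flat (m + 1) (1 - (x \<bullet> x) / r\<^sup>2)) *
      ((- 2 / r\<^sup>2) * (x \<bullet> v)))) (at x)"
proof -
  have "((\<lambda>x. 1 - (x \<bullet> x) / r\<^sup>2) has_derivative (\<lambda>v. (- 2 / r\<^sup>2) * (x \<bullet> v))) (at x)"
  proof -
    have "((\<lambda>x. 1 - (1 / r\<^sup>2) * (x \<bullet> x)) has_derivative (\<lambda>v. 0 - (1 / r\<^sup>2) * (x \<bullet> v + v \<bullet> x))) (at x)"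
      by (intro derivative_intros)
    then show ?thesis by (simp add: inner_commute)
  qed
  from has_derivative_compose[OF this flat_derivative[unfolded has_field_derivative_def]]
  show ?thesis by simp
qed

lemma C_k_flat_bump: "C_k k (\<lambda>x. flat m (1 - (x \<bullet> x) / r\<^sup>2))"
proof (induction k arbitrary: m)
  case 0
  have "continuous (at x) (\<lambda>x. flat m (1 - (x \<bullet> x) / r\<^sup>2))" for x :: 'a
    using flat_bump_derivative by (rule has_derivative_continuous)
  then show ?case by (simp add: continuous_at_imp_continuous_on)
next
  case (Suc k)
  show ?case
    by (rule C_k_SucI[OF flat_bump_derivative])
      (intro C_k_mult C_k_diff C_k_const C_k_inner Suc)
qed

lemma C_k_bump: "C_k k (bump r)"
  unfolding bump_def by (rule C_k_flat_bump)

lemma bump_nonneg: "0 \<le> bump r x"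
  by (simp add: bump_def flat_def)

text \<open>The argument of \<open>flat 0\<close> is at most 1, where the value is
  \<open>exp (- 1)\<close>. The sharp maximum matters: it is divided out later to obtain cutoff
  functions with values in [0, 1].\<close>

lemma bump_le_1: "bump r x \<le> exp (- 1)"
  by (auto simp: bump_def flat_def divide_le_eq le_divide_eq)

lemma bump_eq_0: "0 < r \<Longrightarrow> r \<le> norm x \<Longrightarrow> bump r x = 0"
  by (auto simp: bump_def flat_def dot_square_norm field_simps dest: power_mono[of r "norm x" 2])

lemma bump_pos: "norm x < r \<Longrightarrow> 0 < bump r x"
  using power_strict_mono[of "norm x" r 2] norm_ge_zero[of x]
  by (simp add: bump_def flat_def dot_square_norm) (smt (verit) divide_less_eq_1 zero_le_power2)

section \<open>Gradients of test functions\<close>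

definition grad :: "('a::euclidean_space \<Rightarrow> real) \<Rightarrow> 'a \<Rightarrow> 'a" where
  "grad u x = (\<Sum>b\<in>Basis. frechet_derivative u (at x) b *\<^sub>R b)"

lemma grad_eqI:
  assumes "(u has_derivative (\<lambda>v. g \<bullet> v)) (at x)"
  shows "grad u x = g"
  unfolding grad_def frechet_derivative_at[OF assms, symmetric]
  by (rule euclidean_representation)

lemma has_derivative_grad:
  assumes "u differentiable (at x)"
  shows "(u has_derivative (\<lambda>v. grad u x \<bullet> v)) (at x)"
proof -
  interpret linear "frechet_derivative u (at x)"
    using assms by (rule linear_frechet_derivative)
  have "frechet_derivative u (at x) v = grad u x \<bullet> v" for v
  proof -
    have "frechet_derivative u (at x) v = frechet_derivative u (at x) (\<Sum>b\<in>Basis. (v \<bullet> b) *\<^sub>R b)"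
      by (simp add: euclidean_representation)
    also have "\<dots> = grad u x \<bullet> v"
      by (simp add: sum scale grad_def inner_sum_left inner_commute[of v] mult.commute)
    finally show ?thesis .
  qed
  moreover have "(u has_derivative frechet_derivative u (at x)) (at x)"
    using assms by (simp add: frechet_derivative_works)
  ultimately show ?thesis by presburger
qed

lemma frechet_derivative_eq_grad:
  "u differentiable (at x) \<Longrightarrow> frechet_derivative u (at x) v = grad u x \<bullet> v"
  using frechet_derivative_at[OF has_derivative_grad] by metis

text \<open>The gradient is \<open>- (2 / r^2) * flat 2 t\<close> times \<open>x\<close>. Here
  \<open>flat 2\<close> is at most 2, because \<open>y^2 / 2 \<le> exp y\<close> with
  \<open>y = 1/t\<close>, and \<open>norm x < r\<close> on the support, which gives
  \<open>2 * (2 / r^2) * r\<close>. The decay in \<open>r\<close> is what makes cutting off harmless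
  in Sobolev norms.\<close>

lemma norm_grad_bump_le:
  assumes "0 < r"
  shows "norm (grad (bump r) x) \<le> 4 / r"
proof -
  let ?t = "1 - (x \<bullet> x) / r\<^sup>2"
  have "grad (bump r) x = (flat 2 ?t * (- 2 / r\<^sup>2)) *\<^sub>R x"
    unfolding bump_def by (rule grad_eqI[OF has_derivative_eq_rhs[OF flat_bump_derivative]]) (simp add: numeral_2_eq_2 algebra_simps)
  then have eq: "norm (grad (bump r) x) = \<bar>flat 2 ?t\<bar> * (2 / r\<^sup>2) * norm x" by (simp add: abs_mult)
  show ?thesis
  proof (cases "norm x < r")
    case False
    then have "r\<^sup>2 \<le> x \<bullet> x"
      using assms power_mono[of r "norm x" 2] by (simp add: dot_square_norm)
    then have "flat 2 ?t = 0"
      using assms by (simp add: flat_def)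
    then show ?thesis using eq assms by simp
  next
    case True
    have f2: "\<bar>flat 2 t\<bar> \<le> 2" for t
    proof (cases "0 < t")
      case True
      have "(1 / t)\<^sup>2 / 2 \<le> exp (1 / t)"
      proof -
        have "0 < 1 / t" using True by simp
        then show ?thesis using exp_lower_Taylor_quadratic[of "1 / t"] by linarith
      qed
      then have "(1 / t)\<^sup>2 * exp (- (1 / t)) \<le> 2 * exp (1 / t) * exp (- (1 / t))"
        by (intro mult_right_mono) auto
      also have "\<dots> = 2" by (simp add: exp_minus)
      finally have "(1 / t)\<^sup>2 * exp (- (1 / t)) \<le> 2" .
      then show ?thesis using True by (simp add: flat_def power_divide field_simps)
    qed (simp add: flat_def)
    have "\<bar>flat 2 ?t\<bar> * (2 / r\<^sup>2) * norm x \<le> 2 * (2 / r\<^sup>2) * r"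
      using True assms f2[of ?t] by (intro mult_mono) auto
    also have "\<dots> = 4 / r" using assms by (simp add: power2_eq_square)
    finally show ?thesis using eq by simp
  qed
qed

lemma Cc_infinityI:
  assumes "\<And>k. C_k k u" "\<And>x. R < norm x \<Longrightarrow> u x = 0"
  shows "u \<in> Cc_infinity"
proof -
  have "{x. u x \<noteq> 0} \<subseteq> cball 0 R" using assms(2) by (force simp: not_less[symmetric])
  then have "bounded {x. u x \<noteq> 0}" by (rule bounded_subset[OF bounded_cball])
  then show ?thesis using assms(1) by (auto simp: Cc_infinity_def)
qed

lemma Cc_infinity_bounded_support:
  assumes "u \<in> Cc_infinity"
  shows "\<exists>R>0. \<forall>x. R < norm x \<longrightarrow> u x = 0"
proof -
  have "bounded (closure {x. u x \<noteq> 0})" using assms by (auto simp: Cc_infinity_def intro: compact_imp_bounded)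
  then have "bounded {x. u x \<noteq> 0}" by (rule bounded_subset[OF _ closure_subset])
  then show ?thesis by (auto simp: bounded_pos) (metis not_less)
qed

lemma Cc_infinity_C_k: "u \<in> Cc_infinity \<Longrightarrow> C_k k u"
  by (simp add: Cc_infinity_def)

lemma Cc_infinity_differentiable: "u \<in> Cc_infinity \<Longrightarrow> u differentiable (at x)"
  using Cc_infinity_C_k[of u "Suc 0"] by simp

lemma Cc_infinity_has_derivative: "u \<in> Cc_infinity \<Longrightarrow> (u has_derivative (\<lambda>v. grad u x \<bullet> v)) (at x)"
  by (intro has_derivative_grad Cc_infinity_differentiable)

lemma Cc_infinity_continuous: "u \<in> Cc_infinity \<Longrightarrow> continuous_on UNIV u"
  using Cc_infinity_C_k[of u 0] by simp

lemma grad_continuous: "u \<in> Cc_infinity \<Longrightarrow> continuous_on UNIV (grad u)"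
  using Cc_infinity_C_k[of u "Suc 0"]
  unfolding grad_def by (auto intro!: continuous_intros)

lemma grad_eq_0:
  assumes "\<And>x. R < norm x \<Longrightarrow> u x = 0" "R < norm x"
  shows "grad u x = 0"
proof (rule grad_eqI)
  have "((\<lambda>_. 0) has_derivative (\<lambda>v. 0 \<bullet> v)) (at x)" by simp
  then show "(u has_derivative (\<lambda>v. 0 \<bullet> v)) (at x)"
    by (rule has_derivative_transform_within_open[where s="- cball 0 R"])
      (use assms in \<open>auto intro!: open_Compl\<close>)
qed

lemma Cc_infinity_partial:
  assumes "u \<in> Cc_infinity" "b \<in> Basis"
  shows "(\<lambda>x. grad u x \<bullet> b) \<in> Cc_infinity"
proof -
  obtain R where R: "\<And>x. R < norm x \<Longrightarrow> u x = 0" using Cc_infinity_bounded_support[OF assms(1)] by blast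
  show ?thesis
  proof (rule Cc_infinityI[of _ R])
    fix k
    have "C_k k (\<lambda>x. frechet_derivative u (at x) b)"
      using Cc_infinity_C_k[OF assms(1), of "Suc k"] assms(2) by simp
    then show "C_k k (\<lambda>x. grad u x \<bullet> b)"
      by (simp add: frechet_derivative_eq_grad[OF Cc_infinity_differentiable[OF assms(1)]])
  qed (simp add: grad_eq_0[OF R])
qed

lemma Cc_infinity_mult:
  assumes "u \<in> Cc_infinity" "\<And>k. C_k k v"
  shows "(\<lambda>x. u x * v x) \<in> Cc_infinity"
proof -
  obtain R where R: "\<And>x. R < norm x \<Longrightarrow> u x = 0" using Cc_infinity_bounded_support[OF assms(1)] by blast
  show ?thesis
    by (rule Cc_infinityI[of _ R]) (simp_all add: R C_k_mult Cc_infinity_C_k assms)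
qed

lemma Cc_infinity_bump: "0 < r \<Longrightarrow> bump r \<in> Cc_infinity"
  by (rule Cc_infinityI[of _ r]) (auto intro: C_k_bump bump_eq_0)

lemma Cc_infinity_cmult:
  assumes "u \<in> Cc_infinity" shows "(\<lambda>x. c * u x) \<in> Cc_infinity"
  using Cc_infinity_mult[OF assms C_k_const, of c] by (simp add: mult.commute)

lemma Cc_infinity_diff:
  assumes "u \<in> Cc_infinity" "v \<in> Cc_infinity"
  shows "(\<lambda>x. u x - v x) \<in> Cc_infinity"
proof -
  obtain R S where "\<And>x. R < norm x \<Longrightarrow> u x = 0" "\<And>x. S < norm x \<Longrightarrow> v x = 0"
    using Cc_infinity_bounded_support assms by meson
  then show ?thesis
    by (intro Cc_infinityI[of _ "max R S"]) (simp_all add: C_k_diff Cc_infinity_C_k assms)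
qed

lemma bounded_compact_support:
  fixes h :: "'a::euclidean_space \<Rightarrow> 'b::real_normed_vector"
  assumes "continuous_on UNIV h" "\<And>x. R < norm x \<Longrightarrow> h x = 0"
  shows "\<exists>B>0. \<forall>x. norm (h x) \<le> B"
proof -
  have "bounded (h ` cball 0 R)"
    by (intro compact_imp_bounded compact_continuous_image continuous_on_subset[OF assms(1)]) auto
  then obtain B where B: "0 < B" "\<forall>x\<in>cball 0 R. norm (h x) \<le> B" by (auto simp: bounded_pos)
  have "norm (h x) \<le> B" for x
    using B assms(2)[of x] by (cases "norm x \<le> R") auto
  with B show ?thesis by blast
qed

lemma modular_bounded_support_finite:
  fixes f :: "'a::euclidean_space \<Rightarrow> 'b::euclidean_space"
  assumes "0 \<le> p" "\<And>x. norm (f x) \<le> B" "\<And>x. R < norm x \<Longrightarrow> f x = 0"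
  shows "modular p f < \<infinity>"
proof -
  have "0 \<le> B" using assms(2)[of undefined] by (meson norm_ge_zero order_trans)
  then have "modular p f \<le> modular p (\<lambda>x::'a. indicator (cball 0 R) x *\<^sub>R B)"
    using assms(2,3) by - (rule modular_mono[OF assms(1) AE_I2], auto simp: indicator_def)
  also have "\<dots> < \<infinity>"
    using emeasure_lborel_cball_finite[of "0::'a" R]
    by (subst modular_indicator) (auto simp: ennreal_mult_less_top)
  finally show ?thesis .
qed

lemma Cc_infinity_borel: "u \<in> Cc_infinity \<Longrightarrow> u \<in> borel_measurable borel"
  by (intro borel_measurable_continuous_onI Cc_infinity_continuous)

lemma grad_borel: "u \<in> Cc_infinity \<Longrightarrow> grad u \<in> borel_measurable borel"
  by (intro borel_measurable_continuous_onI grad_continuous)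

lemma Cc_infinity_bounded:
  assumes "u \<in> Cc_infinity" shows "\<exists>B>0. \<forall>x. \<bar>u x\<bar> \<le> B"
  using Cc_infinity_bounded_support[OF assms] bounded_compact_support[OF Cc_infinity_continuous[OF assms]]
  by (metis real_norm_def)

lemma grad_bounded:
  assumes "u \<in> Cc_infinity" shows "\<exists>B>0. \<forall>x. norm (grad u x) \<le> B"
  using Cc_infinity_bounded_support[OF assms] bounded_compact_support[OF grad_continuous[OF assms]]
  by (metis grad_eq_0)

lemma Cc_infinity_modular_finite:
  assumes "u \<in> Cc_infinity" "0 \<le> p" shows "modular p u < \<infinity>"
  using Cc_infinity_bounded_support[OF assms(1)] Cc_infinity_bounded[OF assms(1)]
  by (metis modular_bounded_support_finite[OF assms(2)] real_norm_def)

lemma grad_modular_finite: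
  assumes "u \<in> Cc_infinity" "0 \<le> p" shows "modular p (grad u) < \<infinity>"
  using Cc_infinity_bounded_support[OF assms(1)] grad_bounded[OF assms(1)]
  by (metis modular_bounded_support_finite[OF assms(2)] grad_eq_0)

lemma integrable_bounded_continuous_mult:
  fixes h :: "'a::euclidean_space \<Rightarrow> 'b::euclidean_space"
  assumes "continuous_on UNIV w" "\<And>x. \<bar>w x\<bar> \<le> B" "integrable lborel h"
  shows "integrable lborel (\<lambda>y. w y *\<^sub>R h y)"
proof (rule Bochner_Integration.integrable_bound[of _ "\<lambda>y. B *\<^sub>R h y"])
  have [measurable]: "w \<in> borel_measurable borel" by (intro borel_measurable_continuous_onI assms)
  note [measurable] = borel_measurable_integrable[OF assms(3)]
  show "(\<lambda>y. w y *\<^sub>R h y) \<in> borel_measurable lborel" by measurable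
  have "0 \<le> B" using assms(2)[of undefined] by linarith
  then show "AE y in lborel. norm (w y *\<^sub>R h y) \<le> norm (B *\<^sub>R h y)"
    using assms(2) by (intro AE_I2) (auto intro: mult_right_mono)
qed (use assms in auto)

text \<open>The mean value inequality on the segment from \<open>a\<close> to \<open>a + v\<close>,
  with a radius \<open>d\<close> independent of \<open>a\<close> because \<open>grad r\<close> is
  uniformly continuous. This uniformity is what permits differentiation under the integral of a
  convolution.\<close>

lemma grad_linearization:
  assumes r: "r \<in> Cc_infinity" and e: "0 < e"
  shows "\<exists>d>0. \<forall>a v. norm v < d \<longrightarrow> \<bar>r (a + v) - r a - grad r a \<bullet> v\<bar> \<le> e * norm v"
proof -
  obtain R where R: "\<And>x. R < norm x \<Longrightarrow> r x = 0" using Cc_infinity_bounded_support[OF r] by blast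
  have "uniformly_continuous_on UNIV (grad r)"
    by (rule uniformly_continuous_on_compact_support[OF grad_continuous[OF r]]) (rule grad_eq_0[OF R])
  from uniformly_continuous_onE[OF this e]
  obtain d where d: "0 < d" "\<And>x x'. dist x' x < d \<Longrightarrow> dist (grad r x') (grad r x) < e"
    by (metis UNIV_I)
  show ?thesis
  proof (intro exI[of _ d] conjI allI impI d)
    fix a v :: 'a assume v: "norm v < d"
    have "norm (r (a + v) - r a - (\<lambda>v. grad r a \<bullet> v) (a + v - a)) \<le> norm (a + v - a) * e"
    proof (rule differentiable_bound_linearization[where S="closed_segment a (a + v)" and f'="\<lambda>x v. grad r x \<bullet> v"])
      show "onorm ((\<lambda>i. grad r x \<bullet> i) - (\<lambda>i. grad r a \<bullet> i)) \<le> e" if x: "x \<in> closed_segment a (a + v)" for x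
      proof (rule onorm_le)
        fix w
        have "norm (x - a) \<le> norm (a + v - a)"
          using segment_bound1[OF x] by (simp add: norm_minus_commute)
        then have "norm (grad r x - grad r a) \<le> e"
          using d(2)[of x a] v by (simp add: dist_norm)
        then show "norm (((\<lambda>i. grad r x \<bullet> i) - (\<lambda>i. grad r a \<bullet> i)) w) \<le> e * norm w"
          using Cauchy_Schwarz_ineq2[of "grad r x - grad r a" w]
          by (simp add: inner_diff_left) (meson mult_right_mono norm_ge_zero order_trans)
      qed
      show "a + t *\<^sub>R (a + v - a) \<in> closed_segment a (a + v)" if "t \<in> {0..1}" for t
        using that by (auto simp: in_segment algebra_simps intro!: exI[of _ t])
    qed (auto intro: has_derivative_at_withinI Cc_infinity_has_derivative[OF r])
    then show "\<bar>r (a + v) - r a - grad r a \<bullet> v\<bar> \<le> e * norm v" by (simp add: mult.commute)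
  qed
qed

section \<open>Convolution of an integrable function with a test function\<close>

lemma integrable_conv:
  fixes h :: "'a::euclidean_space \<Rightarrow> real"
  assumes "r \<in> Cc_infinity" "integrable lborel h"
  shows "integrable lborel (\<lambda>y. r (x - y) * h y)"
proof -
  obtain B where B: "\<And>x. \<bar>r x\<bar> \<le> B" using Cc_infinity_bounded[OF assms(1)] by blast
  have "integrable lborel (\<lambda>y. r (x - y) *\<^sub>R h y)"
    by (rule integrable_bounded_continuous_mult[OF continuous_on_compose2[OF Cc_infinity_continuous[OF assms(1)]] B assms(2)])
      (auto intro!: continuous_intros)
  then show ?thesis by simp
qed

text \<open>The uniform linearization error \<open>e' * norm v\<close> is integrated against
  \<open>\<bar>h\<bar>\<close>. The second claim recognises each partial derivative as a convolution
  of \<open>h\<close> with a partial derivative of \<open>r\<close>, again a test function, which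
  drives the induction for higher derivatives.\<close>

lemma has_derivative_conv:
  fixes h :: "'a::euclidean_space \<Rightarrow> real"
  assumes r: "r \<in> Cc_infinity" and h: "integrable lborel h"
  shows "((\<lambda>x. LINT y|lborel. r (x - y) * h y) has_derivative
    (\<lambda>v. (LINT y|lborel. h y *\<^sub>R grad r (x - y)) \<bullet> v)) (at x)"
    and "b \<in> Basis \<Longrightarrow> (LINT y|lborel. h y *\<^sub>R grad r (x - y)) \<bullet> b = (LINT y|lborel. (grad r (x - y) \<bullet> b) * h y)"
proof -
  obtain B where B: "\<And>x. norm (grad r x) \<le> B" using grad_bounded[OF r] by blast
  have ig: "integrable lborel (\<lambda>y. h y *\<^sub>R grad r (x - y))"
  proof (rule Bochner_Integration.integrable_bound[of _ "\<lambda>y. B *\<^sub>R h y"])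
    note [measurable] = grad_borel[OF r] borel_measurable_integrable[OF h]
    show "(\<lambda>y. h y *\<^sub>R grad r (x - y)) \<in> borel_measurable lborel" by measurable
    show "AE y in lborel. norm (h y *\<^sub>R grad r (x - y)) \<le> norm (B *\<^sub>R h y)"
    proof (rule AE_I2)
      fix y
      have "\<bar>h y\<bar> * norm (grad r (x - y)) \<le> \<bar>h y\<bar> * \<bar>B\<bar>"
        using B[of "x - y"] by (intro mult_left_mono) auto
      then show "norm (h y *\<^sub>R grad r (x - y)) \<le> norm (B *\<^sub>R h y)" by (simp add: abs_mult mult.commute)
    qed
  qed (use h in auto)
  let ?G = "LINT y|lborel. h y *\<^sub>R grad r (x - y)"
  have inner: "?G \<bullet> v = (LINT y|lborel. (grad r (x - y) \<bullet> v) * h y)" for v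
    using integral_inner_left[OF ig, of v] by (simp add: mult.commute)
  then show "?G \<bullet> b = (LINT y|lborel. (grad r (x - y) \<bullet> b) * h y)" .
  have ig2: "integrable lborel (\<lambda>y. (grad r (x - y) \<bullet> v) * h y)" for v
    using integrable_inner_left[of v, OF ig] by (simp add: mult.commute)
  show "((\<lambda>x. LINT y|lborel. r (x - y) * h y) has_derivative (\<lambda>v. ?G \<bullet> v)) (at x)"
    unfolding has_derivative_at_alt
  proof (intro conjI allI impI bounded_linear_inner_right)
    fix e :: real assume e: "0 < e"
    define H where "H = (LINT y|lborel. \<bar>h y\<bar>)"
    have H: "0 \<le> H" by (simp add: H_def)
    \<comment> \<open>\<open>H\<close> is the L^1 norm of \<open>h\<close>; adding 1 covers
      \<open>H = 0\<close>.\<close>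
    define e' where "e' = e / (H + 1)"
    have e': "0 < e'" "e' * H \<le> e" using e H by (auto simp: e'_def field_simps)
    obtain d where d: "0 < d" "\<And>a v. norm v < d \<Longrightarrow> \<bar>r (a + v) - r a - grad r a \<bullet> v\<bar> \<le> e' * norm v"
      using grad_linearization[OF r e'(1)] by blast
    show "\<exists>d>0. \<forall>x'. norm (x' - x) < d \<longrightarrow>
        norm ((LINT y|lborel. r (x' - y) * h y) - (LINT y|lborel. r (x - y) * h y) - ?G \<bullet> (x' - x)) \<le> e * norm (x' - x)"
    proof (intro exI[of _ d] conjI allI impI d)
      fix x' assume x': "norm (x' - x) < d"
      have "norm ((LINT y|lborel. r (x' - y) * h y) - (LINT y|lborel. r (x - y) * h y) - ?G \<bullet> (x' - x)) =
          norm (LINT y|lborel. r (x' - y) * h y - r (x - y) * h y - (grad r (x - y) \<bullet> (x' - x)) * h y)"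
        unfolding inner
        by (simp add: Bochner_Integration.integral_diff integrable_conv[OF r h] ig2)
      also have "\<dots> \<le> (LINT y|lborel. (e' * norm (x' - x)) * \<bar>h y\<bar>)"
      proof (rule Bochner_Integration.integral_norm_bound_integral)
        fix y
        have "\<bar>r ((x - y) + (x' - x)) - r (x - y) - grad r (x - y) \<bullet> (x' - x)\<bar> \<le> e' * norm (x' - x)"
          by (rule d(2)[OF x'])
        then have "\<bar>r (x' - y) - r (x - y) - grad r (x - y) \<bullet> (x' - x)\<bar> * \<bar>h y\<bar> \<le> e' * norm (x' - x) * \<bar>h y\<bar>"
          by (intro mult_right_mono) (simp_all add: algebra_simps)
        then show "norm (r (x' - y) * h y - r (x - y) * h y - (grad r (x - y) \<bullet> (x' - x)) * h y) \<le> e' * norm (x' - x) * \<bar>h y\<bar>"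
          by (simp add: abs_mult[symmetric] left_diff_distrib)
      qed (auto intro!: Bochner_Integration.integrable_diff integrable_conv[OF r h] ig2 h)
      also have "\<dots> = (e' * H) * norm (x' - x)" by (simp add: H_def)
      also have "\<dots> \<le> e * norm (x' - x)" by (intro mult_right_mono e') simp
      finally show "norm ((LINT y|lborel. r (x' - y) * h y) - (LINT y|lborel. r (x - y) * h y) - ?G \<bullet> (x' - x)) \<le> e * norm (x' - x)" .
    qed
  qed
qed

lemma C_k_conv:
  fixes h :: "'a::euclidean_space \<Rightarrow> real"
  assumes h: "integrable lborel h"
  shows "r \<in> Cc_infinity \<Longrightarrow> C_k k (\<lambda>x. LINT y|lborel. r (x - y) * h y)"
proof (induction k arbitrary: r)
  case 0
  have "continuous (at x) (\<lambda>x. LINT y|lborel. r (x - y) * h y)" for x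
    using has_derivative_conv(1)[OF 0 h] by (rule has_derivative_continuous)
  then show ?case by (simp add: continuous_at_imp_continuous_on)
next
  case (Suc k)
  show ?case
  proof (rule C_k_SucI[OF has_derivative_conv(1)[OF Suc.prems h]])
    fix b :: 'a assume b: "b \<in> Basis"
    show "C_k k (\<lambda>x. (LINT y|lborel. h y *\<^sub>R grad r (x - y)) \<bullet> b)"
      using Suc.IH[OF Cc_infinity_partial[OF Suc.prems b]]
      by (simp add: has_derivative_conv(2)[OF Suc.prems h b])
  qed
qed

section \<open>Regularisation and weak gradients\<close>

lemma integrable_modular_1:
  fixes f :: "'a::euclidean_space \<Rightarrow> 'b::euclidean_space"
  assumes "f \<in> borel_measurable borel" "modular 1 f < \<infinity>"
  shows "integrable lborel f"
  using assms by (simp add: modular_def integrable_iff_bounded)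

lemma modular_eq_0_imp_AE:
  fixes f :: "'a::euclidean_space \<Rightarrow> 'b::euclidean_space"
  assumes "f \<in> borel_measurable lebesgue" "modular p f = 0"
  shows "AE x in lebesgue. f x = 0"
proof -
  note [measurable] = assms(1)
  have "(\<integral>\<^sup>+x. ennreal (norm (f x) powr p) \<partial>lebesgue) = 0 \<longleftrightarrow>
      (AE x in lebesgue. ennreal (norm (f x) powr p) = 0)"
    by (rule nn_integral_0_iff_AE) measurable
  then have "AE x in lebesgue. ennreal (norm (f x) powr p) = 0"
    using assms(2) by (simp add: modular_lebesgue)
  then show ?thesis by eventually_elim (simp add: ennreal_eq_0_iff)
qed

lemma Cc_infinity_integrable: "u \<in> Cc_infinity \<Longrightarrow> integrable lborel u"
  by (intro integrable_modular_1 Cc_infinity_borel Cc_infinity_modular_finite) auto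

section \<open>Mollification\<close>

definition mollifier :: "real \<Rightarrow> ('a::euclidean_space \<Rightarrow> real) \<Rightarrow> bool" where
  "mollifier d r \<longleftrightarrow> r \<in> Cc_infinity \<and> (\<forall>x. 0 \<le> r x) \<and> (\<forall>x. d \<le> norm x \<longrightarrow> r x = 0) \<and>
    (LINT x|lborel. r x) = 1"

lemma mollifier_exists:
  assumes d: "0 < d"
  obtains r :: "'a::euclidean_space \<Rightarrow> real" where "mollifier d r"
proof -
  let ?b = "bump d :: 'a \<Rightarrow> real"
  define I where "I = (LINT x|lborel. ?b x)"
  have int: "integrable lborel ?b" by (intro Cc_infinity_integrable Cc_infinity_bump d)
  have "I \<noteq> 0"
  proof
    assume "I = 0"
    then have "AE x in lborel. ?b x = 0"
      using integral_nonneg_eq_0_iff_AE[OF int] bump_nonneg unfolding I_def by auto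
    then have "AE x in lborel. x \<notin> ball (0::'a) d"
      by eventually_elim (use bump_pos[of _ d] in force)
    then have "emeasure lborel (ball (0::'a) d) = 0"
      using AE_iff_measurable[of "ball (0::'a) d" lborel "\<lambda>x. x \<notin> ball 0 d"]
      by (auto simp: ball_def)
    then show False
      using content_ball_pos[OF d, of "0::'a"] by (simp add: measure_def)
  qed
  moreover have "0 \<le> I" unfolding I_def by (intro Bochner_Integration.integral_nonneg bump_nonneg)
  ultimately have I: "0 < I" by simp
  show ?thesis
  proof (rule that[of "\<lambda>x. (1 / I) * ?b x"], unfold mollifier_def, intro conjI allI impI)
    show "(\<lambda>x. (1 / I) * ?b x) \<in> Cc_infinity" by (intro Cc_infinity_cmult Cc_infinity_bump d)
    show "0 \<le> (1 / I) * ?b x" for x using I bump_nonneg[of d x] by simp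
    show "(1 / I) * ?b x = 0" if "d \<le> norm x" for x using bump_eq_0[OF d that] by simp
    show "(LINT x|lborel. (1 / I) * ?b x) = 1"
      using I by (simp add: I_def[symmetric])
  qed
qed

text \<open>The mollified function minus \<open>f\<close> is the average of
  \<open>f (x - z) - f x\<close> with the weight \<open>r\<close> of mass 1, so Jensen's inequality
  bounds it by the translation modulus over \<open>norm z < d\<close>. The radius \<open>d\<close>
  works for every mollifier, so that two functions can later share one.\<close>

lemma mollify_close:
  fixes f :: "'a::euclidean_space \<Rightarrow> 'b::euclidean_space"
  assumes f [measurable]: "f \<in> borel_measurable borel" and int: "integrable lborel f"
    and fin: "modular p f < \<infinity>" and p: "1 \<le> p" and e: "0 < e"
  obtains d where "0 < d"
    "\<And>r. mollifier d r \<Longrightarrow> modular p (\<lambda>x. (LINT y|lborel. r (x - y) *\<^sub>R f y) - f x) < ennreal e"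
proof -
  obtain d where d: "0 < d" "\<And>z. norm z < d \<Longrightarrow> modular p (\<lambda>x. f (x - z) - f x) < ennreal (e / 2)"
    using modular_translation_continuous[OF f fin, of "e / 2"] p e by auto
  show ?thesis
  proof (rule that[OF d(1)])
    fix r :: "'a \<Rightarrow> real"
    assume "mollifier d r"
    then have r: "r \<in> Cc_infinity" and r0: "\<forall>x. 0 \<le> r x" and rd: "\<forall>x. d \<le> norm x \<longrightarrow> r x = 0"
      and r1: "(LINT x|lborel. r x) = 1" by (auto simp: mollifier_def)
    have [measurable]: "r \<in> borel_measurable borel" using r by (rule Cc_infinity_borel)
    note ir = Cc_infinity_integrable[OF r]
    have nr: "(\<integral>\<^sup>+z. ennreal (r z) \<partial>lborel) = 1"
      using nn_integral_eq_integral[OF ir] r0 r1 by simp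
    obtain B where B: "\<And>x. \<bar>r x\<bar> \<le> B" using Cc_infinity_bounded[OF r] by blast
    have eq: "(LINT y|lborel. r (x - y) *\<^sub>R f y) - f x = (LINT z|lborel. r z *\<^sub>R (f (x - z) - f x))" for x
    proof -
      have i1: "integrable lborel (\<lambda>z. r z *\<^sub>R f (x - z))"
      proof (rule integrable_bounded_continuous_mult[OF Cc_infinity_continuous[OF r] B])
        have "integrable (distr lborel borel (\<lambda>z. x - z)) f" using int by (simp add: lborel_distr_reflect)
        then show "integrable lborel (\<lambda>z. f (x - z))" by (simp add: integrable_distr_eq)
      qed
      have "(LINT y|lborel. r (x - y) *\<^sub>R f y) = (LINT z|lborel. r (x - (x - z)) *\<^sub>R f (x - z))"
        by (rule integral_reflect[symmetric]) measurable
      also have "\<dots> - f x = (LINT z|lborel. r z *\<^sub>R f (x - z)) - (LINT z|lborel. r z *\<^sub>R f x)"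
        using ir r1 by simp
      also have "\<dots> = (LINT z|lborel. r z *\<^sub>R f (x - z) - r z *\<^sub>R f x)"
        by (intro Bochner_Integration.integral_diff[symmetric] i1 integrable_scaleR_left ir)
      finally show ?thesis by (simp add: scaleR_diff_right)
    qed
    have "modular p (\<lambda>x. LINT z|lborel. r z *\<^sub>R (f (x - z) - f x)) \<le>
      ennreal (1 powr (p - 1)) * (\<integral>\<^sup>+z. ennreal (r z) * modular p (\<lambda>x. f (x - z) - f x) \<partial>lborel)"
      by (rule modular_integral_le) (use r0 nr p in \<open>auto intro: lborel.sigma_finite_measure_axioms\<close>)
    also have "\<dots> \<le> (\<integral>\<^sup>+z. ennreal (r z) * ennreal (e / 2) \<partial>lborel)"
    proof -
      have "ennreal (r z) * modular p (\<lambda>x. f (x - z) - f x) \<le> ennreal (r z) * ennreal (e / 2)" for z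
      proof (cases "norm z < d")
        case True
        from less_imp_le[OF d(2)[OF this]] show ?thesis by (rule mult_left_mono) simp
      qed (use rd in auto)
      then show ?thesis by (auto intro!: nn_integral_mono)
    qed
    also have "\<dots> = ennreal (e / 2)" using nr by (simp add: nn_integral_multc)
    also have "\<dots> < ennreal e" using e by (simp add: ennreal_less_iff)
    finally show "modular p (\<lambda>x. (LINT y|lborel. r (x - y) *\<^sub>R f y) - f x) < ennreal e" by (simp add: eq)
  qed
qed

section \<open>Local integrability, null sets and uniqueness of weak gradients\<close>

lemma integrable_locally:
  fixes u :: "'a::euclidean_space \<Rightarrow> 'b::euclidean_space" and F :: "'a \<Rightarrow> 'c::euclidean_space"
  assumes u: "locally_integrable u" and F: "F \<in> borel_measurable borel"
    and B: "\<And>y. norm (F y) \<le> B * norm (u y)" and R: "\<And>y. R < norm y \<Longrightarrow> F y = 0"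
  shows "integrable lborel F"
proof -
  have "integrable lebesgue (\<lambda>y. indicator (cball 0 R) y *\<^sub>R u y)"
    using u by (simp add: locally_integrable_def set_integrable_def)
  then have "integrable lebesgue (\<lambda>y. B * norm (indicator (cball 0 R) y *\<^sub>R u y))"
    by (intro integrable_mult_right integrable_norm)
  then have "integrable lebesgue F"
  proof (rule Bochner_Integration.integrable_bound)
    show "AE y in lebesgue. norm (F y) \<le> norm (B * norm (indicator (cball 0 R) y *\<^sub>R u y))"
    proof (rule AE_I2)
      fix y :: 'a
      have "norm (F y) \<le> \<bar>B * norm (u y)\<bar>" using B[of y] by linarith
      then show "norm (F y) \<le> norm (B * norm (indicator (cball 0 R) y *\<^sub>R u y))"
        using R[of y] by (cases "norm y \<le> R") auto
    qed
  qed (intro borel_lebesgue F)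
  then show ?thesis using F by (simp add: integrable_completion)
qed

lemma locally_integrable_cong_AE:
  assumes "locally_integrable u" "AE x in lebesgue. u x = v x"
    "u \<in> borel_measurable lebesgue" "v \<in> borel_measurable lebesgue"
  shows "locally_integrable v"
  unfolding locally_integrable_def
proof (intro allI impI)
  fix K :: "'a set" assume K: "compact K"
  note [measurable] = assms(3,4)
  have "K \<in> sets borel" using K by (intro borel_closed compact_imp_closed)
  then have [measurable]: "K \<in> sets lebesgue" by simp
  have "integrable lebesgue (\<lambda>y. indicator K y *\<^sub>R u y)"
    using assms(1) K by (simp add: locally_integrable_def set_integrable_def)
  then have "integrable lebesgue (\<lambda>y. indicator K y *\<^sub>R v y)"
    by (subst (asm) integrable_cong_AE[where g="\<lambda>y. indicator K y *\<^sub>R v y"])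
      (use assms(2) in \<open>auto elim: eventually_mono\<close>)
  then show "set_integrable lebesgue K v" by (simp add: set_integrable_def)
qed

lemma weak_gradient_cong_AE:
  assumes "has_weak_gradient u g" "AE x in lebesgue. u x = u' x" "AE x in lebesgue. g x = g' x"
    "u \<in> borel_measurable lebesgue" "u' \<in> borel_measurable borel"
    "g \<in> borel_measurable lebesgue" "g' \<in> borel_measurable borel"
  shows "has_weak_gradient u' g'"
  unfolding has_weak_gradient_def
proof (intro conjI ballI)
  note [measurable] = assms(4,6) assms(5,7)[THEN borel_lebesgue]
  show "locally_integrable u'" "locally_integrable g'"
    using assms locally_integrable_cong_AE[OF _ assms(2)] locally_integrable_cong_AE[OF _ assms(3)]
    by (auto simp: has_weak_gradient_def intro: borel_lebesgue)
  fix \<phi> :: "'a \<Rightarrow> real" and b :: 'a assume \<phi>: "\<phi> \<in> Cc_infinity" and b: "b \<in> Basis"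
  have [measurable]: "(\<lambda>x. frechet_derivative \<phi> (at x) b) \<in> borel_measurable lebesgue" "\<phi> \<in> borel_measurable lebesgue"
    using \<phi> b Cc_infinity_borel[OF Cc_infinity_partial[OF \<phi> b]]
    by (auto intro!: borel_lebesgue Cc_infinity_borel simp: frechet_derivative_eq_grad[OF Cc_infinity_differentiable])
  have "(LINT x|lebesgue. u' x * frechet_derivative \<phi> (at x) b) = (LINT x|lebesgue. u x * frechet_derivative \<phi> (at x) b)"
    by (rule integral_cong_AE) (use assms(2) in \<open>auto elim: eventually_mono\<close>)
  also have "\<dots> = - (LINT x|lebesgue. (g x \<bullet> b) * \<phi> x)"
    using assms(1) \<phi> b by (simp add: has_weak_gradient_def)
  also have "(LINT x|lebesgue. (g x \<bullet> b) * \<phi> x) = (LINT x|lebesgue. (g' x \<bullet> b) * \<phi> x)"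
    by (rule integral_cong_AE) (use assms(3) in \<open>auto elim: eventually_mono\<close>)
  finally show "(LINT x|lebesgue. u' x * frechet_derivative \<phi> (at x) b) = - (LINT x|lebesgue. (g' x \<bullet> b) * \<phi> x)" .
qed

text \<open>Multiplying \<open>v\<close> by a bump gives an integrable function \<open>?h\<close>.
  Its mollification at \<open>x\<close> pairs \<open>v\<close> with the test function
  \<open>bump (Suc k) y * r (x - y)\<close> of \<open>y\<close> and therefore vanishes, while
  mollifications come arbitrarily close to \<open>?h\<close> in L^1. Growing bumps, positive on
  their balls, then cover the space.\<close>

lemma fundamental_lemma_borel:
  fixes v :: "'a::euclidean_space \<Rightarrow> real"
  assumes v: "locally_integrable v" and [measurable]: "v \<in> borel_measurable borel"
    and 0: "\<And>\<phi>. \<phi> \<in> Cc_infinity \<Longrightarrow> (LINT x|lborel. v x * \<phi> x) = 0"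
  shows "AE x in lebesgue. v x = 0"
proof -
  have "AE x in lebesgue. bump (Suc k) x * v x = 0" for k
  proof -
    let ?h = "\<lambda>x. bump (Suc k) x * v x"
    have bC: "bump (Suc k) \<in> (Cc_infinity :: ('a \<Rightarrow> real) set)" by (intro Cc_infinity_bump) auto
    have [measurable]: "bump (Suc k) \<in> borel_measurable (borel :: 'a measure)"
      using bC by (rule Cc_infinity_borel)
    have hm: "?h \<in> borel_measurable borel" by measurable
    have ih: "integrable lborel ?h"
    proof (rule integrable_locally[OF v hm, where B=1 and R="Suc k"])
      show "norm (bump (Suc k) y * v y) \<le> 1 * norm (v y)" for y
      proof -
        have "bump (Suc k) y \<le> 1" using bump_le_1[of "Suc k" y] by (smt (verit) exp_le_one_iff)
        then show ?thesis using bump_nonneg[of "Suc k" y] by (simp add: abs_mult mult_left_le_one_le)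
      qed
    qed (simp add: bump_eq_0)
    have mh: "modular 1 ?h < \<infinity>"
      using ih by (simp add: modular_def integrable_iff_bounded)
    have "modular 1 ?h \<le> ennreal e" if e: "0 < e" for e
    proof -
      obtain d where d: "0 < d" "\<And>r. mollifier d r \<Longrightarrow> modular 1 (\<lambda>x. (LINT y|lborel. r (x - y) *\<^sub>R ?h y) - ?h x) < ennreal e"
        using mollify_close[OF hm ih mh order.refl e] by blast
      obtain r :: "'a \<Rightarrow> real" where r: "mollifier d r"
        using mollifier_exists[OF d(1)] .
      have rC: "r \<in> Cc_infinity" using r by (simp add: mollifier_def)
      have eq0: "(LINT y|lborel. r (x - y) *\<^sub>R ?h y) = 0" for x
      proof -
        have "(\<lambda>y. bump (Suc k) y * r (x - y)) \<in> Cc_infinity"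
          by (intro Cc_infinity_mult bC C_k_reflect Cc_infinity_C_k rC)
        from 0[OF this] show ?thesis by (simp add: mult_ac)
      qed
      have "modular 1 (\<lambda>x. 0 - ?h x) < ennreal e" using d(2)[OF r] unfolding eq0 .
      then show ?thesis by (simp only: diff_0 modular_uminus less_imp_le)
    qed
    then have "modular 1 ?h \<le> 0"
      by - (rule ennreal_le_epsilon, simp)
    then have "modular 1 ?h = 0" by simp
    with borel_lebesgue[OF hm] show ?thesis by (rule modular_eq_0_imp_AE)
  qed
  then have "AE x in lebesgue. \<forall>k. bump (Suc k) x * v x = 0"
    by (simp only: AE_all_countable) blast
  then show ?thesis
  proof eventually_elim
    case (elim x)
    obtain k :: nat where "norm x \<le> real k" using real_arch_simple by blast
    then have "norm x < Suc k" by simp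
    from bump_pos[OF this] elim show ?case by (metis less_irrefl mult_eq_0_iff)
  qed
qed

text \<open>Coordinatewise reduction to the scalar case for a Borel representative of each component
  of \<open>g - g'\<close>. Phrased as equality of pairings because it serves both weak and
  fractional gradients, each determined by its pairings with test functions.\<close>

lemma fundamental_lemma:
  fixes g g' :: "'a::euclidean_space \<Rightarrow> 'a"
  assumes li: "locally_integrable g" "locally_integrable g'"
    and "g \<in> borel_measurable lebesgue" "g' \<in> borel_measurable lebesgue"
    and eq: "\<And>\<phi> b. \<phi> \<in> Cc_infinity \<Longrightarrow> b \<in> Basis \<Longrightarrow>
      (LINT x|lebesgue. (g x \<bullet> b) * \<phi> x) = (LINT x|lebesgue. (g' x \<bullet> b) * \<phi> x)"
  shows "AE x in lebesgue. g x = g' x"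
proof -
  have "AE x in lebesgue. (g x - g' x) \<bullet> b = 0" if b: "b \<in> Basis" for b
  proof -
    note [measurable] = assms(3,4)
    have l: "locally_integrable (\<lambda>x. (g x - g' x) \<bullet> b)"
      unfolding locally_integrable_def
    proof (intro allI impI)
      fix K :: "'a set" assume K: "compact K"
      then have "integrable lebesgue (\<lambda>x. (indicator K x *\<^sub>R g x - indicator K x *\<^sub>R g' x) \<bullet> b)"
        using li by (intro integrable_inner_left Bochner_Integration.integrable_diff)
          (auto simp: locally_integrable_def set_integrable_def)
      then show "set_integrable lebesgue K (\<lambda>x. (g x - g' x) \<bullet> b)"
        by (simp add: set_integrable_def inner_diff_left right_diff_distrib)
    qed
    have m [measurable]: "(\<lambda>x. (g x - g' x) \<bullet> b) \<in> borel_measurable lebesgue" by measurable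
    obtain v where v: "v \<in> borel_measurable borel" and ae: "AE x in lebesgue. (g x - g' x) \<bullet> b = v x"
      using borel_representative[OF m] by blast
    note [measurable] = borel_lebesgue[OF v]
    have lv: "locally_integrable v" by (rule locally_integrable_cong_AE[OF l ae m borel_lebesgue[OF v]])
    have "AE x in lebesgue. v x = 0"
    proof (rule fundamental_lemma_borel[OF lv v])
      fix \<phi> :: "'a \<Rightarrow> real" assume \<phi>: "\<phi> \<in> Cc_infinity"
      note \<phi>m = Cc_infinity_borel[OF \<phi>]
      note [measurable] = borel_lebesgue[OF \<phi>m]
      obtain R where R: "\<And>x. R < norm x \<Longrightarrow> \<phi> x = 0" using Cc_infinity_bounded_support[OF \<phi>] by blast
      obtain B where B: "\<And>x. \<bar>\<phi> x\<bar> \<le> B" "0 < B" using Cc_infinity_bounded[OF \<phi>] by blast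
      have int: "integrable lebesgue (\<lambda>x. (f x \<bullet> b) * \<phi> x)"
        if lf: "locally_integrable f" and fm: "f \<in> borel_measurable lebesgue" for f :: "'a \<Rightarrow> 'a"
      proof -
        note [measurable] = fm
        have "integrable lebesgue (\<lambda>x. B * norm (indicator (cball 0 R) x *\<^sub>R f x))"
          using lf by (intro integrable_mult_right integrable_norm)
            (auto simp: locally_integrable_def set_integrable_def)
        then show ?thesis
        proof (rule Bochner_Integration.integrable_bound)
          show "AE x in lebesgue. norm ((f x \<bullet> b) * \<phi> x) \<le> norm (B * norm (indicator (cball 0 R) x *\<^sub>R f x))"
          proof (rule AE_I2)
            fix x
            have "\<bar>f x \<bullet> b\<bar> * \<bar>\<phi> x\<bar> \<le> norm (f x) * B"
              using Basis_le_norm[OF b, of "f x"] B by (intro mult_mono) auto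
            then show "norm ((f x \<bullet> b) * \<phi> x) \<le> norm (B * norm (indicator (cball 0 R) x *\<^sub>R f x))"
              using R[of x] B(2) by (cases "norm x \<le> R") (auto simp: abs_mult mult.commute)
          qed
        qed measurable
      qed
      have "(LINT x|lborel. v x * \<phi> x) = (LINT x|lebesgue. v x * \<phi> x)"
        by (rule integral_completion[symmetric]) (use v \<phi>m in auto)
      also have "\<dots> = (LINT x|lebesgue. (g x \<bullet> b) * \<phi> x - (g' x \<bullet> b) * \<phi> x)"
        by (rule integral_cong_AE) (use ae in \<open>auto elim!: eventually_mono simp: inner_diff_left simp flip: left_diff_distrib\<close>)
      also have "\<dots> = (LINT x|lebesgue. (g x \<bullet> b) * \<phi> x) - (LINT x|lebesgue. (g' x \<bullet> b) * \<phi> x)"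
        by (intro Bochner_Integration.integral_diff int li assms)
      also have "\<dots> = 0"
        using eq[OF \<phi> b] by simp
      finally show "(LINT x|lborel. v x * \<phi> x) = 0" .
    qed
    with ae show ?thesis by eventually_elim simp
  qed
  then have "AE x in lebesgue. \<forall>b\<in>Basis. (g x - g' x) \<bullet> b = 0" by (intro AE_finite_allI) auto
  then show ?thesis
    by eventually_elim (auto simp: euclidean_eq_iff[where 'a='a] inner_diff_left)
qed

lemma weak_gradient_unique:
  assumes "has_weak_gradient u g" "has_weak_gradient u g'"
    "g \<in> borel_measurable lebesgue" "g' \<in> borel_measurable lebesgue"
  shows "AE x in lebesgue. g x = g' x"
proof (rule fundamental_lemma)
  fix \<phi> :: "'a \<Rightarrow> real" and b :: 'a assume \<phi>: "\<phi> \<in> Cc_infinity" and b: "b \<in> Basis"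
  have "(LINT x|lebesgue. u x * frechet_derivative \<phi> (at x) b) = - (LINT x|lebesgue. (f x \<bullet> b) * \<phi> x)"
    if "has_weak_gradient u f" for f
    using that \<phi> b by (simp add: has_weak_gradient_def)
  from this[OF assms(1)] this[OF assms(2)]
  show "(LINT x|lebesgue. (g x \<bullet> b) * \<phi> x) = (LINT x|lebesgue. (g' x \<bullet> b) * \<phi> x)" by simp
qed (use assms in \<open>auto simp: has_weak_gradient_def\<close>)

section \<open>Density of test functions in Sobolev space\<close>

lemma Cc_infinity_conv:
  fixes h :: "'a::euclidean_space \<Rightarrow> real"
  assumes r: "r \<in> Cc_infinity" and h: "integrable lborel h" and R: "\<And>x. R < norm x \<Longrightarrow> h x = 0"
  shows "(\<lambda>x. LINT y|lborel. r (x - y) * h y) \<in> Cc_infinity"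
proof -
  obtain S where S: "\<And>x. S < norm x \<Longrightarrow> r x = 0" using Cc_infinity_bounded_support[OF r] by blast
  show ?thesis
  proof (rule Cc_infinityI[of _ "R + S"])
    fix x :: 'a assume x: "R + S < norm x"
    have "r (x - y) * h y = 0" for y
    proof (cases "R < norm y")
      case False
      then have "S < norm (x - y)" using x norm_triangle_sub[of x y] by linarith
      then show ?thesis using S by simp
    qed (simp add: R)
    then show "(LINT y|lborel. r (x - y) * h y) = 0" by (simp only: Bochner_Integration.integral_zero)
  qed (rule C_k_conv[OF h r])
qed

text \<open>Integration by parts against \<open>y \<mapsto> c y * r (x - y)\<close> moves the gradient of a regularised and
  truncated Sobolev function onto the weak gradient.\<close>

lemma grad_conv_weak:
  fixes u :: "'a::euclidean_space \<Rightarrow> real"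
  assumes w: "has_weak_gradient u g" and [measurable]: "u \<in> borel_measurable borel" "g \<in> borel_measurable borel"
    and c: "c \<in> Cc_infinity" and r: "r \<in> Cc_infinity"
  defines "G \<equiv> \<lambda>y. c y *\<^sub>R g y + u y *\<^sub>R grad c y"
  shows "integrable lborel (\<lambda>y. c y * u y)" "integrable lborel G"
    "grad (\<lambda>x. LINT y|lborel. r (x - y) * (c y * u y)) x = (LINT y|lborel. r (x - y) *\<^sub>R G y)"
proof -
  have lu: "locally_integrable u" and lg: "locally_integrable g" using w by (auto simp: has_weak_gradient_def)
  note [measurable] = Cc_infinity_borel[OF c] Cc_infinity_borel[OF r] grad_borel[OF c] grad_borel[OF r]
  obtain R where R: "\<And>x. R < norm x \<Longrightarrow> c x = 0" using Cc_infinity_bounded_support[OF c] by blast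
  have R': "grad c y = 0" if "R < norm y" for y by (rule grad_eq_0[OF R that])
  obtain B where B: "\<And>x. \<bar>c x\<bar> \<le> B" using Cc_infinity_bounded[OF c] by blast
  obtain B' where B': "\<And>x. norm (grad c x) \<le> B'" using grad_bounded[OF c] by blast
  obtain A where A: "\<And>x. \<bar>r x\<bar> \<le> A" "0 < A" using Cc_infinity_bounded[OF r] by blast
  obtain A' where A': "\<And>x. norm (grad r x) \<le> A'" using grad_bounded[OF r] by blast
  show icu: "integrable lborel (\<lambda>y. c y * u y)"
    by (rule integrable_locally[OF lu, of _ B R]) (auto simp: abs_mult R intro: mult_right_mono B)
  have i1: "integrable lborel (\<lambda>y. c y *\<^sub>R g y)"
    by (rule integrable_locally[OF lg, of _ B R]) (auto simp: R intro: mult_right_mono B)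
  have i2: "integrable lborel (\<lambda>y. u y *\<^sub>R grad c y)"
    by (rule integrable_locally[OF lu, of _ B' R])
      (auto simp: R' mult.commute[of "\<bar>u _\<bar>"] intro: mult_right_mono B')
  show iG: "integrable lborel G" unfolding G_def by (intro Bochner_Integration.integrable_add i1 i2)
  have iR: "integrable lborel (\<lambda>y. r (x - y) *\<^sub>R F y)"
    if F: "integrable lborel F" for F :: "'a \<Rightarrow> 'a"
    by (rule integrable_bounded_continuous_mult[OF continuous_on_compose2[OF Cc_infinity_continuous[OF r]] A(1) F])
      (auto intro!: continuous_intros)
  show "grad (\<lambda>x. LINT y|lborel. r (x - y) * (c y * u y)) x = (LINT y|lborel. r (x - y) *\<^sub>R G y)"
  proof (rule euclidean_eqI)
    fix b :: 'a assume b: "b \<in> Basis"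
    have "grad (\<lambda>x. LINT y|lborel. r (x - y) * (c y * u y)) x = (LINT y|lborel. (c y * u y) *\<^sub>R grad r (x - y))"
      by (rule grad_eqI[OF has_derivative_conv(1)[OF r icu]])
    then have "grad (\<lambda>x. LINT y|lborel. r (x - y) * (c y * u y)) x \<bullet> b = (LINT y|lborel. (grad r (x - y) \<bullet> b) * (c y * u y))"
      using has_derivative_conv(2)[OF r icu b] by simp
    let ?\<psi> = "\<lambda>y. c y * r (x - y)"
    have \<psi>: "?\<psi> \<in> Cc_infinity" by (intro Cc_infinity_mult c C_k_reflect Cc_infinity_C_k r)
    \<comment> \<open>The inner sign from \<open>y -> r (x - y)\<close> cancels the minus sign in
      the definition of the weak gradient, so \<open>grad r\<close> is traded for \<open>g\<close>
      without a sign; differentiating \<open>c\<close> produces the extra term in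
      \<open>G\<close>.\<close>
    have d: "frechet_derivative ?\<psi> (at y) b = (grad c y \<bullet> b) * r (x - y) - c y * (grad r (x - y) \<bullet> b)" for y
    proof -
      have "((\<lambda>y. r (x - y)) has_derivative (\<lambda>v. grad r (x - y) \<bullet> (- v))) (at y)"
        by (rule has_derivative_compose[of "\<lambda>y. x - y" _ _ _ r])
          (auto intro!: derivative_eq_intros Cc_infinity_has_derivative[OF r])
      from has_derivative_mult[OF Cc_infinity_has_derivative[OF c] this]
      show ?thesis by (subst frechet_derivative_at[symmetric], assumption) (simp add: mult.commute)
    qed
    have i3: "integrable lborel (\<lambda>y. u y * ((grad c y \<bullet> b) * r (x - y)))"
      using integrable_inner_left[of b, OF iR[OF i2]] by (simp add: mult_ac)
    have i4: "integrable lborel (\<lambda>y. u y * (c y * (grad r (x - y) \<bullet> b)))"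
      using integrable_conv[OF Cc_infinity_partial[OF r b] icu, of x] by (simp add: mult_ac)
    have i5: "integrable lborel (\<lambda>y. (g y \<bullet> b) * (c y * r (x - y)))"
      using integrable_inner_left[of b, OF iR[OF i1]] by (simp add: mult_ac)
    have "(LINT y|lborel. u y * ((grad c y \<bullet> b) * r (x - y))) - (LINT y|lborel. u y * (c y * (grad r (x - y) \<bullet> b)))
        = (LINT y|lborel. u y * frechet_derivative ?\<psi> (at y) b)"
      unfolding d by (subst Bochner_Integration.integral_diff[symmetric, OF i3 i4]) (simp add: right_diff_distrib)
    also have "\<dots> = (LINT y|lebesgue. u y * frechet_derivative ?\<psi> (at y) b)"
      by (rule integral_completion[symmetric]) (simp add: d)
    also have "\<dots> = - (LINT y|lebesgue. (g y \<bullet> b) * (c y * r (x - y)))"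
      using w \<psi> b by (simp add: has_weak_gradient_def)
    also have "(LINT y|lebesgue. (g y \<bullet> b) * (c y * r (x - y))) = (LINT y|lborel. (g y \<bullet> b) * (c y * r (x - y)))"
      by (rule integral_completion) simp
    finally have "(LINT y|lborel. u y * (c y * (grad r (x - y) \<bullet> b))) =
        (LINT y|lborel. (g y \<bullet> b) * (c y * r (x - y))) + (LINT y|lborel. u y * ((grad c y \<bullet> b) * r (x - y)))"
      by simp
    also have "\<dots> = (LINT y|lborel. (g y \<bullet> b) * (c y * r (x - y)) + u y * ((grad c y \<bullet> b) * r (x - y)))"
      by (rule Bochner_Integration.integral_add[symmetric, OF i5 i3])
    also have "\<dots> = (LINT y|lborel. (r (x - y) *\<^sub>R G y) \<bullet> b)"
      by (rule Bochner_Integration.integral_cong) (auto simp: G_def inner_add_left algebra_simps)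
    also have "\<dots> = (LINT y|lborel. r (x - y) *\<^sub>R G y) \<bullet> b"
      by (rule integral_inner_left[OF iR[OF iG]])
    finally show "grad (\<lambda>x. LINT y|lborel. r (x - y) * (c y * u y)) x \<bullet> b = (LINT y|lborel. r (x - y) *\<^sub>R G y) \<bullet> b"
      using \<open>grad _ x \<bullet> b = _\<close> by (simp add: mult_ac)
  qed
qed

text \<open>Cut off, then mollify. The cutoffs \<open>c n\<close> tend to 1 with gradients of order
  \<open>1/n\<close>, so \<open>c n * u\<close> and its weak gradient \<open>G n\<close> converge to
  \<open>u\<close> and \<open>g\<close> by dominated convergence. For a fixed \<open>n\<close> both
  are integrable, and mollification commutes with the gradient.\<close>

lemma Cc_infinity_dense_Sobolev:
  fixes u :: "'a::euclidean_space \<Rightarrow> real"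
  assumes w: "has_weak_gradient u g" and um [measurable]: "u \<in> borel_measurable borel"
    and gm [measurable]: "g \<in> borel_measurable borel"
    and fin: "modular p u < \<infinity>" "modular p g < \<infinity>" and p: "1 \<le> p" and e: "0 < e"
  shows "\<exists>U\<in>Cc_infinity. modular p (\<lambda>x. U x - u x) < ennreal e \<and> modular p (\<lambda>x. grad U x - g x) < ennreal e"
proof -
  \<comment> \<open>The maximum of \<open>bump\<close> is \<open>exp (- 1)\<close>, so the factor
    \<open>exp 1\<close> gives values in [0, 1] and pointwise limit 1; \<open>Suc n\<close> keeps
    the radius positive.\<close>
  define c where "c n x = exp 1 * bump (Suc n) x" for n and x :: 'a
  define G where "G n y = c n y *\<^sub>R g y + u y *\<^sub>R grad (c n) y" for n y
  have cC: "c n \<in> Cc_infinity" for n unfolding c_def by (intro Cc_infinity_cmult Cc_infinity_bump) simp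
  note [measurable] = Cc_infinity_borel[OF cC] grad_borel[OF cC]
  have [measurable]: "G n \<in> borel_measurable borel" for n unfolding G_def by measurable
  have c01: "0 \<le> c n x" "c n x \<le> 1" for n x
    using bump_nonneg[of "Suc n" x] bump_le_1[of "Suc n" x]
    by (auto simp: c_def exp_minus field_simps)
  have gradc: "grad (c n) x = exp 1 *\<^sub>R grad (bump (Suc n)) x" for n x
    unfolding c_def using has_derivative_mult_right[OF Cc_infinity_has_derivative[OF Cc_infinity_bump[of "Suc n"]], of "exp 1" x]
    by (intro grad_eqI) simp
  define C where "C = 4 * exp (1::real)"
  have C0: "0 \<le> C" by (simp add: C_def)
  have gradc_le: "norm (grad (c n) x) \<le> C / Suc n" for n x
  proof -
    have "exp 1 * norm (grad (bump (Suc n)) x) \<le> exp 1 * (4 / real (Suc n))"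
      by (intro mult_left_mono norm_grad_bump_le) auto
    then show ?thesis by (simp add: gradc C_def mult.commute)
  qed
  have climit: "(\<lambda>n. c n x) \<longlonglongrightarrow> 1" for x
  proof -
    have "(\<lambda>n. 1 - (x \<bullet> x) / (real (Suc n))\<^sup>2) \<longlonglongrightarrow> 1 - 0"
    proof (intro tendsto_intros)
      have "(\<lambda>n. (x \<bullet> x) * (inverse (real (Suc n)))\<^sup>2) \<longlonglongrightarrow> (x \<bullet> x) * 0\<^sup>2"
        by (intro tendsto_intros LIMSEQ_inverse_real_of_nat)
      then show "(\<lambda>n. (x \<bullet> x) / (real (Suc n))\<^sup>2) \<longlonglongrightarrow> 0" by (simp add: divide_inverse power_inverse)
    qed
    then have 1: "(\<lambda>n. 1 - (x \<bullet> x) / (real (Suc n))\<^sup>2) \<longlonglongrightarrow> 1" by simp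
    have "isCont (flat 0) 1" using flat_derivative by (rule DERIV_isCont)
    from isCont_tendsto_compose[OF this 1]
    have "(\<lambda>n. exp 1 * bump (Suc n) x) \<longlonglongrightarrow> exp 1 * flat 0 1"
      unfolding bump_def by (intro tendsto_intros)
    then show ?thesis by (simp add: c_def flat_def exp_minus)
  qed
  have gradc_limit: "(\<lambda>n. grad (c n) x) \<longlonglongrightarrow> 0" for x
  proof (rule tendsto_norm_zero_cancel, rule tendsto_sandwich[of "\<lambda>_. 0"])
    have "(\<lambda>n. C * inverse (real (Suc n))) \<longlonglongrightarrow> C * 0"
      by (intro tendsto_intros LIMSEQ_inverse_real_of_nat)
    then show "(\<lambda>n. C / real (Suc n)) \<longlonglongrightarrow> 0" by (simp add: divide_inverse)
  qed (use gradc_le in auto)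
  \<comment> \<open>A majorant of all \<open>G n\<close>: the cutoffs are at most 1 and their
    gradients at most \<open>C / Suc n \<le> C\<close>.\<close>
  define H where "H x = norm (g x) + C * norm (u x)" for x
  have [measurable]: "H \<in> borel_measurable borel" unfolding H_def by measurable
  have H0: "0 \<le> H x" for x using C0 by (simp add: H_def)
  have finH: "modular p H < \<infinity>"
  proof -
    have "modular p H \<le> ennreal (2 powr p) * (modular p (\<lambda>x. norm (g x)) + modular p (\<lambda>x. C *\<^sub>R norm (u x)))"
      unfolding H_def real_scaleR_def by (intro modular_add borel_lebesgue) (use p in auto)
    also have "modular p (\<lambda>x. norm (g x)) = modular p g" by (simp add: modular_def)
    also have "modular p (\<lambda>x. C *\<^sub>R norm (u x)) = ennreal (\<bar>C\<bar> powr p) * modular p u"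
      by (subst modular_scaleR) (auto intro!: borel_lebesgue simp: modular_def)
    also have "ennreal (2 powr p) * (modular p g + ennreal (\<bar>C\<bar> powr p) * modular p u) < \<infinity>"
      using fin by (simp add: ennreal_mult_less_top)
    finally show ?thesis .
  qed
  have GH: "norm (G n x) \<le> H x" for n x
  proof -
    have "norm (G n x) \<le> c n x * norm (g x) + \<bar>u x\<bar> * norm (grad (c n) x)"
      unfolding G_def using c01[of n x] by (intro norm_triangle_le) simp
    also have "\<dots> \<le> 1 * norm (g x) + \<bar>u x\<bar> * C"
    proof (intro add_mono mult_mono c01)
      show "norm (grad (c n) x) \<le> C"
        by (rule order_trans[OF gradc_le]) (use C0 in \<open>simp add: divide_le_eq mult_le_cancel_left1\<close>)
    qed (use C0 in auto)
    finally show ?thesis by (simp add: H_def mult.commute)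
  qed
  define e' where "e' = e / (2 * 2 powr p)"
  have e': "0 < e'" using e by (simp add: e'_def)
  have "(\<lambda>n. modular p (\<lambda>x. c n x * u x - u x)) \<longlonglongrightarrow> 0"
  proof (rule modular_tendsto_0_dominated[where h=u])
    show "AE x in lebesgue. (\<lambda>n. c n x * u x - u x) \<longlonglongrightarrow> 0"
    proof (rule AE_I2)
      fix x
      have "(\<lambda>n. c n x * u x - u x) \<longlonglongrightarrow> 1 * u x - u x" by (intro tendsto_intros climit)
      then show "(\<lambda>n. c n x * u x - u x) \<longlonglongrightarrow> 0" by simp
    qed
    show "AE x in lebesgue. norm (c n x * u x - u x) \<le> norm (u x)" for n
    proof (rule AE_I2)
      fix x
      have "norm (c n x * u x - u x) = (1 - c n x) * \<bar>u x\<bar>"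
        using c01[of n x] abs_mult[of "c n x - 1" "u x"] by (simp add: left_diff_distrib)
      also have "\<dots> \<le> 1 * \<bar>u x\<bar>" using c01[of n x] by (intro mult_right_mono) auto
      finally show "norm (c n x * u x - u x) \<le> norm (u x)" by simp
    qed
  qed (use fin p in \<open>auto intro!: borel_lebesgue\<close>)
  note ev1 = eventually_less_ennreal[OF this e']
  have "(\<lambda>n. modular p (\<lambda>x. G n x - g x)) \<longlonglongrightarrow> 0"
  proof (rule modular_tendsto_0_dominated[where h="\<lambda>x. H x + H x"])
    show "AE x in lebesgue. (\<lambda>n. G n x - g x) \<longlonglongrightarrow> 0"
    proof (rule AE_I2)
      fix x
      have "(\<lambda>n. G n x - g x) \<longlonglongrightarrow> (1 *\<^sub>R g x + u x *\<^sub>R 0) - g x"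
        unfolding G_def by (intro tendsto_intros climit gradc_limit)
      then show "(\<lambda>n. G n x - g x) \<longlonglongrightarrow> 0" by simp
    qed
    show "AE x in lebesgue. norm (G n x - g x) \<le> norm (H x + H x)" for n
    proof (rule AE_I2)
      fix x
      have "norm (g x) \<le> H x" using C0 by (simp add: H_def)
      then show "norm (G n x - g x) \<le> norm (H x + H x)"
        using GH[of n x] norm_triangle_ineq4[of "G n x" "g x"] by simp
    qed
    have "modular p (\<lambda>x. H x + H x) \<le> ennreal (2 powr p) * (modular p H + modular p H)"
      by (intro modular_add borel_lebesgue) (use p in auto)
    also have "\<dots> < \<infinity>" using finH by (simp add: ennreal_mult_less_top)
    finally show "modular p (\<lambda>x. H x + H x) < \<infinity>" .
  qed (use p in \<open>auto intro!: borel_lebesgue\<close>)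
  note ev2 = eventually_less_ennreal[OF this e']
  obtain n where n: "modular p (\<lambda>x. c n x * u x - u x) < ennreal e'" "modular p (\<lambda>x. G n x - g x) < ennreal e'"
    using eventually_conj[OF ev1 ev2] by (auto simp: eventually_sequentially)
  let ?h = "\<lambda>x. c n x * u x"
  note gcw = grad_conv_weak[OF w um gm cC[of n]]
  have ih: "integrable lborel ?h" and iG: "integrable lborel (G n)"
    using gcw(1,2)[OF cC[of n]] by (auto simp: G_def[abs_def])
  have hm: "?h \<in> borel_measurable borel" and Gm: "G n \<in> borel_measurable borel" by measurable
  have finh: "modular p ?h < \<infinity>"
  proof -
    have "modular p ?h \<le> modular p u"
      using p c01 by (intro modular_mono AE_I2) (auto simp: abs_mult mult_left_le_one_le)
    then show ?thesis using fin by simp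
  qed
  have finG: "modular p (G n) < \<infinity>"
  proof -
    have "modular p (G n) \<le> modular p H"
      using p GH H0 by (intro modular_mono AE_I2) auto
    then show ?thesis using finH by simp
  qed
  obtain d1 where d1: "0 < d1" "\<And>r. mollifier d1 r \<Longrightarrow> modular p (\<lambda>x. (LINT y|lborel. r (x - y) *\<^sub>R ?h y) - ?h x) < ennreal e'"
    using mollify_close[OF hm ih finh p e'] by blast
  obtain d2 where d2: "0 < d2" "\<And>r. mollifier d2 r \<Longrightarrow> modular p (\<lambda>x. (LINT y|lborel. r (x - y) *\<^sub>R G n y) - G n x) < ennreal e'"
    using mollify_close[OF Gm iG finG p e'] by blast
  \<comment> \<open>\<open>U\<close> and \<open>grad U\<close> are mollifications of
    \<open>?h\<close> and \<open>G n\<close> with the same \<open>r\<close>, so its radius must meet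
    both accuracy requirements.\<close>
  have "0 < min d1 d2" using d1 d2 by simp
  from mollifier_exists[OF this] obtain r :: "'a \<Rightarrow> real" where m: "mollifier (min d1 d2) r" .
  then have r: "r \<in> Cc_infinity" and r1: "mollifier d1 r" and r2: "mollifier d2 r"
    by (auto simp: mollifier_def)
  define U where "U x = (LINT y|lborel. r (x - y) * ?h y)" for x
  have gU: "grad U x = (LINT y|lborel. r (x - y) *\<^sub>R G n y)" for x
    unfolding U_def using gcw(3)[OF r] by (simp add: G_def)
  have UC: "U \<in> Cc_infinity"
    unfolding U_def by (rule Cc_infinity_conv[OF r ih, of "Suc n"]) (simp add: c_def bump_eq_0)
  have UmB [measurable]: "U \<in> borel_measurable borel" and "grad U \<in> borel_measurable borel"
    using UC by (auto intro: Cc_infinity_borel grad_borel)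
  have "modular p (\<lambda>x. U x - ?h x) < ennreal e'"
    using d1(2)[OF r1] by (simp add: U_def)
  then have 1: "modular p (\<lambda>x. U x - u x) < ennreal e"
    using n(1) p by (intro modular_triangle_less[of U ?h u p e]) (auto simp: e'_def intro: borel_lebesgue)
  have "modular p (\<lambda>x. grad U x - G n x) < ennreal e'"
    using d2(2)[OF r2] by (simp add: gU)
  then have "modular p (\<lambda>x. grad U x - g x) < ennreal e"
    using n(2) p grad_borel[OF UC] by (intro modular_triangle_less[of "grad U" "G n" g p e]) (auto simp: e'_def intro: borel_lebesgue)
  with 1 UC show ?thesis by blast
qed

section \<open>Radial integrals and the normalising constant\<close>

text \<open>Polar coordinates without a surface measure: both measures agree on the generating
  half-lines, because the volume \<open>omega_n a^n\<close> of a ball is the integral of its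
  derivative in the radius.\<close>

lemma distr_norm_lborel:
  "distr lborel borel (norm :: 'a::euclidean_space \<Rightarrow> real) =
    density lborel (\<lambda>r. ennreal (DIM('a) * unit_ball_vol DIM('a) * r ^ (DIM('a) - 1)) * indicator {0..} r)"
    (is "?M = density lborel ?d")
proof (rule measure_eqI_generator_eq[where E="range (\<lambda>a. {..a::real})" and \<Omega>=UNIV and A="\<lambda>n. {..real n}"])
  let ?n = "DIM('a)" and ?w = "unit_ball_vol DIM('a)"
  have M: "emeasure ?M {..a} = (if 0 \<le> a then ennreal (?w * a ^ ?n) else 0)" for a
  proof -
    have "norm -` {..a} \<inter> space lborel = cball (0::'a) a" by auto
    then have "emeasure ?M {..a} = emeasure lborel (cball (0::'a) a)"
      by (simp add: emeasure_distr)
    then show ?thesis by (auto simp: emeasure_cball)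
  qed
  show "emeasure ?M X = emeasure (density lborel ?d) X" if "X \<in> range (\<lambda>a. {..a::real})" for X
  proof -
    from that obtain a where X: "X = {..a}" by auto
    have N: "emeasure (density lborel ?d) {..a} =
        (\<integral>\<^sup>+r. ennreal (?n * ?w * r ^ (?n - 1)) * indicator {0..a} r \<partial>lborel)"
      by (subst emeasure_density) (auto intro!: nn_integral_cong simp: indicator_def)
    show ?thesis
    proof (cases "0 \<le> a")
      case True
      have "(\<integral>\<^sup>+r. ennreal (?n * ?w * r ^ (?n - 1)) * indicator {0..a} r \<partial>lborel) =
          ennreal (?w * a ^ ?n - ?w * 0 ^ ?n)"
        using True by (intro nn_integral_FTC_Icc) (auto intro!: derivative_eq_intros)
      then show ?thesis using True N M[of a] by (simp add: X)
    next
      case False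
      then have "{0..a} = {}" by auto
      then show ?thesis using False N M[of a] by (simp add: X)
    qed
  qed
  show "emeasure ?M {..real i} \<noteq> \<infinity>" for i using M[of "real i"] by simp
  show "Int_stable (range (\<lambda>a. {..a::real}))"
  proof (rule Int_stableI)
    fix A B assume "A \<in> range (\<lambda>a. {..a::real})" "B \<in> range (\<lambda>a. {..a::real})"
    then obtain a b where "A = {..a}" "B = {..b}" by auto
    then have "A \<inter> B = {..min a b}" by auto
    then show "A \<inter> B \<in> range (\<lambda>a. {..a::real})" by blast
  qed
  show "sets ?M = sigma_sets UNIV (range (\<lambda>a. {..a}))"
    "sets (density lborel ?d) = sigma_sets UNIV (range (\<lambda>a. {..a}))"
    by (simp_all add: borel_eq_atMost)
  show "(\<Union>i. {..real i}) = UNIV"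
    using real_arch_simple by auto
qed auto

lemma nn_integral_radial:
  fixes f :: "real \<Rightarrow> ennreal"
  assumes [measurable]: "f \<in> borel_measurable borel"
  shows "(\<integral>\<^sup>+z. f (norm (z::'a::euclidean_space)) \<partial>lborel) =
    (\<integral>\<^sup>+r. ennreal (DIM('a) * unit_ball_vol DIM('a) * r ^ (DIM('a) - 1)) * indicator {0..} r * f r \<partial>lborel)"
proof -
  have "(\<integral>\<^sup>+z. f (norm (z::'a)) \<partial>lborel) = (\<integral>\<^sup>+r. f r \<partial>distr lborel borel (norm :: 'a \<Rightarrow> real))"
    by (simp add: nn_integral_distr)
  also have "\<dots> = (\<integral>\<^sup>+r. ennreal (DIM('a) * unit_ball_vol DIM('a) * r ^ (DIM('a) - 1)) * indicator {0..} r * f r \<partial>lborel)"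
    unfolding distr_norm_lborel by (rule nn_integral_density) auto
  finally show ?thesis .
qed

lemma radial_power_identity:
  assumes "0 < (r::real)" "1 \<le> n"
  shows "r ^ (n - 1) * r powr a = r powr (real n - 1 + a)"
  using assms by (simp add: powr_add powr_realpow[symmetric] of_nat_diff)

text \<open>The Jacobian \<open>r^(n-1)\<close> reduces the weight to \<open>r powr (- s)\<close>,
  integrable at 0 because \<open>s < 1\<close>. The value grows like \<open>1/(1-s)\<close>, the
  growth that the normalising constant has to compensate.\<close>

lemma nn_integral_near:
  fixes s d :: real
  assumes s: "s < 1" and d: "0 < d"
  shows "(\<integral>\<^sup>+z. ennreal (norm (z::'a::euclidean_space) powr (1 - real DIM('a) - s) * indicator {..<d} (norm z)) \<partial>lborel) =
    ennreal (DIM('a) * unit_ball_vol DIM('a) * (d powr (1 - s) / (1 - s)))"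
proof -
  let ?n = "DIM('a)" and ?w = "unit_ball_vol DIM('a)"
  have "((\<lambda>r. r powr (- s)) has_integral (d powr (- s + 1) / (- s + 1))) {0..d}"
    by (rule has_integral_powr_from_0) (use s d in auto)
  then have I: "(\<integral>\<^sup>+r. ennreal (indicator {0..d} r * r powr (- s)) \<partial>lborel) = ennreal (d powr (1 - s) / (1 - s))"
    by (subst nn_integral_has_integral_lebesgue) (auto simp: add.commute)
  have "(\<integral>\<^sup>+z. ennreal (norm (z::'a) powr (1 - real ?n - s) * indicator {..<d} (norm z)) \<partial>lborel) =
      (\<integral>\<^sup>+r. ennreal (?n * ?w * r ^ (?n - 1)) * indicator {0..} r * ennreal (r powr (1 - real ?n - s) * indicator {..<d} r) \<partial>lborel)"
    by (rule nn_integral_radial) simp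
  also have "\<dots> = (\<integral>\<^sup>+r. ennreal (?n * ?w) * ennreal (indicator {0..d} r * r powr (- s)) \<partial>lborel)"
  proof (rule nn_integral_cong_AE)
    \<comment> \<open>The weight lives on \<open>r < d\<close> but the power integral is taken over
      \<open>{0..d}\<close>; they differ at one point.\<close>
    have "AE r in lborel. r \<noteq> d" by (rule AE_lborel_singleton)
    then show "AE r in lborel. ennreal (?n * ?w * r ^ (?n - 1)) * indicator {0..} r * ennreal (r powr (1 - real ?n - s) * indicator {..<d} r) =
        ennreal (?n * ?w) * ennreal (indicator {0..d} r * r powr (- s))"
    proof eventually_elim
      case (elim r)
      show ?case
      proof (cases "0 < r \<and> r < d")
        case True
        then have "r ^ (?n - 1) * r powr (1 - real ?n - s) = r powr (- s)"
          using radial_power_identity[of r ?n "1 - real ?n - s"] DIM_positive[where 'a='a] by simp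
        then have "?n * ?w * r ^ (?n - 1) * r powr (1 - real ?n - s) = ?n * ?w * r powr (- s)"
          by (simp add: mult.assoc)
        then show ?thesis using True by (simp add: ennreal_mult[symmetric])
      qed (use elim in \<open>auto simp: indicator_def\<close>)
    qed
  qed
  also have "\<dots> = ennreal (?n * ?w) * ennreal (d powr (1 - s) / (1 - s))"
    by (subst nn_integral_cmult) (auto simp: I)
  also have "\<dots> = ennreal (?n * ?w * (d powr (1 - s) / (1 - s)))"
    by (rule ennreal_mult[symmetric]) (use s in auto)
  finally show ?thesis .
qed

text \<open>Here the Jacobian leaves \<open>r powr (- 1 - s)\<close>, integrable at infinity because
  \<open>0 < s\<close>; the value stays bounded as \<open>s\<close> tends to 1.\<close>

lemma nn_integral_far:
  fixes s d :: real
  assumes s: "0 < s" and d: "0 < d"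
  shows "(\<integral>\<^sup>+z. ennreal (norm (z::'a::euclidean_space) powr (- real DIM('a) - s) * indicator {d..} (norm z)) \<partial>lborel) =
    ennreal (DIM('a) * unit_ball_vol DIM('a) * (d powr (- s) / s))"
proof -
  let ?n = "DIM('a)" and ?w = "unit_ball_vol DIM('a)"
  have "((\<lambda>r. r powr (- 1 - s)) has_integral - (d powr (- 1 - s + 1)) / (- 1 - s + 1)) {d..}"
    by (rule has_integral_powr_to_inf) (use s d in auto)
  then have I: "(\<integral>\<^sup>+r. ennreal (indicator {d..} r * r powr (- 1 - s)) \<partial>lborel) = ennreal (d powr (- s) / s)"
    by (subst nn_integral_has_integral_lebesgue) auto
  have "(\<integral>\<^sup>+z. ennreal (norm (z::'a) powr (- real ?n - s) * indicator {d..} (norm z)) \<partial>lborel) =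
      (\<integral>\<^sup>+r. ennreal (?n * ?w * r ^ (?n - 1)) * indicator {0..} r * ennreal (r powr (- real ?n - s) * indicator {d..} r) \<partial>lborel)"
    by (rule nn_integral_radial) simp
  also have "\<dots> = (\<integral>\<^sup>+r. ennreal (?n * ?w) * ennreal (indicator {d..} r * r powr (- 1 - s)) \<partial>lborel)"
  proof (rule nn_integral_cong)
    fix r
    show "ennreal (?n * ?w * r ^ (?n - 1)) * indicator {0..} r * ennreal (r powr (- real ?n - s) * indicator {d..} r) =
        ennreal (?n * ?w) * ennreal (indicator {d..} r * r powr (- 1 - s))"
    proof (cases "d \<le> r")
      case True
      then have "r ^ (?n - 1) * r powr (- real ?n - s) = r powr (- 1 - s)"
        using radial_power_identity[of r ?n "- real ?n - s"] DIM_positive[where 'a='a] d by simp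
      then have "?n * ?w * r ^ (?n - 1) * r powr (- real ?n - s) = ?n * ?w * r powr (- 1 - s)"
        by (simp add: mult.assoc)
      then show ?thesis using True d by (simp add: ennreal_mult[symmetric])
    qed auto
  qed
  also have "\<dots> = ennreal (?n * ?w) * ennreal (d powr (- s) / s)"
    by (subst nn_integral_cmult) (auto simp: I)
  also have "\<dots> = ennreal (?n * ?w * (d powr (- s) / s))"
    by (rule ennreal_mult[symmetric]) (use s in auto)
  finally show ?thesis .
qed

lemma frac_const_pos: "1 \<le> n \<Longrightarrow> 0 < s \<Longrightarrow> s < 1 \<Longrightarrow> 0 < frac_const n s"
  unfolding frac_const_def by (intro mult_pos_pos divide_pos_pos Gamma_real_pos) auto

text \<open>The constant vanishes at \<open>s = 1\<close> because Gamma has a pole at 0. The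
  functional equation \<open>Gamma (z + 1) = z * Gamma z\<close> at \<open>z = (1 - s) / 2\<close>
  lets the factor \<open>1 - s\<close> absorb the pole, leaving
  \<open>2 * Gamma ((1 - s) / 2 + 1)\<close>, which tends to 2; at \<open>z = n / 2\<close> it turns
  the limit into the reciprocal volume of the unit ball.\<close>

lemma frac_const_limit:
  assumes n: "1 \<le> n"
  shows "((\<lambda>s. frac_const n s / (1 - s)) \<longlongrightarrow> 1 / unit_ball_vol n) (at_left 1)"
proof -
  let ?f = "\<lambda>s. (real n + s - 1) * (Gamma ((real n + s - 1) / 2) /
      (pi powr (real n / 2) * 2 powr (1 - s) * (2 * Gamma ((1 - s) / 2 + 1))))"
  have "(?f \<longlongrightarrow> (real n + 1 - 1) * (Gamma ((real n + 1 - 1) / 2) /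
      (pi powr (real n / 2) * 2 powr (1 - 1) * (2 * Gamma ((1 - 1) / 2 + 1))))) (at_left 1)"
  proof (intro tendsto_intros)
    show "(real n + 1 - 1) / 2 \<notin> \<int>\<^sub>\<le>\<^sub>0" using n by (auto simp: nonpos_Ints_def)
    show "(1 - 1) / 2 + 1 \<notin> (\<int>\<^sub>\<le>\<^sub>0 :: real set)" by simp
  qed auto
  also have "(real n + 1 - 1) * (Gamma ((real n + 1 - 1) / 2) /
      (pi powr (real n / 2) * 2 powr (1 - 1) * (2 * Gamma ((1 - 1) / 2 + 1)))) = 1 / unit_ball_vol n"
  proof -
    have "Gamma (real n / 2 + 1) = real n / 2 * Gamma (real n / 2)"
      by (rule Gamma_plus1) (use n in \<open>auto simp: nonpos_Ints_def\<close>)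
    then have "real n * Gamma (real n / 2) = 2 * Gamma (real n / 2 + 1)" by simp
    then show ?thesis by (simp add: unit_ball_vol_def)
  qed
  finally have lim: "(?f \<longlongrightarrow> 1 / unit_ball_vol n) (at_left 1)" .
  have "\<forall>\<^sub>F s in at_left 1. ?f s = frac_const n s / (1 - s)"
  proof -
    have "?f s = frac_const n s / (1 - s)" if "s < 1" for s
    proof -
      have "Gamma ((1 - s) / 2 + 1) = (1 - s) / 2 * Gamma ((1 - s) / 2)"
        by (rule Gamma_plus1) (use that in \<open>auto simp: nonpos_Ints_def\<close>)
      then have e: "2 * Gamma ((1 - s) / 2 + 1) = (1 - s) * Gamma ((1 - s) / 2)" by simp
      show ?thesis unfolding e frac_const_def by (simp add: mult_ac)
    qed
    then show ?thesis by (auto simp: eventually_at_filter)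
  qed
  with lim show ?thesis by (rule Lim_transform_eventually)
qed

section \<open>Coordinate symmetries and second moments of radial weights\<close>

lemma lborel_distr_negate_coordinate:
  fixes b :: "'a::euclidean_space"
  assumes b: "b \<in> Basis"
  shows "distr lborel borel (\<lambda>z. z - (2 * (z \<bullet> b)) *\<^sub>R b) = lborel"
proof -
  let ?c = "\<lambda>j. if j = b then - 1 else (1::real)"
  have "(\<Sum>j\<in>Basis. (?c j * (z \<bullet> j)) *\<^sub>R j) = z - (2 * (z \<bullet> b)) *\<^sub>R b" for z :: 'a
    by (rule euclidean_eqI) (use b in \<open>auto simp: inner_diff_left inner_Basis\<close>)
  then have T: "(\<lambda>z::'a. 0 + (\<Sum>j\<in>Basis. (?c j * (z \<bullet> j)) *\<^sub>R j)) = (\<lambda>z. z - (2 * (z \<bullet> b)) *\<^sub>R b)" by simp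
  have "(\<Prod>j\<in>(Basis::'a set). \<bar>?c j\<bar>) = 1" by (intro prod.neutral) auto
  then show ?thesis
    using lborel_affine_euclidean[of ?c "0::'a"] unfolding T by (simp only: density_1 ennreal_1) (auto simp: density_1)
qed

text \<open>The map exchanges the coordinates \<open>b\<close> and \<open>c\<close> and fixes the
  others. Preimages of boxes are boxes with two sides exchanged, and the product of side lengths is
  invariant under that permutation.\<close>

lemma lborel_distr_swap_coordinates:
  fixes b c :: "'a::euclidean_space"
  assumes b: "b \<in> Basis" and c: "c \<in> Basis" and bc: "b \<noteq> c"
  shows "distr lborel borel (\<lambda>z. z + (z \<bullet> c - z \<bullet> b) *\<^sub>R (b - c)) = lborel"
proof (rule lborel_eqI[symmetric])
  let ?T = "\<lambda>z. z + (z \<bullet> c - z \<bullet> b) *\<^sub>R (b - c)" and ?t = "Transposition.transpose b c"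
  have T: "?T z \<bullet> j = z \<bullet> ?t j" if "j \<in> Basis" for j z
    using that b c bc by (auto simp: inner_add_left inner_diff_left inner_Basis transpose_def)
  have t: "?t permutes Basis" using b c by (rule permutes_swap_id)
  fix l u :: 'a assume le: "\<And>b. b \<in> Basis \<Longrightarrow> l \<bullet> b \<le> u \<bullet> b"
  have tB: "?t j \<in> Basis" if "j \<in> Basis" for j using permutes_in_image[OF t] that by simp
  have box: "?T -` box l u \<inter> space lborel = box (?T l) (?T u)"
  proof -
    have "x \<in> box (?T l) (?T u)" if "?T x \<in> box l u" for x
    proof -
      have "l \<bullet> ?t j < ?T x \<bullet> ?t j \<and> ?T x \<bullet> ?t j < u \<bullet> ?t j" if "j \<in> Basis" for j
        using \<open>?T x \<in> box l u\<close> tB[OF that] by (auto simp: mem_box)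
      then show ?thesis using T tB by (simp add: mem_box)
    qed
    moreover have "?T x \<in> box l u" if "x \<in> box (?T l) (?T u)" for x
    proof -
      have "?T l \<bullet> ?t j < x \<bullet> ?t j \<and> x \<bullet> ?t j < ?T u \<bullet> ?t j" if "j \<in> Basis" for j
        using \<open>x \<in> box (?T l) (?T u)\<close> tB[OF that] by (auto simp: mem_box)
      then show ?thesis using T tB by (simp add: mem_box)
    qed
    ultimately show ?thesis by auto
  qed
  have "emeasure (distr lborel borel ?T) (box l u) = emeasure lborel (box (?T l) (?T u))"
    by (subst emeasure_distr) (simp_all only: box, simp_all)
  also have "\<dots> = (\<Prod>j\<in>Basis. (?T u - ?T l) \<bullet> j)"
    by (rule emeasure_lborel_box) (use le T tB in auto)
  also have "(\<Prod>j\<in>Basis. (?T u - ?T l) \<bullet> j) = (\<Prod>j\<in>Basis. (u - l) \<bullet> ?t j)"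
    by (rule prod.cong) (use T in \<open>auto simp: inner_diff_left\<close>)
  also have "\<dots> = (\<Prod>j\<in>Basis. (u - l) \<bullet> j)"
    using prod.permute[OF t, of "\<lambda>j. (u - l) \<bullet> j"] by (simp add: o_def)
  finally show "emeasure (distr lborel borel ?T) (box l u) = (\<Prod>j\<in>Basis. (u - l) \<bullet> j)" by simp
qed simp

text \<open>Flipping one coordinate kills the mixed second moments \<open>J b c\<close>, swapping
  two coordinates equates the diagonal ones, and these add up to the integral of
  \<open>k (norm z) * (norm z)^2\<close>. Each diagonal moment is therefore \<open>1/n\<close> of
  that integral.\<close>

lemma integral_radial_tensor:
  fixes k :: "real \<Rightarrow> real" and g :: "'a::euclidean_space"
  assumes [measurable]: "k \<in> borel_measurable borel"
    and int: "integrable lborel (\<lambda>z::'a. k (norm z) * (norm z)\<^sup>2)"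
  shows "integrable lborel (\<lambda>z::'a. (k (norm z) * (g \<bullet> z)) *\<^sub>R z)"
    and "(LINT z|lborel. (k (norm z) * (g \<bullet> z)) *\<^sub>R z) =
      ((LINT z|lborel. k (norm (z::'a)) * (norm z)\<^sup>2) / DIM('a)) *\<^sub>R g"
proof -
  show ig: "integrable lborel (\<lambda>z::'a. (k (norm z) * (g \<bullet> z)) *\<^sub>R z)" for g
  proof (rule Bochner_Integration.integrable_bound)
    show "integrable lborel (\<lambda>z::'a. norm g * (k (norm z) * (norm z)\<^sup>2))"
      by (intro integrable_mult_right int)
    show "AE z in lborel. norm ((k (norm z) * (g \<bullet> z)) *\<^sub>R z) \<le> norm (norm g * (k (norm z) * (norm z)\<^sup>2))"
    proof (rule AE_I2)
      fix z :: 'a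
      have "\<bar>k (norm z)\<bar> * \<bar>g \<bullet> z\<bar> * norm z \<le> \<bar>k (norm z)\<bar> * (norm g * norm z) * norm z"
        by (intro mult_right_mono mult_left_mono Cauchy_Schwarz_ineq2) auto
      then show "norm ((k (norm z) * (g \<bullet> z)) *\<^sub>R z) \<le> norm (norm g * (k (norm z) * (norm z)\<^sup>2))"
        by (simp add: abs_mult power2_eq_square mult_ac)
    qed
  qed measurable
  define J where "J b c = (LINT z|lborel. k (norm (z::'a)) * (z \<bullet> b) * (z \<bullet> c))" for b c
  have iJ: "integrable lborel (\<lambda>z::'a. k (norm z) * (z \<bullet> b) * (z \<bullet> c))" for b c
    using integrable_inner_left[of c, OF ig[of b]] by (simp add: inner_commute)
  have J0: "J b c = 0" if b: "b \<in> Basis" and c: "c \<in> Basis" and bc: "b \<noteq> c" for b c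
  proof -
    let ?T = "\<lambda>z::'a. z - (2 * (z \<bullet> b)) *\<^sub>R b"
    have nT: "norm (?T z) = norm z" for z
      using b by (simp add: norm_eq_sqrt_inner inner_diff_left inner_diff_right inner_commute algebra_simps)
    have Tc: "?T z \<bullet> b = - (z \<bullet> b)" "?T z \<bullet> c = z \<bullet> c" for z
      using b c bc by (auto simp: inner_diff_left inner_Basis)
    have "J b c = (LINT z|distr lborel borel ?T. k (norm z) * (z \<bullet> b) * (z \<bullet> c))"
      unfolding J_def lborel_distr_negate_coordinate[OF b] ..
    also have "\<dots> = (LINT z|lborel. k (norm (?T z)) * (?T z \<bullet> b) * (?T z \<bullet> c))"
      by (rule integral_distr) measurable
    also have "\<dots> = - J b c" unfolding nT Tc J_def by simp
    finally show ?thesis by simp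
  qed
  have Jeq: "J b b = J c c" if b: "b \<in> Basis" and c: "c \<in> Basis" and bc: "b \<noteq> c" for b c
  proof -
    let ?T = "\<lambda>z::'a. z + (z \<bullet> c - z \<bullet> b) *\<^sub>R (b - c)"
    have Tc: "?T z \<bullet> b = z \<bullet> c" for z
      using b c bc by (auto simp: inner_add_left inner_diff_left inner_Basis)
    have nT: "norm (?T z) = norm z" for z
    proof -
      have "b \<bullet> c = 0" "b \<bullet> b = 1" "c \<bullet> c = 1" using b c bc by (auto simp: inner_Basis)
      then have "?T z \<bullet> ?T z = z \<bullet> z"
        by (simp add: inner_add_left inner_add_right inner_diff_left inner_diff_right inner_commute[of b z]
          inner_commute[of c z] inner_commute[of c b] algebra_simps)
      then show ?thesis by (simp add: norm_eq_sqrt_inner)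
    qed
    have "J b b = (LINT z|distr lborel borel ?T. k (norm z) * (z \<bullet> b) * (z \<bullet> b))"
      unfolding J_def lborel_distr_swap_coordinates[OF b c bc] ..
    also have "\<dots> = (LINT z|lborel. k (norm (?T z)) * (?T z \<bullet> b) * (?T z \<bullet> b))"
      by (rule integral_distr) measurable
    also have "\<dots> = J c c" unfolding nT Tc J_def ..
    finally show ?thesis .
  qed
  let ?I = "LINT z|lborel. k (norm (z::'a)) * (norm z)\<^sup>2"
  have sumJ: "(\<Sum>b\<in>Basis. J b b) = ?I"
  proof -
    have "(\<Sum>b\<in>Basis. J b b) = (LINT z|lborel. (\<Sum>b\<in>Basis. k (norm (z::'a)) * (z \<bullet> b) * (z \<bullet> b)))"
      unfolding J_def by (rule Bochner_Integration.integral_sum[symmetric]) (rule iJ)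
    also have "(\<lambda>z::'a. \<Sum>b\<in>Basis. k (norm z) * (z \<bullet> b) * (z \<bullet> b)) = (\<lambda>z. k (norm z) * (norm z)\<^sup>2)"
    proof
      fix z :: 'a
      have "(norm z)\<^sup>2 = (\<Sum>b\<in>Basis. (z \<bullet> b) * (z \<bullet> b))"
        unfolding power2_norm_eq_inner by (rule euclidean_inner)
      then show "(\<Sum>b\<in>Basis. k (norm z) * (z \<bullet> b) * (z \<bullet> b)) = k (norm z) * (norm z)\<^sup>2"
        by (simp add: sum_distrib_left mult.assoc)
    qed
    finally show ?thesis .
  qed
  have Jb: "J b b = ?I / DIM('a)" if b: "b \<in> Basis" for b
  proof -
    have "(\<Sum>c\<in>Basis. J c c) = (\<Sum>c\<in>(Basis::'a set). J b b)"
      by (rule sum.cong) (use Jeq b in metis)+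
    then show ?thesis using sumJ by (simp add: field_simps)
  qed
  show "(LINT z|lborel. (k (norm z) * (g \<bullet> z)) *\<^sub>R z) = (?I / DIM('a)) *\<^sub>R g"
  proof (rule euclidean_eqI)
    fix b :: 'a assume b: "b \<in> Basis"
    have "(LINT z|lborel. (k (norm z) * (g \<bullet> z)) *\<^sub>R z) \<bullet> b = (LINT z|lborel. ((k (norm z) * (g \<bullet> z)) *\<^sub>R z) \<bullet> b)"
      by (rule integral_inner_left[symmetric, OF ig])
    also have "\<dots> = (LINT z|lborel. (\<Sum>c\<in>Basis. (g \<bullet> c) * (k (norm z) * (z \<bullet> c) * (z \<bullet> b))))"
    proof (rule Bochner_Integration.integral_cong)
      fix z :: 'a
      have "g \<bullet> z = (\<Sum>c\<in>Basis. (g \<bullet> c) * (z \<bullet> c))" by (rule euclidean_inner)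
      then show "((k (norm z) * (g \<bullet> z)) *\<^sub>R z) \<bullet> b = (\<Sum>c\<in>Basis. (g \<bullet> c) * (k (norm z) * (z \<bullet> c) * (z \<bullet> b)))"
        by (simp add: sum_distrib_left sum_distrib_right mult_ac)
    qed simp
    also have "\<dots> = (\<Sum>c\<in>Basis. (LINT z|lborel. (g \<bullet> c) * (k (norm (z::'a)) * (z \<bullet> c) * (z \<bullet> b))))"
      by (rule Bochner_Integration.integral_sum) (intro integrable_mult_right iJ)
    also have "\<dots> = (\<Sum>c\<in>Basis. (g \<bullet> c) * J c b)"
      by (simp add: J_def)
    also have "\<dots> = (\<Sum>c\<in>Basis. if c = b then (g \<bullet> b) * (?I / DIM('a)) else 0)"
      by (rule sum.cong) (use b J0 Jb in auto)
    also have "\<dots> = (g \<bullet> b) * (?I / DIM('a))" using b by simp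
    finally show "(LINT z|lborel. (k (norm z) * (g \<bullet> z)) *\<^sub>R z) \<bullet> b = ((?I / DIM('a)) *\<^sub>R g) \<bullet> b"
      by (simp add: mult.commute)
  qed
qed

section \<open>Singular integrals of differences\<close>

lemma modular_add_le:
  assumes "f \<in> borel_measurable borel" "g \<in> borel_measurable borel" "0 \<le> p"
    "modular p f \<le> ennreal a" "modular p g \<le> ennreal b" "0 \<le> a" "0 \<le> b"
  shows "modular p (\<lambda>x. f x + g x) \<le> ennreal (2 powr p * (a + b))"
proof -
  have "modular p (\<lambda>x. f x + g x) \<le> ennreal (2 powr p) * (modular p f + modular p g)"
    by (intro modular_add borel_lebesgue assms)
  also have "\<dots> \<le> ennreal (2 powr p) * (ennreal a + ennreal b)"
    by (intro mult_left_mono add_mono assms) simp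
  also have "\<dots> = ennreal (2 powr p * (a + b))"
    using assms by (simp add: ennreal_mult)
  finally show ?thesis .
qed

lemma modular_diff_le:
  assumes "f \<in> borel_measurable borel" "g \<in> borel_measurable borel" "0 \<le> p"
    "modular p f \<le> ennreal a" "modular p g \<le> ennreal b" "0 \<le> a" "0 \<le> b"
  shows "modular p (\<lambda>x. f x - g x) \<le> ennreal (2 powr p * (a + b))"
  using modular_add_le[of f "\<lambda>x. - g x" p a b] assms by simp

lemma modular_inner_le:
  assumes "f \<in> borel_measurable borel" "0 \<le> p" "modular p f \<le> ennreal a"
  shows "modular p (\<lambda>x. f x \<bullet> z) \<le> ennreal (norm z powr p * a)"
proof -
  have "modular p (\<lambda>x. f x \<bullet> z) \<le> modular p (\<lambda>x. norm z *\<^sub>R f x)"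
  proof (intro modular_mono AE_I2 assms)
    fix x show "norm (f x \<bullet> z) \<le> norm (norm z *\<^sub>R f x)"
      using Cauchy_Schwarz_ineq2[of "f x" z] by (simp add: mult.commute)
  qed
  also have "\<dots> = ennreal (\<bar>norm z\<bar> powr p) * modular p f"
    by (intro modular_scaleR borel_lebesgue assms)
  also have "\<dots> \<le> ennreal (\<bar>norm z\<bar> powr p) * ennreal a"
    by (intro mult_left_mono assms) simp
  finally show ?thesis by (simp add: ennreal_mult')
qed

text \<open>By the fundamental theorem of calculus along the segment from \<open>x\<close> to
  \<open>x - z\<close>, the remainder is the average over \<open>t\<close> in [0, 1] of
  \<open>(grad U (x - t z) - grad U x) . z\<close>. The weight has mass 1, so taking p-th powers
  inside costs no constant.\<close>

lemma Cc_infinity_taylor_modular: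
  assumes U: "U \<in> Cc_infinity" and p: "1 \<le> p" and B0: "0 \<le> B"
    and B: "\<And>t. t \<in> {0..1} \<Longrightarrow> modular p (\<lambda>x. grad U (x - t *\<^sub>R z) - grad U x) \<le> ennreal B"
  shows "modular p (\<lambda>x. U x - U (x - z) - grad U x \<bullet> z) \<le> ennreal (norm z powr p * B)"
proof -
  note [measurable] = grad_borel[OF U] Cc_infinity_borel[OF U]
  let ?F = "\<lambda>x t. (grad U (x - t *\<^sub>R z) - grad U x) \<bullet> z"
  have eq: "U x - U (x - z) - grad U x \<bullet> z = (LINT t|lborel. indicator {0..1} t *\<^sub>R ?F x t)" for x
  proof -
    have c: "continuous_on {0..1} (\<lambda>t. grad U (x - t *\<^sub>R z) \<bullet> z)"
      by (intro continuous_intros continuous_on_compose2[OF grad_continuous[OF U]]) auto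
    have d: "((\<lambda>t. - U (x - t *\<^sub>R z)) has_vector_derivative (grad U (x - t *\<^sub>R z) \<bullet> z)) (at t within {0..1})" for t
    proof -
      have "((\<lambda>t. x - t *\<^sub>R z) has_derivative (\<lambda>h. - (h *\<^sub>R z))) (at t within {0..1})"
        by (auto intro!: derivative_eq_intros)
      from has_derivative_minus[OF has_derivative_compose[OF this Cc_infinity_has_derivative[OF U]]]
      show ?thesis by (simp add: has_vector_derivative_def)
    qed
    have "(LINT t|lborel. indicator {0..1} t *\<^sub>R (grad U (x - t *\<^sub>R z) \<bullet> z)) = - U (x - 1 *\<^sub>R z) - - U (x - 0 *\<^sub>R z)"
      by (rule integral_FTC_Icc) (use c d in auto)
    moreover have "integrable lborel (\<lambda>t. indicator {0..1} t *\<^sub>R (grad U (x - t *\<^sub>R z) \<bullet> z))"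
      using borel_integrable_compact[OF compact_Icc c] by (simp add: indicator_def if_distrib[of "\<lambda>r. r *\<^sub>R _"] cong: if_cong)
    moreover have "integrable lborel (\<lambda>t::real. indicator {0..1} t *\<^sub>R (grad U x \<bullet> z))" by simp
    moreover have "(LINT t|lborel. indicator {0..1::real} t *\<^sub>R (grad U x \<bullet> z)) = grad U x \<bullet> z" by simp
    ultimately show ?thesis
      by (simp add: inner_diff_left right_diff_distrib Bochner_Integration.integral_diff)
  qed
  have "modular p (\<lambda>x. LINT t|lborel. indicator {0..1} t *\<^sub>R ?F x t)
      \<le> ennreal (1 powr (p - 1)) * (\<integral>\<^sup>+t. ennreal (indicator {0..1} t) * modular p (\<lambda>x. ?F x t) \<partial>lborel)"
    by (rule modular_integral_le[OF lborel.sigma_finite_measure_axioms]) (use p in \<open>auto simp: ennreal_indicator\<close>)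
  also have "\<dots> \<le> (\<integral>\<^sup>+t. ennreal (norm z powr p * B) * indicator {0..1::real} t \<partial>lborel)"
  proof -
    have "ennreal (indicator {0..1} t) * modular p (\<lambda>x. ?F x t) \<le> ennreal (norm z powr p * B) * indicator {0..1} t" for t :: real
    proof (cases "t \<in> {0..1}")
      case True
      have "modular p (\<lambda>x. ?F x t) \<le> ennreal (norm z powr p * B)"
        by (rule modular_inner_le) (use p B[OF True] in auto)
      then show ?thesis using True by simp
    qed simp
    then show ?thesis by (auto intro!: nn_integral_mono)
  qed
  also have "\<dots> = ennreal (norm z powr p * B)"
    by (subst nn_integral_cmult_indicator) auto
  finally show ?thesis unfolding eq .
qed

text \<open>The form in which Sobolev functions enter the estimates below. Since test functions with
  their gradients satisfy it too, one estimate covers \<open>u\<close>, its approximations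
  \<open>U\<close> and the errors \<open>U - u\<close>.\<close>

definition approximable :: "real \<Rightarrow> ('a::euclidean_space \<Rightarrow> real) \<Rightarrow> ('a \<Rightarrow> 'a) \<Rightarrow> bool" where
  "approximable p u g \<longleftrightarrow> u \<in> borel_measurable borel \<and> g \<in> borel_measurable borel \<and>
    modular p u < \<infinity> \<and> modular p g < \<infinity> \<and>
    (\<forall>e>0. \<exists>U\<in>Cc_infinity. modular p (\<lambda>x. U x - u x) < ennreal e \<and> modular p (\<lambda>x. grad U x - g x) < ennreal e)"

lemma grad_diff:
  assumes "U \<in> Cc_infinity" "V \<in> Cc_infinity"
  shows "grad (\<lambda>x. U x - V x) x = grad U x - grad V x"
  using has_derivative_diff[OF assms[THEN Cc_infinity_has_derivative], of x]
  by (intro grad_eqI) (simp add: inner_diff_left)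

lemma approximable_Cc_infinity:
  assumes U: "U \<in> Cc_infinity" and p: "1 \<le> p"
  shows "approximable p U (grad U)"
proof -
  have z: "modular p (\<lambda>x. U x - U x) < ennreal e \<and> modular p (\<lambda>x. grad U x - grad U x) < ennreal e"
    if "0 < e" for e
    using that by (simp add: modular_def)
  show ?thesis
    unfolding approximable_def
  proof (intro conjI allI impI)
    show "\<exists>V\<in>Cc_infinity. modular p (\<lambda>x. V x - U x) < ennreal e \<and>
        modular p (\<lambda>x. grad V x - grad U x) < ennreal e" if "0 < e" for e
      by (rule bexI[where x=U]) (rule z[OF that], rule U)
  qed (use U p Cc_infinity_modular_finite[of U p] grad_modular_finite[of U p]
      in \<open>auto intro: Cc_infinity_borel grad_borel\<close>)
qed

lemma approximable_diff:
  assumes u: "approximable p u g" and U: "U \<in> Cc_infinity" and p: "1 \<le> p"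
  shows "approximable p (\<lambda>x. U x - u x) (\<lambda>x. grad U x - g x)"
  unfolding approximable_def
proof (intro conjI allI impI)
  note [measurable] = Cc_infinity_borel[OF U] grad_borel[OF U]
  have [measurable]: "u \<in> borel_measurable borel" "g \<in> borel_measurable borel"
    and fin: "modular p u < \<infinity>" "modular p g < \<infinity>" using u by (auto simp: approximable_def)
  show "(\<lambda>x. U x - u x) \<in> borel_measurable borel" "(\<lambda>x. grad U x - g x) \<in> borel_measurable borel" by auto
  have "modular p (\<lambda>x. U x - u x) \<le> ennreal (2 powr p) * (modular p U + modular p u)"
    by (intro modular_diff borel_lebesgue) (use p in auto)
  also have "\<dots> < \<infinity>" using fin Cc_infinity_modular_finite[OF U] p by (simp add: ennreal_mult_less_top)
  finally show "modular p (\<lambda>x. U x - u x) < \<infinity>" .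
  have "modular p (\<lambda>x. grad U x - g x) \<le> ennreal (2 powr p) * (modular p (grad U) + modular p g)"
    by (intro modular_diff borel_lebesgue) (use p in auto)
  also have "\<dots> < \<infinity>" using fin grad_modular_finite[OF U] p by (simp add: ennreal_mult_less_top)
  finally show "modular p (\<lambda>x. grad U x - g x) < \<infinity>" .
  fix e :: real assume "0 < e"
  then obtain V where V: "V \<in> Cc_infinity" "modular p (\<lambda>x. V x - u x) < ennreal e" "modular p (\<lambda>x. grad V x - g x) < ennreal e"
    using u by (auto simp: approximable_def)
  have "modular p (\<lambda>x. (U x - V x) - (U x - u x)) < ennreal e"
    using V(2) modular_minus_commute[of p V u] by simp
  moreover have "modular p (\<lambda>x. grad (\<lambda>x. U x - V x) x - (grad U x - g x)) < ennreal e"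
    using V(3) modular_minus_commute[of p "grad V" g] by (simp add: grad_diff[OF U V(1)])
  ultimately show "\<exists>W\<in>Cc_infinity. modular p (\<lambda>x. W x - (U x - u x)) < ennreal e \<and>
      modular p (\<lambda>x. grad W x - (grad U x - g x)) < ennreal e"
    by (intro bexI[of _ "\<lambda>x. U x - V x"] conjI Cc_infinity_diff U V)
qed

text \<open>A test function \<open>U\<close> within \<open>e\<close> of \<open>(u, g)\<close>
  inherits the translation bound up to errors that vanish with \<open>e\<close>, and the resulting
  bound \<open>f e\<close> is continuous at 0. Three factors \<open>2 powr p\<close> survive: two
  from comparing translates of \<open>grad U\<close> with those of \<open>g\<close>, one from adding
  the error \<open>u - U\<close> back.\<close>

lemma taylor_modular:
  assumes u: "approximable p u g" and p: "1 \<le> p" and B0: "0 \<le> B"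
    and B: "\<And>t. t \<in> {0..1} \<Longrightarrow> modular p (\<lambda>x. g (x - t *\<^sub>R z) - g x) \<le> ennreal B"
  shows "modular p (\<lambda>x. u x - u (x - z) - g x \<bullet> z) \<le> ennreal ((2 powr p) ^ 3 * norm z powr p * B)"
proof -
  have [measurable]: "u \<in> borel_measurable borel" "g \<in> borel_measurable borel"
    using u by (auto simp: approximable_def)
  define q :: real where "q = 2 powr p"
  define Z where "Z = norm z powr p"
  have q: "0 < q" "0 \<le> Z" by (auto simp: q_def Z_def)
  have p0: "0 \<le> p" using p by simp
  note add_le = modular_add_le[OF _ _ p0, folded q_def] and diff_le = modular_diff_le[OF _ _ p0, folded q_def]
  define f where "f e = q * (q * (q * (e + e) + Z * e) + Z * (q * (e + q * (B + e))))" for e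
  have le: "modular p (\<lambda>x. u x - u (x - z) - g x \<bullet> z) \<le> ennreal (f e)" if e: "0 < e" for e
  proof -
    obtain U where U: "U \<in> Cc_infinity"
      and M: "modular p (\<lambda>x. U x - u x) < ennreal e" "modular p (\<lambda>x. grad U x - g x) < ennreal e"
      using u e by (auto simp: approximable_def)
    note [measurable] = Cc_infinity_borel[OF U] grad_borel[OF U]
    have m1: "modular p (\<lambda>x. u x - U x) \<le> ennreal e" and m2: "modular p (\<lambda>x. g x - grad U x) \<le> ennreal e"
      using M by (auto simp: modular_minus_commute[of p u] modular_minus_commute[of p g])
    have m1z: "modular p (\<lambda>x. u (x - z) - U (x - z)) \<le> ennreal e"
      using m1 modular_shift[of "\<lambda>x. u x - U x" p z] by simp
    have a: "modular p (\<lambda>x. (u x - U x) - (u (x - z) - U (x - z)) - (g x - grad U x) \<bullet> z) \<le> ennreal (q * (q * (e + e) + Z * e))"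
      unfolding Z_def
      by (intro diff_le modular_inner_le m1 m1z m2) (use e q p0 in auto)
    have b: "modular p (\<lambda>x. U x - U (x - z) - grad U x \<bullet> z) \<le> ennreal (Z * (q * (e + q * (B + e))))"
      unfolding Z_def
    proof (rule Cc_infinity_taylor_modular[OF U p])
      fix t :: real assume t: "t \<in> {0..1}"
      have s: "modular p (\<lambda>x. grad U (x - t *\<^sub>R z) - g (x - t *\<^sub>R z)) \<le> ennreal e"
        using M(2) modular_shift[of "\<lambda>x. grad U x - g x" p "t *\<^sub>R z"] by simp
      have "modular p (\<lambda>x. (grad U (x - t *\<^sub>R z) - g (x - t *\<^sub>R z)) + ((g (x - t *\<^sub>R z) - g x) + (g x - grad U x)))
          \<le> ennreal (q * (e + q * (B + e)))"
        by (intro add_le s B[OF t] m2) (use e q B0 in auto)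
      then show "modular p (\<lambda>x. grad U (x - t *\<^sub>R z) - grad U x) \<le> ennreal (q * (e + q * (B + e)))" by simp
    qed (use e q B0 in auto)
    have "modular p (\<lambda>x. ((u x - U x) - (u (x - z) - U (x - z)) - (g x - grad U x) \<bullet> z)
        + (U x - U (x - z) - grad U x \<bullet> z)) \<le> ennreal (f e)"
      unfolding f_def by (rule add_le[OF _ _ a b]) (use e q B0 in auto)
    then show ?thesis by (simp add: inner_diff_left algebra_simps)
  qed
  have "(\<lambda>n. ennreal (f (inverse (real (Suc n))))) \<longlonglongrightarrow> ennreal (f 0)"
    unfolding f_def by (intro tendsto_ennrealI tendsto_intros LIMSEQ_inverse_real_of_nat)
  then have "modular p (\<lambda>x. u x - u (x - z) - g x \<bullet> z) \<le> ennreal (f 0)"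
    by (rule LIMSEQ_le_const) (use le in auto)
  also have "f 0 = (2 powr p) ^ 3 * norm z powr p * B"
    by (simp add: f_def q_def Z_def power3_eq_cube)
  finally show ?thesis .
qed

text \<open>The constant of \<open>difference_modular\<close>: the Taylor remainder with the crude
  translation bound \<open>B = 2 * 2 powr p * G\<close>, valid for every \<open>z\<close>,
  contributes \<open>2 * (2 powr p)^4\<close>; the linear term \<open>g x . z\<close> contributes 1;
  the outer factor comes from adding the two.\<close>

definition near_const :: "real \<Rightarrow> real" where
  "near_const p = 2 powr p * (2 * (2 powr p) ^ 4 + 1)"

lemma near_const_nonneg: "0 \<le> near_const p"
  by (simp add: near_const_def)

lemma difference_modular:
  assumes u: "approximable p u g" and p: "1 \<le> p" and G: "modular p g \<le> ennreal G" "0 \<le> G"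
  shows "modular p (\<lambda>x. u x - u (x - z)) \<le> ennreal (near_const p * G * norm z powr p)"
proof -
  have [measurable]: "u \<in> borel_measurable borel" "g \<in> borel_measurable borel"
    using u by (auto simp: approximable_def)
  define q :: real where "q = 2 powr p"
  have q: "0 < q" by (simp add: q_def)
  have p0: "0 \<le> p" using p by simp
  note add_le = modular_add_le[OF _ _ p0, folded q_def] and diff_le = modular_diff_le[OF _ _ p0, folded q_def]
  have "modular p (\<lambda>x. g (x - t *\<^sub>R z) - g x) \<le> ennreal (q * (G + G))" for t
  proof (rule diff_le)
    show "modular p (\<lambda>x. g (x - t *\<^sub>R z)) \<le> ennreal G"
      using G modular_shift[of g p "t *\<^sub>R z"] by simp
  qed (use G in auto)
  then have 1: "modular p (\<lambda>x. u x - u (x - z) - g x \<bullet> z) \<le> ennreal (q ^ 3 * norm z powr p * (q * (G + G)))"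
    unfolding q_def by (intro taylor_modular[OF u p]) (use G in auto)
  have "modular p (\<lambda>x. (u x - u (x - z) - g x \<bullet> z) + g x \<bullet> z) \<le>
      ennreal (q * (q ^ 3 * norm z powr p * (q * (G + G)) + norm z powr p * G))"
    by (rule add_le[OF _ _ 1 modular_inner_le]) (use G q p0 in auto)
  also have "q * (q ^ 3 * norm z powr p * (q * (G + G)) + norm z powr p * G) =
      (q * (2 * q ^ 4 + 1)) * G * norm z powr p"
    by (simp add: algebra_simps power_Suc numeral_eq_Suc)
  finally show ?thesis by (simp add: q_def near_const_def)
qed

lemma difference_modular_far:
  assumes [measurable]: "u \<in> borel_measurable borel" and p: "1 \<le> p" and H: "modular p u \<le> ennreal H" "0 \<le> H"
  shows "modular p (\<lambda>x. u x - u (x - z)) \<le> ennreal (2 * 2 powr p * H)"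
proof -
  have "modular p (\<lambda>x. u x - u (x - z)) \<le> ennreal (2 powr p * (H + H))"
  proof (rule modular_diff_le)
    show "modular p (\<lambda>x. u (x - z)) \<le> ennreal H" using H modular_shift[of u p z] by simp
  qed (use H p in auto)
  then show ?thesis by (simp add: algebra_simps)
qed

text \<open>This is \<open>z / |z|^(n+s+1)\<close>. At \<open>z = 0\<close> the division conventions
  give 0, so oddness and the formula for the norm hold everywhere.\<close>

definition kern :: "real \<Rightarrow> 'a::euclidean_space \<Rightarrow> 'a" where
  "kern s z = (1 / norm z powr (real DIM('a) + s)) *\<^sub>R (z /\<^sub>R norm z)"

text \<open>Closed forms of the two radial integrals of the weights inside and outside radius
  \<open>d\<close>; the \<open>itself\<close> argument carries the dimension.\<close>

definition near_mass :: "'a::euclidean_space itself \<Rightarrow> real \<Rightarrow> real \<Rightarrow> real" where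
  "near_mass _ s d = DIM('a) * unit_ball_vol DIM('a) * (d powr (1 - s) / (1 - s))"

definition far_mass :: "'a::euclidean_space itself \<Rightarrow> real \<Rightarrow> real \<Rightarrow> real" where
  "far_mass _ s d = DIM('a) * unit_ball_vol DIM('a) * (d powr (- s) / s)"

lemma masses_pos:
  "s < 1 \<Longrightarrow> 0 < d \<Longrightarrow> 0 < near_mass TYPE('a::euclidean_space) s d"
  "0 < s \<Longrightarrow> 0 < d \<Longrightarrow> 0 < far_mass TYPE('a::euclidean_space) s d"
  by (auto simp: near_mass_def far_mass_def)

lemma [measurable]: "kern s \<in> borel_measurable borel"
  unfolding kern_def by measurable

lemma kern_minus: "kern s (- z) = - kern s z"
  by (simp add: kern_def)

lemma norm_kern: "norm (kern s z) = norm (z::'a::euclidean_space) powr (- real DIM('a) - s)"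
proof (cases "z = 0")
  case False
  then have "norm (z /\<^sub>R norm z) = 1" by simp
  then have "norm (kern s z) = norm z powr - (real DIM('a) + s)"
    unfolding kern_def norm_scaleR powr_minus_divide by simp
  then show ?thesis by simp
qed (simp add: kern_def)

text \<open>The weight is \<open>|z|^(1-n-s)\<close> for \<open>|z| < d\<close>, where differences of \<open>u\<close> are of order \<open>|z|\<close>, and
  \<open>|z|^(-n-s)\<close> for \<open>|z| \<ge> d\<close>, where they are merely bounded in \<open>L\<^sup>p\<close>.\<close>

lemma singular_integral_modular:
  fixes w :: "'a::euclidean_space \<Rightarrow> 'a \<Rightarrow> real"
  assumes wm: "(\<lambda>(x, z). w x z) \<in> borel_measurable (borel \<Otimes>\<^sub>M borel)"
    and s: "0 < s" "s < 1" and d: "0 < d" and p: "1 \<le> p" and b: "0 \<le> b1" "0 \<le> b2"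
    and near: "\<And>z. norm z < d \<Longrightarrow> modular p (\<lambda>x. w x z) \<le> ennreal (b1 * norm z powr p)"
    and far: "\<And>z. d \<le> norm z \<Longrightarrow> modular p (\<lambda>x. w x z) \<le> ennreal b2"
  defines "Kn \<equiv> near_mass TYPE('a) s d" and "Kf \<equiv> far_mass TYPE('a) s d"
  shows "modular p (\<lambda>x. LINT z|lborel. w x z *\<^sub>R kern s z) \<le> ennreal ((Kn + Kf) powr (p - 1) * (b1 * Kn + b2 * Kf))"
    and "AE x in lborel. integrable lborel (\<lambda>z. w x z *\<^sub>R kern s z)"
    and "p = 1 \<Longrightarrow> (\<integral>\<^sup>+z. ennreal (norm (kern s z)) * modular 1 (\<lambda>x. w x z) \<partial>lborel) < \<infinity>"
proof -
  define n where "n = real DIM('a)"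
  define kn where "kn z = norm z powr (1 - n - s) * indicator {..<d} (norm z)" for z :: 'a
  define kf where "kf z = norm z powr (- n - s) * indicator {d..} (norm z)" for z :: 'a
  define k where "k z = kn z + kf z" for z
  \<comment> \<open>Dividing by \<open>r\<close> moves one power of \<open>norm z\<close> from the
    kernel to the difference for \<open>norm z < d\<close>. The product
    \<open>k z *\<^sub>R F x z\<close> is still the original integrand, but now \<open>k\<close> is
    integrable and \<open>F\<close> is bounded in L^p on each of the two regions.\<close>
  define r where "r z = (if norm z < d then norm z else 1)" for z :: 'a
  define F where "F x z = (w x z / r z) *\<^sub>R (z /\<^sub>R norm z)" for x z
  have [measurable]: "kn \<in> borel_measurable borel" "kf \<in> borel_measurable borel" "k \<in> borel_measurable borel"
      "r \<in> borel_measurable borel"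
    unfolding k_def kn_def kf_def r_def by measurable
  note [measurable] = wm
  have Fm: "(\<lambda>(x, z). F x z) \<in> borel_measurable (borel \<Otimes>\<^sub>M borel)"
    unfolding F_def by measurable
  then have Fm': "(\<lambda>(x, z). F x z) \<in> borel_measurable (borel \<Otimes>\<^sub>M lborel)" by measurable
  have In: "(\<integral>\<^sup>+z. ennreal (kn z) \<partial>lborel) = ennreal Kn"
    unfolding kn_def Kn_def near_mass_def n_def by (rule nn_integral_near[OF s(2) d])
  have If: "(\<integral>\<^sup>+z. ennreal (kf z) \<partial>lborel) = ennreal Kf"
    unfolding kf_def Kf_def far_mass_def n_def by (rule nn_integral_far[OF s(1) d])
  have K: "0 < Kn" "0 < Kf" using masses_pos s d by (auto simp: Kn_def Kf_def)
  have kn0: "0 \<le> kn z" "0 \<le> kf z" "0 \<le> k z" for z by (auto simp: k_def kn_def kf_def)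
  have Ik: "(\<integral>\<^sup>+z. ennreal (k z) \<partial>lborel) = ennreal (Kn + Kf)"
    using K by (simp add: k_def kn0 In If nn_integral_add)
  have nk: "norm (kern s z) * r z = k z" for z
  proof (cases "z = 0")
    case False
    have "norm z powr (1 - n - s) = norm z powr (- n - s + 1)" by (simp add: algebra_simps)
    also have "\<dots> = norm z powr (- n - s) * norm z" using False by (subst powr_add) simp
    finally show ?thesis using False
      by (auto simp: norm_kern n_def[symmetric] r_def k_def kn_def kf_def)
  qed (use d in \<open>auto simp: kern_def k_def kn_def kf_def\<close>)
  have r0: "0 < r z" if "z \<noteq> 0" for z using that by (simp add: r_def)
  have kF: "k z *\<^sub>R F x z = w x z *\<^sub>R kern s z" for x z
  proof (cases "z = 0")
    case False
    have "norm (kern s z) *\<^sub>R (z /\<^sub>R norm z) = kern s z"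
      using False by (simp add: kern_def)
    moreover have "k z *\<^sub>R F x z = w x z *\<^sub>R (norm (kern s z) *\<^sub>R (z /\<^sub>R norm z))"
      using r0[OF False] by (simp add: F_def nk[symmetric])
    ultimately show ?thesis by simp
  qed (simp add: F_def kern_def)
  have nF: "norm (F x z) = norm ((1 / r z) *\<^sub>R w x z)" if "z \<noteq> 0" for x z
  proof -
    have "norm (z /\<^sub>R norm z) = 1" using that by simp
    then show ?thesis unfolding F_def norm_scaleR by (simp add: abs_divide)
  qed
  have MF: "modular p (\<lambda>x. F x z) \<le> (if norm z < d then ennreal b1 else ennreal b2)" if z: "z \<noteq> 0" for z
  proof -
    have [measurable]: "(\<lambda>x. w x z) \<in> borel_measurable borel" by measurable
    have "modular p (\<lambda>x. F x z) = modular p (\<lambda>x. (1 / r z) *\<^sub>R w x z)"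
      unfolding modular_def nF[OF z] ..
    also have "\<dots> = ennreal (\<bar>1 / r z\<bar> powr p) * modular p (\<lambda>x. w x z)"
      by (intro modular_scaleR borel_lebesgue) measurable
    also have "\<dots> \<le> (if norm z < d then ennreal b1 else ennreal b2)"
    proof (cases "norm z < d")
      case True
      have "ennreal (\<bar>1 / r z\<bar> powr p) * modular p (\<lambda>x. w x z) \<le> ennreal (\<bar>1 / norm z\<bar> powr p) * ennreal (b1 * norm z powr p)"
        using near[OF True] True by (intro mult_mono) (auto simp: r_def)
      also have "\<dots> = ennreal (\<bar>1 / norm z\<bar> powr p * (b1 * norm z powr p))"
        using b by (simp add: ennreal_mult)
      also have "\<bar>1 / norm z\<bar> powr p * (b1 * norm z powr p) = b1"
        using z by (simp add: powr_divide)
      finally show ?thesis using True by simp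
    next
      case False
      then show ?thesis using far[of z] by (simp add: r_def)
    qed
    finally show ?thesis .
  qed
  have "(\<integral>\<^sup>+z. ennreal (k z) * modular p (\<lambda>x. F x z) \<partial>lborel) \<le>
      (\<integral>\<^sup>+z. ennreal b1 * ennreal (kn z) + ennreal b2 * ennreal (kf z) \<partial>lborel)"
  proof (rule nn_integral_mono)
    fix z :: 'a
    show "ennreal (k z) * modular p (\<lambda>x. F x z) \<le> ennreal b1 * ennreal (kn z) + ennreal b2 * ennreal (kf z)"
    proof (cases "z = 0")
      case False
      show ?thesis
      proof (cases "norm z < d")
        case True
        then have kz: "k z = kn z" "kf z = 0" by (auto simp: k_def kf_def)
        have "ennreal (k z) * modular p (\<lambda>x. F x z) \<le> ennreal (k z) * ennreal b1"
          using MF[OF False] True by (intro mult_left_mono) auto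
        then show ?thesis by (simp add: kz mult.commute)
      next
        case far: False
        then have kz: "k z = kf z" "kn z = 0" by (auto simp: k_def kn_def)
        have "ennreal (k z) * modular p (\<lambda>x. F x z) \<le> ennreal (k z) * ennreal b2"
          using MF[OF False] far by (intro mult_left_mono) auto
        then show ?thesis by (simp add: kz mult.commute)
      qed
    qed (simp add: k_def kn_def kf_def)
  qed
  also have "\<dots> = ennreal b1 * ennreal Kn + ennreal b2 * ennreal Kf"
    by (simp add: nn_integral_add nn_integral_cmult In If)
  also have "\<dots> = ennreal (b1 * Kn + b2 * Kf)"
    using K b by (simp add: ennreal_mult)
  finally have tot: "(\<integral>\<^sup>+z. ennreal (k z) * modular p (\<lambda>x. F x z) \<partial>lborel) \<le> ennreal (b1 * Kn + b2 * Kf)" .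
  have KK: "(\<integral>\<^sup>+z. ennreal (k z) \<partial>lborel) \<le> ennreal (Kn + Kf)" "0 < Kn + Kf" using Ik K by auto
  have "modular p (\<lambda>x. LINT z|lborel. k z *\<^sub>R F x z)
      \<le> ennreal ((Kn + Kf) powr (p - 1)) * (\<integral>\<^sup>+z. ennreal (k z) * modular p (\<lambda>x. F x z) \<partial>lborel)"
    by (rule modular_integral_le[OF lborel.sigma_finite_measure_axioms Fm' _ kn0(3) KK p]) simp
  also have "\<dots> \<le> ennreal ((Kn + Kf) powr (p - 1)) * ennreal (b1 * Kn + b2 * Kf)"
    by (intro mult_left_mono tot) simp
  also have "\<dots> = ennreal ((Kn + Kf) powr (p - 1) * (b1 * Kn + b2 * Kf))"
    by (rule ennreal_mult[symmetric]) (use b K in auto)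
  finally show "modular p (\<lambda>x. LINT z|lborel. w x z *\<^sub>R kern s z) \<le> ennreal ((Kn + Kf) powr (p - 1) * (b1 * Kn + b2 * Kf))"
    unfolding kF .
  have "AE x in lborel. integrable lborel (\<lambda>z. k z *\<^sub>R F x z)"
    by (rule AE_integrable_section[OF lborel.sigma_finite_measure_axioms Fm' _ kn0(3) KK p])
      (use tot in \<open>auto intro: le_less_trans\<close>)
  then show "AE x in lborel. integrable lborel (\<lambda>z. w x z *\<^sub>R kern s z)" unfolding kF .
  \<comment> \<open>For \<open>p = 1\<close> the modular is homogeneous of degree 1, so the factor
    \<open>1 / r z\<close> goes back into the weight; the outcome is the absolute integrability that
    Fubini's theorem will need.\<close>
  show "(\<integral>\<^sup>+z. ennreal (norm (kern s z)) * modular 1 (\<lambda>x. w x z) \<partial>lborel) < \<infinity>" if "p = 1"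
  proof -
    have "ennreal (norm (kern s z)) * modular 1 (\<lambda>x. w x z) = ennreal (k z) * modular p (\<lambda>x. F x z)" for z
    proof (cases "z = 0")
      case False
      have [measurable]: "(\<lambda>x. w x z) \<in> borel_measurable borel" by measurable
      have "modular p (\<lambda>x. F x z) = modular 1 (\<lambda>x. (1 / r z) *\<^sub>R w x z)"
        unfolding modular_def nF[OF False] that ..
      also have "\<dots> = ennreal (\<bar>1 / r z\<bar> powr 1) * modular 1 (\<lambda>x. w x z)"
        by (intro modular_scaleR borel_lebesgue) measurable
      finally have "ennreal (k z) * modular p (\<lambda>x. F x z) = ennreal (k z * (1 / r z)) * modular 1 (\<lambda>x. w x z)"
        using r0[OF False] kn0(3)[of z] by (subst ennreal_mult) (simp_all add: mult.assoc)
      moreover have "k z * (1 / r z) = norm (kern s z)"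
        using r0[OF False] nk[of z] by (simp add: field_simps)
      ultimately show ?thesis by simp
    qed (simp add: kern_def k_def kn_def kf_def)
    then have "(\<integral>\<^sup>+z. ennreal (norm (kern s z)) * modular 1 (\<lambda>x. w x z) \<partial>lborel) \<le> ennreal (b1 * Kn + b2 * Kf)"
      using tot by simp
    then show ?thesis by (rule le_less_trans) simp
  qed
qed

text \<open>The singular integral in the variable \<open>z = x - y\<close>, for arbitrary
  \<open>u\<close>. Where it diverges the Bochner integral is 0 by default; for
  \<open>approximable\<close> functions, \<open>1 \<le> p\<close> and \<open>0 < s < 1\<close> this
  concerns a null set.\<close>

definition frac_op :: "real \<Rightarrow> ('a::euclidean_space \<Rightarrow> real) \<Rightarrow> 'a \<Rightarrow> 'a" where
  "frac_op s u x = frac_const DIM('a) s *\<^sub>R (LINT z|lborel. (u x - u (x - z)) *\<^sub>R kern s z)"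

lemma frac_gradient_Cc_eq:
  fixes u :: "'a::euclidean_space \<Rightarrow> real"
  assumes [measurable]: "u \<in> borel_measurable borel"
  shows "frac_gradient_Cc s u = frac_op s u"
proof
  fix x
  let ?H = "\<lambda>y. (u x - u y) *\<^sub>R kern s (x - y)"
  have "(\<lambda>y. ((u x - u y) / norm (x - y) powr (real DIM('a) + s)) *\<^sub>R ((x - y) /\<^sub>R norm (x - y))) = ?H"
    by (simp add: kern_def fun_eq_iff)
  then have "frac_gradient_Cc s u x = frac_const DIM('a) s *\<^sub>R (LINT y|lebesgue. ?H y)"
    by (simp add: frac_gradient_Cc_def)
  also have "(LINT y|lebesgue. ?H y) = (LINT y|lborel. ?H y)"
    by (rule integral_completion) measurable
  also have "\<dots> = (LINT z|lborel. ?H (x - z))"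
    by (rule integral_reflect[symmetric]) measurable
  finally show "frac_gradient_Cc s u x = frac_op s u x" by (simp add: frac_op_def)
qed

lemma frac_op_borel:
  assumes [measurable]: "u \<in> borel_measurable borel"
  shows "frac_op s u \<in> borel_measurable borel"
  unfolding frac_op_def by measurable

lemma difference_pair_borel:
  assumes [measurable]: "(u :: 'a::euclidean_space \<Rightarrow> real) \<in> borel_measurable borel"
  shows "(\<lambda>(x, z). u x - u (x - z)) \<in> borel_measurable (borel \<Otimes>\<^sub>M borel)"
  by measurable

text \<open>For fixed \<open>s\<close> any splitting radius will do, and 1 is taken. What matters is
  that the bound is linear in \<open>H\<close> and \<open>G\<close>, so it tends to 0 along
  approximating sequences.\<close>

lemma
  fixes u :: "'a::euclidean_space \<Rightarrow> real"
  assumes s: "0 < s" "s < 1" and p: "1 \<le> p" and u: "approximable p u g"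
    and H: "modular p u \<le> ennreal H" "0 \<le> H" and G: "modular p g \<le> ennreal G" "0 \<le> G"
  defines "Kn \<equiv> near_mass TYPE('a) s 1" and "Kf \<equiv> far_mass TYPE('a) s 1"
  shows frac_op_modular_le: "modular p (frac_op s u) \<le> ennreal (frac_const DIM('a) s powr p *
      ((Kn + Kf) powr (p - 1) * (near_const p * G * Kn + 2 * 2 powr p * H * Kf)))"
    and frac_op_AE_integrable_bounds: "AE x in lborel. integrable lborel (\<lambda>z. (u x - u (x - z)) *\<^sub>R kern s z)"
    and frac_op_abs_finite: "p = 1 \<Longrightarrow>
      (\<integral>\<^sup>+z. ennreal (norm (kern s z)) * modular 1 (\<lambda>x. u x - u (x - z)) \<partial>lborel) < \<infinity>"
proof -
  have um [measurable]: "u \<in> borel_measurable borel" using u by (simp add: approximable_def)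
  note S = singular_integral_modular[OF difference_pair_borel[OF um] s zero_less_one p, of "near_const p * G" "2 * 2 powr p * H",
    OF _ _ difference_modular[OF u p G] difference_modular_far[OF um p H]]
  have c: "0 < frac_const DIM('a) s" using s by (intro frac_const_pos) auto
  have nonneg: "0 \<le> near_const p * G" "0 \<le> 2 * 2 powr p * H" using near_const_nonneg H G by auto
  have "modular p (frac_op s u) = ennreal (\<bar>frac_const DIM('a) s\<bar> powr p) * modular p (\<lambda>x. LINT z|lborel. (u x - u (x - z)) *\<^sub>R kern s z)"
    unfolding frac_op_def[abs_def] by (intro modular_scaleR borel_lebesgue) measurable
  also have "\<dots> \<le> ennreal (\<bar>frac_const DIM('a) s\<bar> powr p) * ennreal ((Kn + Kf) powr (p - 1) * (near_const p * G * Kn + 2 * 2 powr p * H * Kf))"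
    unfolding Kn_def Kf_def by (intro mult_left_mono S(1) nonneg) auto
  also have "\<dots> = ennreal (frac_const DIM('a) s powr p *
      ((Kn + Kf) powr (p - 1) * (near_const p * G * Kn + 2 * 2 powr p * H * Kf)))"
    using c by (simp add: ennreal_mult')
  finally show "modular p (frac_op s u) \<le> ennreal (frac_const DIM('a) s powr p *
      ((Kn + Kf) powr (p - 1) * (near_const p * G * Kn + 2 * 2 powr p * H * Kf)))" .
  show "AE x in lborel. integrable lborel (\<lambda>z. (u x - u (x - z)) *\<^sub>R kern s z)"
    using S(2) nonneg by blast
  show "p = 1 \<Longrightarrow> (\<integral>\<^sup>+z. ennreal (norm (kern s z)) * modular 1 (\<lambda>x. u x - u (x - z)) \<partial>lborel) < \<infinity>"
    using S(3) nonneg by blast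
qed

lemma approximable_real_bounds:
  assumes "approximable p u g"
  obtains H G where "modular p u = ennreal H" "0 \<le> H" "modular p g = ennreal G" "0 \<le> G"
proof -
  have "modular p u < \<infinity>" "modular p g < \<infinity>" using assms by (auto simp: approximable_def)
  then show ?thesis
    by (intro that[of "enn2real (modular p u)" "enn2real (modular p g)"]) auto
qed

lemma frac_op_AE_integrable:
  assumes s: "0 < s" "s < 1" and p: "1 \<le> p" and u: "approximable p u g"
  shows "AE x in lborel. integrable lborel (\<lambda>z. (u x - u (x - z)) *\<^sub>R kern s z)"
proof -
  obtain H G where "modular p u = ennreal H" "0 \<le> H" "modular p g = ennreal G" "0 \<le> G"
    using approximable_real_bounds[OF u] .
  then show ?thesis by (intro frac_op_AE_integrable_bounds[OF s p u, of H G]) simp_all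
qed

lemma frac_op_modular_finite:
  fixes u :: "'a::euclidean_space \<Rightarrow> real"
  assumes s: "0 < s" "s < 1" and p: "1 \<le> p" and u: "approximable p u g"
  shows "modular p (frac_op s u) < \<infinity>"
proof -
  obtain H G where "modular p u = ennreal H" "0 \<le> H" "modular p g = ennreal G" "0 \<le> G"
    using approximable_real_bounds[OF u] .
  then show ?thesis
    using frac_op_modular_le[OF s p u, of H G] by (auto intro: le_less_trans)
qed

text \<open>Take test functions within \<open>1/(j+1)\<close> of \<open>(u, g)\<close>. The
  difference of the two singular integrals is that of the error \<open>U j - u\<close>, itself
  \<open>approximable\<close>, and so is bounded by \<open>C/(j+1)\<close>.\<close>

lemma has_frac_gradient_frac_op:
  fixes u :: "'a::euclidean_space \<Rightarrow> real"
  assumes s: "0 < s" "s < 1" and p: "1 \<le> p" and u: "approximable p u g"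
  shows "has_frac_gradient p s u (frac_op s u)"
proof -
  have um [measurable]: "u \<in> borel_measurable borel" "g \<in> borel_measurable borel" and fin: "modular p u < \<infinity>"
    using u by (auto simp: approximable_def)
  have "\<exists>U\<in>Cc_infinity. modular p (\<lambda>x. U x - u x) < ennreal (inverse (real (Suc j))) \<and>
      modular p (\<lambda>x. grad U x - g x) < ennreal (inverse (real (Suc j)))" for j
    using u by (simp add: approximable_def)
  then obtain U where U: "\<And>j. U j \<in> Cc_infinity"
    and M: "\<And>j. modular p (\<lambda>x. U j x - u x) < ennreal (inverse (real (Suc j)))"
      "\<And>j. modular p (\<lambda>x. grad (U j) x - g x) < ennreal (inverse (real (Suc j)))"
    by metis
  have UM: "U j \<in> borel_measurable borel" for j using U by (rule Cc_infinity_borel)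
  note [measurable] = UM
  have e0: "(\<lambda>j. ennreal (inverse (real (Suc j)))) \<longlonglongrightarrow> 0"
    using tendsto_ennrealI[OF LIMSEQ_inverse_real_of_nat] by simp
  have p0: "0 < p" using p by simp
  define Kn Kf where "Kn = near_mass TYPE('a) s 1" and "Kf = far_mass TYPE('a) s 1"
  define C where "C = frac_const DIM('a) s powr p * ((Kn + Kf) powr (p - 1) * (near_const p * Kn + 2 * 2 powr p * Kf))"
  have T1: "tendsto_Lp p U u sequentially"
    unfolding tendsto_Lp_iff[OF p0]
  proof (intro conjI always_eventually allI)
    show "U j \<in> Lp p" for j
      using Cc_infinity_modular_finite[OF U, of p] p by (auto simp: Lp_iff intro: borel_lebesgue UM)
    show "u \<in> Lp p" using fin by (auto simp: Lp_iff intro: borel_lebesgue um)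
    show "(\<lambda>j. modular p (\<lambda>x. U j x - u x)) \<longlonglongrightarrow> 0"
      by (rule tendsto_sandwich[OF _ _ tendsto_const e0]) (simp_all add: less_imp_le[OF M(1)] del: of_nat_Suc)
  qed
  have T2: "tendsto_Lp p (\<lambda>j. frac_gradient_Cc s (U j)) (frac_op s u) sequentially"
    unfolding tendsto_Lp_iff[OF p0] frac_gradient_Cc_eq[OF UM]
  proof (intro conjI always_eventually allI)
    show "frac_op s (U j) \<in> Lp p" for j
      using frac_op_modular_finite[OF s p approximable_Cc_infinity[OF U p]]
      by (auto simp: Lp_iff intro: borel_lebesgue frac_op_borel UM)
    show "frac_op s u \<in> Lp p"
      using frac_op_modular_finite[OF s p u] by (auto simp: Lp_iff intro: borel_lebesgue frac_op_borel um)
    have le: "modular p (\<lambda>x. frac_op s (U j) x - frac_op s u x) \<le> ennreal (C * inverse (real (Suc j)))" for j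
    proof -
      let ?w = "\<lambda>x. U j x - u x"
      note ap = approximable_diff[OF u U[of j] p]
      \<comment> \<open>Linearity holds only at points where both integrals converge, hence almost
        everywhere.\<close>
      have "AE x in lborel. frac_op s (U j) x - frac_op s u x = frac_op s ?w x"
        using frac_op_AE_integrable[OF s p u] frac_op_AE_integrable[OF s p approximable_Cc_infinity[OF U[of j] p]]
      proof eventually_elim
        case (elim x)
        have "(LINT z|lborel. (U j x - U j (x - z)) *\<^sub>R kern s z) - (LINT z|lborel. (u x - u (x - z)) *\<^sub>R kern s z)
            = (LINT z|lborel. (U j x - U j (x - z)) *\<^sub>R kern s z - (u x - u (x - z)) *\<^sub>R kern s z)"
          by (rule Bochner_Integration.integral_diff[symmetric, OF elim(2,1)])
        also have "\<dots> = (LINT z|lborel. (?w x - ?w (x - z)) *\<^sub>R kern s z)"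
        proof -
          have "U j x - U j (x - z) - (u x - u (x - z)) = ?w x - ?w (x - z)" for z by simp
          then show ?thesis by (simp only: scaleR_diff_left[symmetric])
        qed
        finally show ?case unfolding frac_op_def by (simp only: scaleR_diff_right[symmetric])
      qed
      then have "modular p (\<lambda>x. frac_op s (U j) x - frac_op s u x) = modular p (frac_op s ?w)"
        by (intro modular_cong_AE AE_completion)
      also have "\<dots> \<le> ennreal (frac_const DIM('a) s powr p * ((Kn + Kf) powr (p - 1) *
          (near_const p * inverse (real (Suc j)) * Kn + 2 * 2 powr p * inverse (real (Suc j)) * Kf)))"
        unfolding Kn_def Kf_def
        by (rule frac_op_modular_le[OF s p ap]) (simp_all add: less_imp_le[OF M(1)] less_imp_le[OF M(2)] del: of_nat_Suc)
      also have "frac_const DIM('a) s powr p * ((Kn + Kf) powr (p - 1) *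
          (near_const p * inverse (real (Suc j)) * Kn + 2 * 2 powr p * inverse (real (Suc j)) * Kf)) = C * inverse (real (Suc j))"
      proof -
        have "near_const p * i * Kn + 2 * 2 powr p * i * Kf = (near_const p * Kn + 2 * 2 powr p * Kf) * i" for i
          by (simp add: algebra_simps)
        then show ?thesis unfolding C_def by (simp only: mult.assoc)
      qed
      finally show ?thesis .
    qed
    have "(\<lambda>j. C * inverse (real (Suc j))) \<longlonglongrightarrow> C * 0"
      by (intro tendsto_intros LIMSEQ_inverse_real_of_nat)
    from tendsto_ennrealI[OF this]
    have lim: "(\<lambda>j. ennreal (C * inverse (real (Suc j)))) \<longlonglongrightarrow> 0" by simp
    show "(\<lambda>j. modular p (\<lambda>x. frac_op s (U j) x - frac_op s u x)) \<longlonglongrightarrow> 0"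
      by (rule tendsto_sandwich[OF _ _ tendsto_const lim]) (simp_all add: le del: of_nat_Suc)
  qed
  show ?thesis unfolding has_frac_gradient_def using U T1 T2 by blast
qed

section \<open>Comparison of the singular integral with the gradient as s tends to 1\<close>

lemma near_tensor:
  fixes g :: "'a::euclidean_space"
  assumes s: "s < 1" and d: "0 < d"
  shows "integrable lborel (\<lambda>z. (if norm z < d then g \<bullet> z else 0) *\<^sub>R kern s z)"
    and "(LINT z|lborel. (if norm z < d then g \<bullet> z else 0) *\<^sub>R kern s z) = (near_mass TYPE('a) s d / DIM('a)) *\<^sub>R g"
proof -
  \<comment> \<open>Chosen so that \<open>k (norm z) * (g . z)\<close> times \<open>z\<close> equals
    \<open>g . z\<close> times the truncated kernel, while \<open>k (norm z) * (norm z)^2\<close> is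
    the weight whose integral is \<open>near_mass\<close>.\<close>
  define k where "k r = indicator {..<d} r * (r powr (- real DIM('a) - s) / r)" for r :: real
  have [measurable]: "k \<in> borel_measurable borel" unfolding k_def by measurable
  have k1: "k (norm z) * (norm z)\<^sup>2 = norm z powr (1 - real DIM('a) - s) * indicator {..<d} (norm z)" for z :: 'a
  proof (cases "z = 0")
    case False
    have "norm z powr (1 - real DIM('a) - s) = norm z powr (- real DIM('a) - s + 1)" by (simp add: algebra_simps)
    also have "\<dots> = norm z powr (- real DIM('a) - s) * norm z" using False by (subst powr_add) simp
    finally show ?thesis using False by (simp add: k_def power2_eq_square)
  qed simp
  have k2: "(k (norm z) * (g \<bullet> z)) *\<^sub>R z = (if norm z < d then g \<bullet> z else 0) *\<^sub>R kern s z" for z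
  proof -
    have "norm z powr (- real DIM('a) - s) = 1 / norm z powr (real DIM('a) + s)"
      by (subst powr_minus_divide[symmetric]) simp
    then show ?thesis by (simp add: k_def kern_def divide_inverse mult_ac)
  qed
  have near: "(\<integral>\<^sup>+z. ennreal (norm (z::'a) powr (1 - real DIM('a) - s) * indicator {..<d} (norm z)) \<partial>lborel) =
      ennreal (near_mass TYPE('a) s d)"
    unfolding near_mass_def by (rule nn_integral_near[OF s d])
  have int: "integrable lborel (\<lambda>z::'a. k (norm z) * (norm z)\<^sup>2)"
    unfolding k1 by (rule integrableI_nonneg) (auto simp: near)
  have I: "(LINT z|lborel. k (norm (z::'a)) * (norm z)\<^sup>2) = near_mass TYPE('a) s d"
    unfolding k1 by (subst integral_eq_nn_integral) (use masses_pos(1)[OF s d, where 'a='a] in \<open>auto simp: near\<close>)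
  show "integrable lborel (\<lambda>z. (if norm z < d then g \<bullet> z else 0) *\<^sub>R kern s z)"
    using integral_radial_tensor(1)[OF _ int, of g] unfolding k2 by simp
  show "(LINT z|lborel. (if norm z < d then g \<bullet> z else 0) *\<^sub>R kern s z) = (near_mass TYPE('a) s d / DIM('a)) *\<^sub>R g"
    using integral_radial_tensor(2)[OF _ int, of g] unfolding k2 I by simp
qed

text \<open>Subtracting the linear term \<open>g x . z\<close> on \<open>norm z < d\<close> under
  the integral removes exactly \<open>An / n\<close> times \<open>g\<close>. The rest is controlled
  by the Taylor bound near the origin and by the size of \<open>u\<close> away from it; replacing
  \<open>An / n\<close> by 1 costs the term with \<open>G\<close>.\<close>

lemma frac_op_minus_gradient_le:
  fixes u :: "'a::euclidean_space \<Rightarrow> real"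
  assumes s: "0 < s" "s < 1" and p: "1 \<le> p" and u: "approximable p u g" and d: "0 < d"
    and H: "modular p u \<le> ennreal H" "0 \<le> H" and G: "modular p g \<le> ennreal G" "0 \<le> G" and B0: "0 \<le> B"
    and B: "\<And>h. norm h < d \<Longrightarrow> modular p (\<lambda>x. g (x - h) - g x) \<le> ennreal B"
  defines "An \<equiv> frac_const DIM('a) s * near_mass TYPE('a) s d" and "Af \<equiv> frac_const DIM('a) s * far_mass TYPE('a) s d"
  shows "modular p (\<lambda>x. frac_op s u x - g x) \<le> ennreal (2 powr p *
    ((An + Af) powr (p - 1) * ((2 powr p) ^ 3 * B * An + 2 * 2 powr p * H * Af) + \<bar>An / DIM('a) - 1\<bar> powr p * G))"
proof -
  have um [measurable]: "u \<in> borel_measurable borel" "g \<in> borel_measurable borel" using u by (auto simp: approximable_def)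
  note [measurable] = frac_op_borel[OF um(1)]
  define c where "c = frac_const DIM('a) s"
  have c: "0 < c" unfolding c_def using s by (intro frac_const_pos) auto
  define Kn Kf where "Kn = near_mass TYPE('a) s d" and "Kf = far_mass TYPE('a) s d"
  have K: "0 < Kn" "0 < Kf" using masses_pos s d by (auto simp: Kn_def Kf_def)
  define w where "w x z = u x - u (x - z) - (if norm z < d then g x \<bullet> z else 0)" for x z
  have wm: "(\<lambda>(x, z). w x z) \<in> borel_measurable (borel \<Otimes>\<^sub>M borel)" unfolding w_def by measurable
  have near: "modular p (\<lambda>x. w x z) \<le> ennreal ((2 powr p) ^ 3 * B * norm z powr p)" if z: "norm z < d" for z
  proof -
    have "modular p (\<lambda>x. u x - u (x - z) - g x \<bullet> z) \<le> ennreal ((2 powr p) ^ 3 * norm z powr p * B)"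
    proof (rule taylor_modular[OF u p B0])
      fix t :: real assume t: "t \<in> {0..1}"
      have "norm (t *\<^sub>R z) \<le> 1 * norm z" unfolding norm_scaleR using t by (intro mult_right_mono) auto
      then show "modular p (\<lambda>x. g (x - t *\<^sub>R z) - g x) \<le> ennreal B" using z by (intro B) simp
    qed
    then show ?thesis using z by (simp add: w_def mult_ac)
  qed
  have far: "modular p (\<lambda>x. w x z) \<le> ennreal (2 * 2 powr p * H)" if z: "d \<le> norm z" for z
    using difference_modular_far[OF um(1) p H, of z] z by (simp add: w_def)
  have b: "0 \<le> (2 powr p) ^ 3 * B" "0 \<le> 2 * 2 powr p * H" using B0 H by auto
  note S = singular_integral_modular[OF wm s d p b near far]
  have meas: "(\<lambda>x. LINT z|lborel. w x z *\<^sub>R kern s z) \<in> borel_measurable borel"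
    using wm by measurable
  have "AE x in lborel. frac_op s u x - (An / DIM('a)) *\<^sub>R g x = c *\<^sub>R (LINT z|lborel. w x z *\<^sub>R kern s z)"
    using frac_op_AE_integrable[OF s p u]
  proof eventually_elim
    case (elim x)
    have "(LINT z|lborel. w x z *\<^sub>R kern s z) = (LINT z|lborel. (u x - u (x - z)) *\<^sub>R kern s z -
        (if norm z < d then g x \<bullet> z else 0) *\<^sub>R kern s z)"
      unfolding w_def scaleR_diff_left ..
    also have "\<dots> = (LINT z|lborel. (u x - u (x - z)) *\<^sub>R kern s z) - (Kn / DIM('a)) *\<^sub>R g x"
      unfolding Kn_def near_tensor(2)[OF s(2) d, symmetric]
      by (rule Bochner_Integration.integral_diff[OF elim near_tensor(1)[OF s(2) d]])
    finally show ?case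
      by (simp add: frac_op_def c_def An_def Kn_def scaleR_diff_right)
  qed
  then have "modular p (\<lambda>x. frac_op s u x - (An / DIM('a)) *\<^sub>R g x) = modular p (\<lambda>x. c *\<^sub>R (LINT z|lborel. w x z *\<^sub>R kern s z))"
    by (intro modular_cong_AE AE_completion)
  also have "\<dots> = ennreal (\<bar>c\<bar> powr p) * modular p (\<lambda>x. LINT z|lborel. w x z *\<^sub>R kern s z)"
    by (intro modular_scaleR borel_lebesgue meas)
  also have "\<dots> \<le> ennreal (\<bar>c\<bar> powr p) * ennreal ((Kn + Kf) powr (p - 1) * ((2 powr p) ^ 3 * B * Kn + 2 * 2 powr p * H * Kf))"
    unfolding Kn_def Kf_def by (intro mult_left_mono S(1)) auto
  also have "\<dots> = ennreal (c powr p * ((Kn + Kf) powr (p - 1) * ((2 powr p) ^ 3 * B * Kn + 2 * 2 powr p * H * Kf)))"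
    using c by (simp add: ennreal_mult')
  \<comment> \<open>Splitting \<open>c powr p\<close> as \<open>c powr (p - 1) * c\<close> attaches
    one factor \<open>c\<close> to every mass. Only the products \<open>An\<close> and
    \<open>Af\<close> remain, which have limits as \<open>s\<close> tends to 1, whereas
    \<open>Kn\<close> alone blows up.\<close>
  also have "c powr p * ((Kn + Kf) powr (p - 1) * ((2 powr p) ^ 3 * B * Kn + 2 * 2 powr p * H * Kf)) =
      (An + Af) powr (p - 1) * ((2 powr p) ^ 3 * B * An + 2 * 2 powr p * H * Af)"
  proof -
    have "An + Af = c * (Kn + Kf)" by (simp add: An_def Af_def c_def Kn_def Kf_def algebra_simps)
    then have "(An + Af) powr (p - 1) = c powr (p - 1) * (Kn + Kf) powr (p - 1)"
      using c K by (simp add: powr_mult)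
    moreover have "c powr p = c powr (p - 1) * c" using c by (simp add: powr_diff)
    ultimately show ?thesis
      by (simp add: An_def Af_def c_def[symmetric] Kn_def[symmetric] Kf_def[symmetric] algebra_simps)
  qed
  finally have 1: "modular p (\<lambda>x. frac_op s u x - (An / DIM('a)) *\<^sub>R g x) \<le>
      ennreal ((An + Af) powr (p - 1) * ((2 powr p) ^ 3 * B * An + 2 * 2 powr p * H * Af))" .
  have "modular p (\<lambda>x. (An / DIM('a) - 1) *\<^sub>R g x) = ennreal (\<bar>An / DIM('a) - 1\<bar> powr p) * modular p g"
    by (intro modular_scaleR borel_lebesgue um)
  also have "\<dots> \<le> ennreal (\<bar>An / DIM('a) - 1\<bar> powr p) * ennreal G" by (intro mult_left_mono G) auto
  also have "\<dots> = ennreal (\<bar>An / DIM('a) - 1\<bar> powr p * G)" by (simp add: ennreal_mult')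
  finally have 2: "modular p (\<lambda>x. (An / DIM('a) - 1) *\<^sub>R g x) \<le> ennreal (\<bar>An / DIM('a) - 1\<bar> powr p * G)" .
  have A: "0 \<le> An" "0 \<le> Af" using c K by (auto simp: An_def Af_def c_def Kn_def Kf_def)
  have "modular p (\<lambda>x. (frac_op s u x - (An / DIM('a)) *\<^sub>R g x) + (An / DIM('a) - 1) *\<^sub>R g x) \<le> ennreal (2 powr p *
    ((An + Af) powr (p - 1) * ((2 powr p) ^ 3 * B * An + 2 * 2 powr p * H * Af) + \<bar>An / DIM('a) - 1\<bar> powr p * G))"
    by (rule modular_add_le[OF _ _ _ 1 2]) (use p A B0 H G in auto)
  then show ?thesis by (simp add: scaleR_diff_left)
qed

text \<open>The factor \<open>1/(1-s)\<close> of the near mass cancels the zero of the constant, and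
  the dependence on \<open>d\<close> disappears because \<open>d powr (1 - s)\<close> tends to 1.
  The far mass stays bounded, so the vanishing constant wins.\<close>

lemma mass_limits:
  assumes d: "0 < d"
  shows "((\<lambda>s. frac_const DIM('a) s * near_mass TYPE('a::euclidean_space) s d) \<longlongrightarrow> DIM('a)) (at_left 1)"
    and "((\<lambda>s. frac_const DIM('a) s * far_mass TYPE('a) s d) \<longlongrightarrow> 0) (at_left 1)"
proof -
  let ?n = "real DIM('a)" and ?w = "unit_ball_vol (real DIM('a))"
  have w: "?w \<noteq> 0" using unit_ball_vol_pos[of ?n] by (metis less_irrefl of_nat_0_le_iff)
  have lim: "((\<lambda>s. frac_const DIM('a) s / (1 - s)) \<longlongrightarrow> 1 / ?w) (at_left 1)"
    by (rule frac_const_limit) simp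
  have "((\<lambda>s. (frac_const DIM('a) s / (1 - s)) * (?n * ?w * d powr (1 - s))) \<longlongrightarrow> 1 / ?w * (?n * ?w * d powr (1 - 1))) (at_left 1)"
    by (intro tendsto_intros lim) (use d in auto)
  then show "((\<lambda>s. frac_const DIM('a) s * near_mass TYPE('a) s d) \<longlongrightarrow> DIM('a)) (at_left 1)"
    using w d by (simp add: near_mass_def mult_ac)
  have "((\<lambda>s. (frac_const DIM('a) s / (1 - s)) * ((1 - s) * (?n * ?w * (d powr (- s) / s)))) \<longlongrightarrow>
      1 / ?w * ((1 - 1) * (?n * ?w * (d powr (- 1) / 1)))) (at_left 1)"
    by (intro tendsto_intros lim) (use d in auto)
  moreover have "\<forall>\<^sub>F s in at_left 1. (frac_const DIM('a) s / (1 - s)) * ((1 - s) * (?n * ?w * (d powr (- s) / s))) =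
      frac_const DIM('a) s * far_mass TYPE('a) s d"
    by (auto simp: eventually_at_filter far_mass_def)
  ultimately show "((\<lambda>s. frac_const DIM('a) s * far_mass TYPE('a) s d) \<longlongrightarrow> 0) (at_left 1)"
    by (auto intro: Lim_transform_eventually)
qed

lemma tendsto_ennreal_0I:
  fixes f :: "'i \<Rightarrow> ennreal"
  assumes "\<And>e. 0 < e \<Longrightarrow> \<forall>\<^sub>F i in F. f i < ennreal e"
  shows "(f \<longlongrightarrow> 0) F"
proof (rule order_tendstoI)
  fix a :: ennreal assume a: "0 < a"
  have "\<exists>e>0. ennreal e \<le> a"
  proof (cases a)
    case (real r)
    then show ?thesis using a by (intro exI[of _ r]) auto
  qed (auto intro: exI[of _ 1])
  then obtain e where "0 < e" "ennreal e \<le> a" by blast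
  then show "\<forall>\<^sub>F i in F. f i < a" using assms[of e] by (auto elim: eventually_mono)
qed simp

lemma frac_op_tendsto_gradient:
  fixes u :: "'a::euclidean_space \<Rightarrow> real"
  assumes p: "1 \<le> p" and u: "approximable p u g"
  shows "((\<lambda>s. modular p (\<lambda>x. frac_op s u x - g x)) \<longlongrightarrow> 0) (at_left 1)"
proof (rule tendsto_ennreal_0I)
  fix e :: real assume e: "0 < e"
  let ?n = "real DIM('a)"
  obtain H G where H: "modular p u = ennreal H" "0 \<le> H" and G: "modular p g = ennreal G" "0 \<le> G"
    using approximable_real_bounds[OF u] .
  \<comment> \<open>\<open>L\<close> is the coefficient of \<open>B\<close> in the limit of
    \<open>R s\<close>, where \<open>An\<close> is \<open>n\<close> and \<open>Af\<close> is 0; with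
    \<open>B = e / (2 * L)\<close> that limit is \<open>e / 2\<close>. The radius \<open>d\<close>
    depends on \<open>B\<close> but not on \<open>s\<close>.\<close>
  define L where "L = 2 powr p * (?n powr (p - 1) * ((2 powr p) ^ 3 * ?n))"
  have L: "0 < L" by (simp add: L_def)
  define B where "B = e / (2 * L)"
  have B: "0 < B" using e L by (simp add: B_def)
  have gm: "g \<in> borel_measurable borel" and gfin: "modular p g < \<infinity>" using u by (auto simp: approximable_def)
  obtain d where d: "0 < d" "\<And>h. norm h < d \<Longrightarrow> modular p (\<lambda>x. g (x - h) - g x) < ennreal B"
    using modular_translation_continuous[OF gm gfin _ B] p by auto
  define An Af where "An s = frac_const DIM('a) s * near_mass TYPE('a) s d"
    and "Af s = frac_const DIM('a) s * far_mass TYPE('a) s d" for s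
  define R where "R s = 2 powr p * ((An s + Af s) powr (p - 1) * ((2 powr p) ^ 3 * B * An s + 2 * 2 powr p * H * Af s)
      + \<bar>An s / DIM('a) - 1\<bar> powr p * G)" for s
  have An: "(An \<longlongrightarrow> ?n) (at_left 1)" and Af: "(Af \<longlongrightarrow> 0) (at_left 1)"
    unfolding An_def[abs_def] Af_def[abs_def] using mass_limits[OF d(1), where 'a='a] by auto
  have "(R \<longlongrightarrow> 2 powr p * ((?n + 0) powr (p - 1) * ((2 powr p) ^ 3 * B * ?n + 2 * 2 powr p * H * 0)
      + \<bar>?n / ?n - 1\<bar> powr p * G)) (at_left 1)"
    unfolding R_def[abs_def] by (intro tendsto_intros tendsto_powr2 An Af) (use p in auto)
  also have "2 powr p * ((?n + 0) powr (p - 1) * ((2 powr p) ^ 3 * B * ?n + 2 * 2 powr p * H * 0)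
      + \<bar>?n / ?n - 1\<bar> powr p * G) = L * B"
    by (simp add: L_def)
  also have "L * B = e / 2" using L by (simp add: B_def)
  finally have "\<forall>\<^sub>F s in at_left 1. R s < e"
    by (rule order_tendstoD(2)) (use e in simp)
  moreover have "\<forall>\<^sub>F s in at_left (1::real). 0 < s \<and> s < 1"
    using eventually_at_left_real[of 0 1] by simp
  ultimately show "\<forall>\<^sub>F s in at_left 1. modular p (\<lambda>x. frac_op s u x - g x) < ennreal e"
  proof eventually_elim
    case (elim s)
    have "modular p (\<lambda>x. frac_op s u x - g x) \<le> ennreal (R s)"
      unfolding R_def An_def Af_def
      by (rule frac_op_minus_gradient_le[OF _ _ p u d(1)])
        (use elim H G B d(2) in \<open>auto intro: less_imp_le\<close>)
    also have "\<dots> < ennreal e" using elim(1) e by (simp add: ennreal_less_iff ennreal_lessI)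
    finally show ?case .
  qed
qed

section \<open>Integration by parts and uniqueness\<close>

text \<open>Fubini's theorem. The kernel alone is not integrable near 0, but the L^1 norm of
  \<open>U x - U (x - z)\<close> is of order \<open>norm z\<close> there, so the case
  \<open>p = 1\<close> of the singular estimate, together with the boundedness of \<open>V\<close>,
  gives absolute integrability of the double integral.\<close>

lemma frac_op_integral_mult:
  fixes U V :: "'a::euclidean_space \<Rightarrow> real"
  assumes U: "U \<in> Cc_infinity" and V: "V \<in> Cc_infinity" and s: "0 < s" "s < 1" and b: "b \<in> Basis"
  shows "(LINT x|lborel. (frac_op s U x \<bullet> b) * V x) = frac_const DIM('a) s *
    (LINT z|lborel. (kern s z \<bullet> b) * (LINT x|lborel. (U x - U (x - z)) * V x))"
proof -
  note [measurable] = Cc_infinity_borel[OF U] Cc_infinity_borel[OF V] frac_op_borel[OF Cc_infinity_borel[OF U]]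
  obtain B where B: "0 < B" "\<And>x. \<bar>V x\<bar> \<le> B" using Cc_infinity_bounded[OF V] by blast
  define f where "f x z = (U x - U (x - z)) * (kern s z \<bullet> b) * V x" for x z
  have fm: "case_prod f \<in> borel_measurable (lborel \<Otimes>\<^sub>M lborel)"
    unfolding f_def by measurable
  note ap = approximable_Cc_infinity[OF U order.refl]
  have abs: "(\<integral>\<^sup>+z. ennreal (norm (kern s z)) * modular 1 (\<lambda>x. U x - U (x - z)) \<partial>lborel) < \<infinity>"
  proof -
    obtain H G where "modular 1 U = ennreal H" "0 \<le> H" "modular 1 (grad U) = ennreal G" "0 \<le> G"
      using approximable_real_bounds[OF ap] .
    then show ?thesis by (intro frac_op_abs_finite[OF s order.refl ap, of H G]) simp_all
  qed
  have int: "integrable (lborel \<Otimes>\<^sub>M lborel) (case_prod f)"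
  proof (rule integrableI_bounded[OF fm])
    have "(\<integral>\<^sup>+ y. ennreal (norm (case_prod f y)) \<partial>(lborel \<Otimes>\<^sub>M lborel)) = (\<integral>\<^sup>+z. \<integral>\<^sup>+x. ennreal (norm (f x z)) \<partial>lborel \<partial>lborel)"
      using lborel_pair.nn_integral_snd[of "\<lambda>y. ennreal (norm (case_prod f y))"] fm by simp
    also have "\<dots> \<le> (\<integral>\<^sup>+z. ennreal B * (ennreal (norm (kern s z)) * modular 1 (\<lambda>x. U x - U (x - z))) \<partial>lborel)"
    proof (rule nn_integral_mono)
      fix z :: 'a
      have "(\<integral>\<^sup>+x. ennreal (norm (f x z)) \<partial>lborel) \<le>
          (\<integral>\<^sup>+x. ennreal (B * norm (kern s z)) * ennreal (norm (U x - U (x - z)) powr 1) \<partial>lborel)"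
      proof (rule nn_integral_mono)
        fix x
        have "\<bar>kern s z \<bullet> b\<bar> \<le> norm (kern s z)" by (rule Basis_le_norm[OF b])
        then have "\<bar>U x - U (x - z)\<bar> * \<bar>kern s z \<bullet> b\<bar> * \<bar>V x\<bar> \<le> \<bar>U x - U (x - z)\<bar> * norm (kern s z) * B"
          using B by (intro mult_mono) auto
        then show "ennreal (norm (f x z)) \<le> ennreal (B * norm (kern s z)) * ennreal (norm (U x - U (x - z)) powr 1)"
          using B by (simp add: f_def abs_mult ennreal_mult[symmetric] mult_ac)
      qed
      also have "\<dots> = ennreal (B * norm (kern s z)) * modular 1 (\<lambda>x. U x - U (x - z))"
        unfolding modular_def by (rule nn_integral_cmult) measurable
      finally show "(\<integral>\<^sup>+x. ennreal (norm (f x z)) \<partial>lborel) \<le> ennreal B * (ennreal (norm (kern s z)) * modular 1 (\<lambda>x. U x - U (x - z)))"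
        using B by (simp add: ennreal_mult mult.assoc)
    qed
    also have "\<dots> \<le> ennreal B * (\<integral>\<^sup>+z. ennreal (norm (kern s z)) * modular 1 (\<lambda>x. U x - U (x - z)) \<partial>lborel)"
    proof (rule eq_refl, rule nn_integral_cmult)
      show "(\<lambda>z. ennreal (norm (kern s z)) * modular 1 (\<lambda>x. U x - U (x - z))) \<in> borel_measurable lborel"
        unfolding modular_def by measurable
    qed
    also have "\<dots> < \<infinity>" using abs by (simp add: ennreal_mult_less_top)
    finally show "(\<integral>\<^sup>+ y. ennreal (norm (case_prod f y)) \<partial>(lborel \<Otimes>\<^sub>M lborel)) < \<infinity>" .
  qed
  have "AE x in lborel. (frac_op s U x \<bullet> b) * V x = frac_const DIM('a) s * (LINT z|lborel. f x z)"
    using frac_op_AE_integrable[OF s order.refl ap]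
  proof eventually_elim
    case (elim x)
    have "(LINT z|lborel. f x z) = (LINT z|lborel. (((U x - U (x - z)) *\<^sub>R kern s z) \<bullet> b) * V x)"
      by (simp add: f_def)
    also have "\<dots> = (LINT z|lborel. ((U x - U (x - z)) *\<^sub>R kern s z) \<bullet> b) * V x"
      by (rule integral_mult_left_zero)
    also have "(LINT z|lborel. ((U x - U (x - z)) *\<^sub>R kern s z) \<bullet> b) = (LINT z|lborel. (U x - U (x - z)) *\<^sub>R kern s z) \<bullet> b"
      by (rule integral_inner_left[OF elim])
    finally show ?case by (simp add: frac_op_def)
  qed
  then have "(LINT x|lborel. (frac_op s U x \<bullet> b) * V x) = (LINT x|lborel. frac_const DIM('a) s * (LINT z|lborel. f x z))"
    by (intro integral_cong_AE) (use fm in measurable)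
  also have "\<dots> = frac_const DIM('a) s * (LINT x|lborel. (LINT z|lborel. f x z))"
    by (rule integral_mult_right_zero)
  also have "(LINT x|lborel. (LINT z|lborel. f x z)) = (LINT z|lborel. (LINT x|lborel. f x z))"
    by (rule lborel_pair.Fubini_integral[symmetric, OF int])
  also have "\<dots> = (LINT z|lborel. (kern s z \<bullet> b) * (LINT x|lborel. (U x - U (x - z)) * V x))"
  proof (rule Bochner_Integration.integral_cong)
    fix z :: 'a
    have "f x z = (kern s z \<bullet> b) * ((U x - U (x - z)) * V x)" for x by (simp add: f_def)
    then show "(LINT x|lborel. f x z) = (kern s z \<bullet> b) * (LINT x|lborel. (U x - U (x - z)) * V x)"
      by (simp only: integral_mult_right_zero)
  qed simp
  finally show ?thesis .
qed

text \<open>For fixed \<open>z\<close>, translating \<open>x\<close> moves the difference from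
  \<open>U\<close> to \<open>V\<close> and turns \<open>z\<close> into \<open>- z\<close>;
  reflecting \<open>z\<close> back costs a sign because \<open>kern\<close> is odd.\<close>

lemma frac_op_integration_by_parts:
  fixes U V :: "'a::euclidean_space \<Rightarrow> real"
  assumes U: "U \<in> Cc_infinity" and V: "V \<in> Cc_infinity" and s: "0 < s" "s < 1" and b: "b \<in> Basis"
  shows "(LINT x|lborel. (frac_op s U x \<bullet> b) * V x) = - (LINT x|lborel. (frac_op s V x \<bullet> b) * U x)"
proof -
  note [measurable] = Cc_infinity_borel[OF U] Cc_infinity_borel[OF V]
  obtain B where B: "\<And>x. \<bar>V x\<bar> \<le> B" using Cc_infinity_bounded[OF V] by blast
  define A where "A z = (LINT x|lborel. (V x - V (x - z)) * U x)" for z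
  have Am [measurable]: "A \<in> borel_measurable borel" unfolding A_def[abs_def] by measurable
  have iV: "integrable lborel (\<lambda>x. V (x + z) * U x)" for z
  proof -
    have "continuous_on UNIV (\<lambda>x. V (x + z))"
      by (rule continuous_on_compose2[OF Cc_infinity_continuous[OF V]]) (auto intro!: continuous_intros)
    from integrable_bounded_continuous_mult[OF this B Cc_infinity_integrable[OF U]] show ?thesis by simp
  qed
  have iU: "integrable lborel (\<lambda>x. U (x - z) * V x)" for z
  proof -
    have "integrable (distr lborel borel (\<lambda>x. x - z)) (\<lambda>x. V (x + z) * U x)"
      unfolding lborel_distr_diff using iV by simp
    then show ?thesis by (subst (asm) integrable_distr_eq) (auto simp: mult.commute)
  qed
  have eq: "(LINT x|lborel. (U x - U (x - z)) * V x) = A (- z)" for z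
  proof -
    have "(LINT x|lborel. (U x - U (x - z)) * V x) = (LINT x|lborel. U x * V x) - (LINT x|lborel. U (x - z) * V x)"
      using iU[of 0] iU[of z] by (simp add: left_diff_distrib)
    also have "(LINT x|lborel. U (x - z) * V x) = (LINT x|lborel. V (x + z) * U x)"
      using integral_diff_shift[of "\<lambda>x. V (x + z) * U x" z] by (simp add: mult.commute)
    also have "(LINT x|lborel. U x * V x) - \<dots> = A (- z)"
      using iV[of 0] iV[of z] by (simp add: A_def left_diff_distrib right_diff_distrib mult.commute)
    finally show ?thesis .
  qed
  have "(LINT z|lborel. (kern s z \<bullet> b) * A (- z)) = (LINT z|lborel. (kern s (0 - z) \<bullet> b) * A (- (0 - z)))"
    by (rule integral_reflect[of "\<lambda>z. (kern s z \<bullet> b) * A (- z)", symmetric]) measurable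
  also have "\<dots> = - (LINT z|lborel. (kern s z \<bullet> b) * A z)"
    by (simp add: kern_minus)
  finally show ?thesis
    unfolding frac_op_integral_mult[OF U V s b] frac_op_integral_mult[OF V U s b] eq
    by (simp add: A_def)
qed

text \<open>A large \<open>l\<close> makes the second term small at the price of a large fixed
  factor in front of the first. This free scale lets Young's inequality do the work of Hoelder's for
  limits of pairings.\<close>

lemma young_scaled:
  fixes a b l p q :: real
  assumes p: "1 < p" and q: "q = p / (p - 1)" and l: "0 < l"
  shows "\<bar>a * b\<bar> \<le> l powr p * \<bar>a\<bar> powr p + l powr (- q) * \<bar>b\<bar> powr q"
proof -
  have q1: "1 < q" "1 / p + 1 / q = 1" using p unfolding q by (auto simp: field_simps)
  have "\<bar>a * b\<bar> = (l * \<bar>a\<bar>) * (\<bar>b\<bar> / l)" using l by (simp add: abs_mult)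
  also have "\<dots> \<le> (l * \<bar>a\<bar>) powr p / p + (\<bar>b\<bar> / l) powr q / q"
    using p q1 l by (intro Youngs_inequality) auto
  also have "\<dots> \<le> (l * \<bar>a\<bar>) powr p + (\<bar>b\<bar> / l) powr q"
    using p q1 by (intro add_mono) (auto simp: divide_le_eq mult_le_cancel_left1)
  also have "\<dots> = l powr p * \<bar>a\<bar> powr p + l powr (- q) * \<bar>b\<bar> powr q"
    using l by (simp add: powr_mult powr_divide powr_minus_divide)
  finally show ?thesis .
qed

lemma nn_integral_mult_le:
  fixes f h :: "'a::euclidean_space \<Rightarrow> real"
  assumes [measurable]: "f \<in> borel_measurable lebesgue" "h \<in> borel_measurable lebesgue"
    and p: "1 < p" and q: "q = p / (p - 1)" and l: "0 < l"
  shows "(\<integral>\<^sup>+x. ennreal (norm (f x * h x)) \<partial>lebesgue) \<le> ennreal (l powr p) * modular p f + ennreal (l powr (- q)) * modular q h"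
proof -
  have "(\<integral>\<^sup>+x. ennreal (norm (f x * h x)) \<partial>lebesgue) \<le>
      (\<integral>\<^sup>+x. ennreal (l powr p) * ennreal (norm (f x) powr p) + ennreal (l powr (- q)) * ennreal (norm (h x) powr q) \<partial>lebesgue)"
    using young_scaled[OF p q l]
    by (intro nn_integral_mono) (simp add: ennreal_mult[symmetric] flip: ennreal_plus)
  also have "\<dots> = ennreal (l powr p) * modular p f + ennreal (l powr (- q)) * modular q h"
    unfolding modular_lebesgue by (simp add: nn_integral_add nn_integral_cmult)
  finally show ?thesis .
qed

lemma integrable_mult_conjugate:
  fixes f h :: "'a::euclidean_space \<Rightarrow> real"
  assumes f [measurable]: "f \<in> borel_measurable lebesgue" and h [measurable]: "h \<in> borel_measurable lebesgue"
    and p: "1 < p" and q: "q = p / (p - 1)" and fin: "modular p f < \<infinity>" "modular q h < \<infinity>"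
  shows "integrable lebesgue (\<lambda>x. f x * h x)"
proof (rule integrableI_bounded)
  have "(\<integral>\<^sup>+x. ennreal (norm (f x * h x)) \<partial>lebesgue) \<le> ennreal (1 powr p) * modular p f + ennreal (1 powr (- q)) * modular q h"
    by (rule nn_integral_mult_le[OF f h p q]) simp
  also have "\<dots> < \<infinity>" using fin by simp
  finally show "(\<integral>\<^sup>+x. ennreal (norm (f x * h x)) \<partial>lebesgue) < \<infinity>" .
qed measurable

lemma tendsto_integral_mult:
  fixes f :: "nat \<Rightarrow> 'a::euclidean_space \<Rightarrow> real"
  assumes fm: "\<And>j. f j \<in> borel_measurable lebesgue" and lm: "l \<in> borel_measurable lebesgue"
    and hm: "h \<in> borel_measurable lebesgue" and p: "1 < p" and q: "q = p / (p - 1)"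
    and fin: "\<And>j. modular p (f j) < \<infinity>" "modular p l < \<infinity>" "modular q h < \<infinity>"
    and lim: "(\<lambda>j. modular p (\<lambda>x. f j x - l x)) \<longlonglongrightarrow> 0"
  shows "(\<lambda>j. LINT x|lebesgue. f j x * h x) \<longlonglongrightarrow> (LINT x|lebesgue. l x * h x)"
proof (rule tendsto_L1_int)
  show "integrable lebesgue (\<lambda>x. f j x * h x)" for j
    by (rule integrable_mult_conjugate[OF fm hm p q fin(1) fin(3)])
  show "integrable lebesgue (\<lambda>x. l x * h x)"
    by (rule integrable_mult_conjugate[OF lm hm p q fin(2) fin(3)])
  have eq: "(\<integral>\<^sup>+x. ennreal (norm (f j x * h x - l x * h x)) \<partial>lebesgue) = (\<integral>\<^sup>+x. ennreal (norm ((f j x - l x) * h x)) \<partial>lebesgue)" for j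
    by (simp only: left_diff_distrib)
  obtain N where N: "modular q h = ennreal N" "0 \<le> N" using fin(3) by (cases "modular q h") auto
  have q1: "0 < q" using p q by simp
  show "(\<lambda>j. \<integral>\<^sup>+x. ennreal (norm (f j x * h x - l x * h x)) \<partial>lebesgue) \<longlonglongrightarrow> 0"
    unfolding eq
  proof (rule tendsto_ennreal_0I)
    fix e :: real assume e: "0 < e"
    \<comment> \<open>Solves \<open>t powr (- q) = e / (2 * (N + 1))\<close>, so that the term with
      \<open>h\<close> stays below \<open>e / 2\<close>; only afterwards is \<open>j\<close> taken
      large enough for the other term.\<close>
    define t where "t = (e / (2 * (N + 1))) powr (- 1 / q)"
    have t: "0 < t" using e N by (simp add: t_def)
    have tq: "t powr (- q) = e / (2 * (N + 1))" using q1 e N by (simp add: t_def powr_powr)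
    have tN: "t powr (- q) * N < e / 2" unfolding tq using e N by (simp add: field_simps)
    have "0 < e / (2 * t powr p)" using e t by simp
    from eventually_less_ennreal[OF lim this]
    show "\<forall>\<^sub>F j in sequentially. (\<integral>\<^sup>+x. ennreal (norm ((f j x - l x) * h x)) \<partial>lebesgue) < ennreal e"
    proof eventually_elim
      case (elim j)
      have "(\<integral>\<^sup>+x. ennreal (norm ((f j x - l x) * h x)) \<partial>lebesgue) \<le>
          ennreal (t powr p) * modular p (\<lambda>x. f j x - l x) + ennreal (t powr (- q)) * modular q h"
        by (rule nn_integral_mult_le[OF borel_measurable_diff[OF fm lm] hm p q t])
      also have "\<dots> \<le> ennreal (t powr p) * ennreal (e / (2 * t powr p)) + ennreal (t powr (- q)) * ennreal N"
        by (intro add_mono mult_left_mono) (use elim N in auto)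
      also have "\<dots> = ennreal (t powr p * (e / (2 * t powr p)) + t powr (- q) * N)"
      proof -
        have "0 \<le> e / (2 * t powr p)" using e by simp
        then have "ennreal (t powr p) * ennreal (e / (2 * t powr p)) = ennreal (t powr p * (e / (2 * t powr p)))"
          by (intro ennreal_mult[symmetric] powr_ge_zero)
        moreover have "ennreal (t powr (- q)) * ennreal N = ennreal (t powr (- q) * N)"
          by (intro ennreal_mult[symmetric] powr_ge_zero N)
        ultimately show ?thesis using e N by (simp only: ennreal_plus[symmetric] mult_nonneg_nonneg powr_ge_zero \<open>0 \<le> e / _\<close>)
      qed
      also have "\<dots> < ennreal e" using tN t e by (intro ennreal_lessI) auto
      finally show ?case .
    qed
  qed
qed

lemma Lp_locally_integrable:
  fixes f :: "'a::euclidean_space \<Rightarrow> 'b::euclidean_space"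
  assumes "f \<in> Lp p" "1 \<le> p"
  shows "locally_integrable f"
  unfolding locally_integrable_def set_integrable_def
proof (intro allI impI)
  have fm [measurable]: "f \<in> borel_measurable lebesgue" and fi: "integrable lebesgue (\<lambda>x. norm (f x) powr p)"
    using assms by (auto simp: Lp_def)
  fix K :: "'a set" assume K: "compact K"
  have Kb: "K \<in> sets borel" using K by (intro borel_closed compact_imp_closed)
  then have [measurable]: "K \<in> sets lebesgue" by simp
  have "integrable lebesgue (\<lambda>x. indicator K x :: real)"
    using emeasure_compact_finite[OF K] Kb by (simp add: integrable_indicator_iff)
  then have "integrable lebesgue (\<lambda>x. indicator K x + norm (f x) powr p)"
    using fi by (rule Bochner_Integration.integrable_add)
  then show "integrable lebesgue (\<lambda>x. indicator K x *\<^sub>R f x)"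
  proof (rule Bochner_Integration.integrable_bound)
    show "AE x in lebesgue. norm (indicator K x *\<^sub>R f x) \<le> norm (indicator K x + norm (f x) powr p)"
    proof (rule AE_I2)
      fix x
      show "norm (indicator K x *\<^sub>R f x) \<le> norm (indicator K x + norm (f x) powr p)"
        using le_1_plus_powr[OF assms(2), of "norm (f x)"] by (cases "x \<in> K") auto
    qed
  qed measurable
qed

text \<open>The chosen \<open>weak_gradient\<close> comes with local integrability only; restricting
  it to growing balls gives measurable functions that converge to it pointwise.\<close>

lemma locally_integrable_measurable:
  fixes f :: "'a::euclidean_space \<Rightarrow> 'b::euclidean_space"
  assumes "locally_integrable f"
  shows "f \<in> borel_measurable lebesgue"
proof (rule borel_measurable_LIMSEQ_metric)
  show "(\<lambda>x. indicator (cball 0 (real n)) x *\<^sub>R f x) \<in> borel_measurable lebesgue" for n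
    using assms by (intro borel_measurable_integrable) (auto simp: locally_integrable_def set_integrable_def)
  fix x :: 'a
  obtain N :: nat where N: "norm x \<le> real N" using real_arch_simple by blast
  have "\<forall>\<^sub>F n in sequentially. indicator (cball 0 (real n)) x *\<^sub>R f x = f x"
    using eventually_ge_at_top[of N] by eventually_elim (use N in auto)
  then show "(\<lambda>n. indicator (cball 0 (real n)) x *\<^sub>R f x) \<longlonglongrightarrow> f x" by (rule tendsto_eventually)
qed

text \<open>Integration by parts for the approximating test functions passes to the limit on both
  sides, since \<open>\<phi>\<close> and \<open>frac_op s \<phi>\<close> lie in L^q for the
  conjugate exponent. The right-hand side no longer involves \<open>v\<close>, which is the source
  of uniqueness.\<close>

lemma has_frac_gradient_weak:
  fixes u :: "'a::euclidean_space \<Rightarrow> real"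
  assumes fg: "has_frac_gradient p s u v" and p: "1 < p" and s: "0 < s" "s < 1"
    and \<phi>: "\<phi> \<in> Cc_infinity" and b: "b \<in> Basis"
  shows "(LINT x|lebesgue. (v x \<bullet> b) * \<phi> x) = - (LINT x|lebesgue. u x * (frac_op s \<phi> x \<bullet> b))"
proof -
  define q where "q = p / (p - 1)"
  have q: "1 < q" using p by (simp add: q_def)
  obtain U where U: "\<And>j. U j \<in> Cc_infinity" and T: "tendsto_Lp p U u sequentially"
    "tendsto_Lp p (\<lambda>j. frac_gradient_Cc s (U j)) v sequentially"
    using fg by (auto simp: has_frac_gradient_def)
  have p0: "0 < p" "1 \<le> p" using p by auto
  note UM = Cc_infinity_borel[OF U]
  have u: "u \<in> borel_measurable lebesgue" "modular p u < \<infinity>" "(\<lambda>j. modular p (\<lambda>x. U j x - u x)) \<longlonglongrightarrow> 0"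
    and v: "v \<in> borel_measurable lebesgue" "modular p v < \<infinity>" "(\<lambda>j. modular p (\<lambda>x. frac_op s (U j) x - v x)) \<longlonglongrightarrow> 0"
    using T by (auto simp: tendsto_Lp_iff[OF p0(1)] Lp_iff frac_gradient_Cc_eq[OF UM])
  have DU: "frac_op s (U j) \<in> borel_measurable borel" "modular p (frac_op s (U j)) < \<infinity>" for j
    using frac_op_borel[OF UM] frac_op_modular_finite[OF s p0(2) approximable_Cc_infinity[OF U p0(2)]] by auto
  have D\<phi>: "frac_op s \<phi> \<in> borel_measurable borel" "modular q (frac_op s \<phi>) < \<infinity>"
    using frac_op_borel[OF Cc_infinity_borel[OF \<phi>]] frac_op_modular_finite[OF s _ approximable_Cc_infinity[OF \<phi>, of q]] q by auto
  have inner_fin: "modular r (\<lambda>x. f x \<bullet> b) \<le> modular r f" if "0 \<le> r" for f :: "'a \<Rightarrow> 'a" and r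
    using that by (intro modular_mono AE_I2) (auto intro: Basis_le_norm[OF b])
  have bm: "(\<lambda>x. f x \<bullet> b) \<in> borel_measurable lebesgue" if [measurable]: "f \<in> borel_measurable lebesgue" for f :: "'a \<Rightarrow> 'a"
    by measurable
  have L1: "(\<lambda>j. LINT x|lebesgue. (frac_op s (U j) x \<bullet> b) * \<phi> x) \<longlonglongrightarrow> (LINT x|lebesgue. (v x \<bullet> b) * \<phi> x)"
  proof (rule tendsto_integral_mult[OF _ _ _ p q_def])
    show "(\<lambda>j. modular p (\<lambda>x. frac_op s (U j) x \<bullet> b - v x \<bullet> b)) \<longlonglongrightarrow> 0"
      by (rule tendsto_sandwich[OF _ _ tendsto_const v(3)])
        (use inner_fin[of p "\<lambda>x. frac_op s (U _) x - v x"] p0 in \<open>auto simp: inner_diff_left\<close>)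
    show "modular p (\<lambda>x. frac_op s (U j) x \<bullet> b) < \<infinity>" for j
      by (rule le_less_trans[OF inner_fin DU(2)]) (use p0 in simp)
    show "modular p (\<lambda>x. v x \<bullet> b) < \<infinity>" by (rule le_less_trans[OF inner_fin v(2)]) (use p0 in simp)
    show "modular q \<phi> < \<infinity>" using Cc_infinity_modular_finite[OF \<phi>, of q] q by simp
  qed (intro bm borel_lebesgue DU v Cc_infinity_borel[OF \<phi>])+
  have L2: "(\<lambda>j. LINT x|lebesgue. U j x * (frac_op s \<phi> x \<bullet> b)) \<longlonglongrightarrow> (LINT x|lebesgue. u x * (frac_op s \<phi> x \<bullet> b))"
  proof (rule tendsto_integral_mult[OF _ _ _ p q_def _ _ _ u(3)])
    show "modular p (U j) < \<infinity>" for j using Cc_infinity_modular_finite[OF U, of p] p0 by simp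
    show "modular q (\<lambda>x. frac_op s \<phi> x \<bullet> b) < \<infinity>"
      by (rule le_less_trans[OF inner_fin D\<phi>(2)]) (use q in simp)
  qed (intro bm borel_lebesgue UM u D\<phi>)+
  have "(LINT x|lebesgue. (frac_op s (U j) x \<bullet> b) * \<phi> x) = - (LINT x|lebesgue. U j x * (frac_op s \<phi> x \<bullet> b))" for j
  proof -
    note [measurable] = DU(1)[of j] D\<phi>(1) UM[of j] Cc_infinity_borel[OF \<phi>]
    have "(LINT x|lebesgue. (frac_op s (U j) x \<bullet> b) * \<phi> x) = (LINT x|lborel. (frac_op s (U j) x \<bullet> b) * \<phi> x)"
      by (rule integral_completion) measurable
    also have "\<dots> = - (LINT x|lborel. (frac_op s \<phi> x \<bullet> b) * U j x)"
      by (rule frac_op_integration_by_parts[OF U \<phi> s b])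
    also have "(LINT x|lborel. (frac_op s \<phi> x \<bullet> b) * U j x) = (LINT x|lebesgue. (frac_op s \<phi> x \<bullet> b) * U j x)"
      by (rule integral_completion[symmetric]) measurable
    finally show ?thesis by (simp only: mult.commute)
  qed
  then have "(\<lambda>j. LINT x|lebesgue. (frac_op s (U j) x \<bullet> b) * \<phi> x) \<longlonglongrightarrow> - (LINT x|lebesgue. u x * (frac_op s \<phi> x \<bullet> b))"
    using tendsto_minus[OF L2] by simp
  from LIMSEQ_unique[OF L1 this] show ?thesis .
qed

lemma has_frac_gradient_Lp: "has_frac_gradient p s u v \<Longrightarrow> v \<in> Lp p"
  by (auto simp: has_frac_gradient_def tendsto_Lp_def)

lemma has_frac_gradient_unique:
  assumes "has_frac_gradient p s u v" "has_frac_gradient p s u v'" and p: "1 < p" and s: "0 < s" "s < 1"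
  shows "AE x in lebesgue. v x = v' x"
proof (rule fundamental_lemma)
  have "v \<in> Lp p" "v' \<in> Lp p" using assms by (auto intro: has_frac_gradient_Lp)
  then show "locally_integrable v" "locally_integrable v'" "v \<in> borel_measurable lebesgue" "v' \<in> borel_measurable lebesgue"
    using p Lp_locally_integrable[of v p] Lp_locally_integrable[of v' p] by (auto simp: Lp_def)
qed (simp only: assms(1,2)[THEN has_frac_gradient_weak, OF p s])

lemma has_frac_gradient_cong_AE:
  assumes "has_frac_gradient p s u v" "AE x in lebesgue. u x = u' x" "u' \<in> Lp p" "0 < p"
  shows "has_frac_gradient p s u' v"
proof -
  have "modular p (\<lambda>x. U x - u x) = modular p (\<lambda>x. U x - u' x)" for U :: "'a \<Rightarrow> real"
    by (rule modular_cong_AE) (use assms(2) in \<open>auto elim: eventually_mono\<close>)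
  then show ?thesis
    using assms(1,3) unfolding has_frac_gradient_def tendsto_Lp_iff[OF assms(4)] by auto
qed

theorem theorem3p2:
  fixes p :: real and u :: "'a::euclidean_space \<Rightarrow> real"
  assumes "1 < p" and "u \<in> W1p p"
  shows "tendsto_Lp p (\<lambda>s. frac_gradient p s u) (weak_gradient u) (at_left 1)"
proof -
  have p: "0 < p" "1 \<le> p" using assms(1) by auto
  obtain g where u: "u \<in> Lp p" and g: "g \<in> Lp p" and ug: "has_weak_gradient u g"
    using assms(2) by (auto simp: W1p_def)
  note um = u[unfolded Lp_iff, THEN conjunct1] and gm = g[unfolded Lp_iff, THEN conjunct1]
  obtain u' where u': "u' \<in> borel_measurable borel" "AE x in lebesgue. u x = u' x"
    using borel_representative[OF um] by blast
  obtain g' where g': "g' \<in> borel_measurable borel" "AE x in lebesgue. g x = g' x"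
    using borel_representative[OF gm] by blast
  have fin: "modular p u' < \<infinity>" "modular p g' < \<infinity>"
    using u g modular_cong_AE[OF u'(2), of p] modular_cong_AE[OF g'(2), of p] by (auto simp: Lp_iff)
  have w': "has_weak_gradient u' g'"
    by (rule weak_gradient_cong_AE[OF ug u'(2) g'(2) um u'(1) gm g'(1)])
  have ap: "approximable p u' g'"
    unfolding approximable_def
    using u' g' fin Cc_infinity_dense_Sobolev[OF w' u'(1) g'(1) fin p(2)] by blast
  \<comment> \<open>A choice operator returns only its defining property. Uniqueness then identifies
    the chosen function almost everywhere with the Borel representative \<open>g'\<close>;
    \<open>frac_gradient\<close> is tied to \<open>frac_op s u'\<close> in the same way.\<close>
  have wg: "has_weak_gradient u (weak_gradient u)"
    unfolding weak_gradient_def by (rule someI[where P="has_weak_gradient u", OF ug])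
  have wgm: "weak_gradient u \<in> borel_measurable lebesgue"
    using wg by (intro locally_integrable_measurable) (simp add: has_weak_gradient_def)
  have "AE x in lebesgue. weak_gradient u x = g x"
    by (rule weak_gradient_unique[OF wg ug wgm gm])
  with g'(2) have wg': "AE x in lebesgue. weak_gradient u x = g' x" by eventually_elim simp
  have wgL: "weak_gradient u \<in> Lp p"
    using wgm fin modular_cong_AE[OF wg', of p] by (simp add: Lp_iff)
  have fg: "frac_gradient p s u \<in> Lp p" "AE x in lebesgue. frac_gradient p s u x = frac_op s u' x"
    if s: "0 < s" "s < 1" for s
  proof -
    have "has_frac_gradient p s u' (frac_op s u')" by (rule has_frac_gradient_frac_op[OF s p(2) ap])
    then have op: "has_frac_gradient p s u (frac_op s u')"
      by (rule has_frac_gradient_cong_AE) (use u'(2) u p in \<open>auto elim: eventually_mono\<close>)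
    have "has_frac_gradient p s u (frac_gradient p s u)"
      unfolding frac_gradient_def by (rule someI[where P="has_frac_gradient p s u", OF op])
    then show "frac_gradient p s u \<in> Lp p" "AE x in lebesgue. frac_gradient p s u x = frac_op s u' x"
      using has_frac_gradient_Lp has_frac_gradient_unique[OF _ op assms(1) s] by auto
  qed
  have ev: "\<forall>\<^sub>F s in at_left (1::real). 0 < s \<and> s < 1"
    using eventually_at_left_real[of 0 1] by simp
  show ?thesis
    unfolding tendsto_Lp_iff[OF p(1)]
  proof (intro conjI wgL)
    show "\<forall>\<^sub>F s in at_left 1. frac_gradient p s u \<in> Lp p"
      using ev by eventually_elim (auto intro: fg)
    have "\<forall>\<^sub>F s in at_left 1. modular p (\<lambda>x. frac_op s u' x - g' x) = modular p (\<lambda>x. frac_gradient p s u x - weak_gradient u x)"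
      using ev
    proof eventually_elim
      case (elim s)
      then have "AE x in lebesgue. frac_gradient p s u x = frac_op s u' x" using fg(2) by blast
      with wg' have "AE x in lebesgue. frac_op s u' x - g' x = frac_gradient p s u x - weak_gradient u x"
        by eventually_elim simp
      then show ?case by (rule modular_cong_AE)
    qed
    with frac_op_tendsto_gradient[OF p(2) ap]
    show "((\<lambda>s. modular p (\<lambda>x. frac_gradient p s u x - weak_gradient u x)) \<longlongrightarrow> 0) (at_left 1)"
      by (rule Lim_transform_eventually)
  qed
qed

end
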